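(* Let $Q$ be a real parameter and let $h,u$ be integers with $2 \leqslant h < u \leqslant Q$. Let $\boldsymbol{\alpha} = (\alpha_n)_{u< n \leqslant u+h}$ be any complex numbers with $|\alpha_n| \leqslant 1$ for all $u< n \leqslant u+h$. For a prime $p \geqslant 3$ put \[ S_p(\boldsymbol{\alpha}, u,h) = \sum_{u< n \leqslant u+h} \alpha_n \left(\frac{n}{p}\right), \qquad M_{2}(Q; \boldsymbol{\alpha}, u,h) = \sum_{\substack{p \in [Q,2Q]\\ p~\text{prime}}} |S_p(\boldsymbol{\alpha}, u,h)|^2 . \] Then \[ M_{2}(Q; \boldsymbol{\alpha}, u,h) \ll h\, \pi(Q)\log h + h^2 Q^{7/8+o(1)}, \] where the implied constant is absolute and $o(1)$ denotes a quantity tending to $0$ as $Q \to \infty$, uniformly in $h$, $u$ and $\boldsymbol{\alpha}$.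
   Context: $\left(\frac{n}{p}\right)$ denotes the Legendre symbol modulo the prime $p$. $\pi(Q)$ is the number of primes $p \leqslant Q$. The notation $X \ll Y$ means $|X| \leqslant cY$ for some absolute constant $c>0$. *)

theory Defs
  imports "HOL-Analysis.Analysis" "HOL-Number_Theory.Number_Theory"
begin

definition prime_pi :: "real \<Rightarrow> nat" where
  "prime_pi Q = card {p :: nat. prime p \<and> real p \<le> Q}"

definition S_p :: "int \<Rightarrow> (int \<Rightarrow> complex) \<Rightarrow> int \<Rightarrow> int \<Rightarrow> complex" where
  "S_p p \<alpha> u h = (\<Sum>n\<in>{u<..u+h}. \<alpha> n * of_int (Legendre n p))"

definition M2 :: "real \<Rightarrow> (int \<Rightarrow> complex) \<Rightarrow> int \<Rightarrow> int \<Rightarrow> real" where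
  "M2 Q \<alpha> u h = (\<Sum>p\<in>{p :: int. prime p \<and> Q \<le> real_of_int p \<and> real_of_int p \<le> 2 * Q}.
                    (cmod (S_p p \<alpha> u h))\<^sup>2)"

end

theory Submission
  imports Defs "HOL-Computational_Algebra.Computational_Algebra" "HOL-Real_Asymp.Real_Asymp"
begin

text \<open>
  After extracting squares of 2 and classifying n by the parity of its 2-adic valuation and its odd
  part n' mod 4, quadratic reciprocity writes (n/p) within a class as a factor of modulus at most 1
  depending only on p, times the Jacobi symbol (p/n'). The sum over primes p can then be majorised by
  a sum over all integers m in [Q, 2Q] with Selberg's sieve weights, and after squaring out
  one needs the sums of (m/n'k') over m. The pairs (n, k) with nk a square contribute the main term:
  there are O(h log h) of them, and only the diagonal ones if u >= h^2. For the other pairs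
  Burgess's bound with r = 2, for a modulus of size at most 4 Q^2, gives Q^(7/8 + o(1)).
  If h > Q^(1/8) or u >= h^2, separate choices of the sieve level suffice.
  Burgess's bound rests on a square-root estimate for sums of (f(x)/p) with f cubic, which is proved
  by Stepanov's method.
\<close>

text \<open>The exponent: for a modulus q <= 4 Q^2 and length at most 2 Q, Burgess's N^(1/2)
  q^(3/16) is of size Q^(1/2 + 3/8) = Q^(7/8). Majorising primes by all integers costs a factor log
  Q in the square pairs, where Q would stand in place of pi(Q); Selberg's weights recover it. But
  level D multiplies the bound for the other pairs by D^4, and D must be a power of Q to gain a full
  logarithm. So the weights serve only where the nonsquare pairs lie below h pi(Q) log h with a
  power of Q to spare: for h <= Q^(1/20), and for u < h^2 with h < Q^(1/8), where all moduli are at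
  most 4 Q^(1/2) and periodicity alone suffices. Elsewhere D = 1, and the lost logarithm is absorbed
  either because h Q^(7/8) >= Q, or because log h is comparable to log Q while only diagonal pairs
  are squares. The implied constant must not depend on the loss in the exponent: the estimate is
  proved for each fixed loss \<epsilon> and large Q with one constant, and \<epsilon> is then made
  to tend to 0 slowly with Q.\<close>

hide_const (open) UnivPoly.coeff UnivPoly.monom Module.smult

section \<open>Stepanov's method for cubic polynomials\<close>

lemma pcompose_power_left: "pcompose (A ^ n) B = pcompose A B ^ n" for A B :: "'a :: comm_semiring_1 poly"
  by (induction n) (simp_all add: pcompose_mult pcompose_1)

text \<open>Since the prime p is a variable, polynomials over the field with p elements are represented by
  integer polynomials modulo [:p:]; vanishing to order M is expressed by Taylor coefficients, which
  avoids the factorials that derivatives would introduce.\<close>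

definition vanish_mod :: "int \<Rightarrow> nat \<Rightarrow> int poly \<Rightarrow> int \<Rightarrow> bool" where
  "vanish_mod p M R x \<longleftrightarrow> (\<forall>k<M. p dvd coeff (pcompose R [:x, 1:]) k)"

text \<open>Modulo \<open>p\<close> the factor \<open>U\<close> is invertible as a power series
  because its constant coefficient is a unit; in the convolution for coefficient \<open>k\<close>
  every other term contains an earlier coefficient of \<open>S\<close>.\<close>

lemma vanish_mod_cancel:
  fixes p :: int
  assumes p: "prime p" and U: "\<not> p dvd coeff U 0"
    and v: "\<And>k. k < M \<Longrightarrow> p dvd coeff (U * S) k"
  shows "k < M \<Longrightarrow> p dvd coeff S k"
proof (induction k rule: less_induct)
  case (less k)
  have "coeff (U * S) k = (\<Sum>i\<le>k. coeff U i * coeff S (k - i))"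
    by (rule coeff_mult)
  also have "\<dots> = coeff U 0 * coeff S k + (\<Sum>i\<in>{..k}-{0}. coeff U i * coeff S (k - i))"
    by (subst sum.remove[of _ 0]) auto
  finally have eq: "coeff U 0 * coeff S k = coeff (U * S) k - (\<Sum>i\<in>{..k}-{0}. coeff U i * coeff S (k - i))"
    by simp
  have "p dvd (\<Sum>i\<in>{..k}-{0}. coeff U i * coeff S (k - i))"
    by (intro dvd_sum dvd_mult less) (use less.prems in auto)
  hence "p dvd coeff U 0 * coeff S k"
    unfolding eq using v[OF less.prems] by (simp only: Rings.dvd_diff)
  thus ?case using p U by (simp add: prime_dvd_mult_iff)
qed

text \<open>Divides out (X - x)^M modulo \<open>p\<close>: in the Taylor expansion at
  \<open>x\<close> the first \<open>M\<close> coefficients form a multiple of \<open>p\<close>, and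
  \<open>S\<close> is what remains after they are cut off and the rest is shifted down.\<close>

lemma vanish_mod_factor:
  assumes "\<not> [:p:] dvd (R :: int poly)" and v: "vanish_mod p M R x"
  obtains S where "degree S + M \<le> degree R" "[:p:] dvd R - [:-x, 1:] ^ M * S"
proof
  define T where "T = pcompose R [:x, 1:]"
  define S where "S = pcompose (poly_shift M T) [:-x, 1:]"
  have id: "pcompose (pcompose A [:x, 1:]) [:-x, 1:] = A" "pcompose (pcompose A [:-x, 1:]) [:x, 1:] = A" for A :: "int poly"
    by (simp_all flip: pcompose_assoc add: pcompose_pCons)
  have degT: "degree T = degree R" by (simp add: T_def degree_pcompose)
  have T: "T = monom 1 M * poly_shift M T + poly_cutoff M T"
    by (rule poly_eqI) (auto simp: coeff_monom_mult coeff_poly_shift coeff_poly_cutoff)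
  have cut: "[:p:] dvd poly_cutoff M T"
    using v by (auto simp: const_poly_dvd_iff coeff_poly_cutoff vanish_mod_def T_def)
  have R: "R = [:-x, 1:] ^ M * S + pcompose (poly_cutoff M T) [:-x,1:]"
  proof -
    have "R = pcompose T [:-x, 1:]" by (simp add: T_def id)
    also have "\<dots> = pcompose (monom 1 M * poly_shift M T + poly_cutoff M T) [:-x,1:]"
      using T by simp
    also have "\<dots> = [:-x, 1:] ^ M * S + pcompose (poly_cutoff M T) [:-x,1:]"
      by (simp add: pcompose_add pcompose_mult S_def pcompose_power_left monom_altdef pcompose_smult 
          pcompose_pCons)
    finally show ?thesis .
  qed
  have d: "[:p:] dvd pcompose (poly_cutoff M T) [:-x,1:]"
    using cut by (auto elim!: dvdE simp: pcompose_mult simp del: mult_pCons_left)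
  show "[:p:] dvd R - [:-x, 1:] ^ M * S"
    using d by (subst R) simp
  \<comment> \<open>A coefficient not divisible by \<open>p\<close> must sit at index
    \<open>M\<close> or later. This gives M <= degree R, so the natural subtraction
    \<open>degree R - M\<close> below does not truncate.\<close>
  have "\<not> [:p:] dvd T"
  proof
    assume "[:p:] dvd T"
    hence "[:p:] dvd pcompose T [:-x,1:]" by (auto elim!: dvdE simp: pcompose_mult simp del: mult_pCons_left)
    thus False using assms(1) by (simp add: T_def id)
  qed
  then obtain i where i: "\<not> p dvd coeff T i" by (auto simp: const_poly_dvd_iff)
  have "i \<ge> M" using i v by (force simp: vanish_mod_def T_def not_le[symmetric])
  moreover have "i \<le> degree T" using i by (intro le_degree) auto
  ultimately have MR: "M \<le> degree R" by (simp add: degT)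
  have "degree (poly_shift M T) \<le> degree R - M"
    by (rule degree_le) (auto simp: coeff_poly_shift degT intro!: coeff_eq_0)
  thus "degree S + M \<le> degree R" using MR by (simp add: S_def degree_pcompose)
qed

text \<open>Lagrange's bound with multiplicities. One point is divided out at a time; at another
  point \<open>y\<close> the divisor (X - x)^M has the unit (y - x)^M as constant Taylor
  coefficient, so the order of vanishing there passes to the quotient.\<close>

lemma vanish_mod_card_le:
  fixes R :: "int poly"
  assumes p: "prime p" and "finite A" "A \<subseteq> {0..<p}" "\<And>x. x \<in> A \<Longrightarrow> vanish_mod p M R x"
    and "\<not> [:p:] dvd R"
  shows "M * card A \<le> degree R"
  using assms(2-)
proof (induction A arbitrary: R rule: finite_induct)
  case (insert x A)
  obtain S where S: "degree S + M \<le> degree R" "[:p:] dvd R - [:-x, 1:] ^ M * S"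
    using vanish_mod_factor insert.prems by (metis insertI1)
  have "\<not> [:p:] dvd S"
    using insert.prems(3) S(2) by (metis dvd_add_right_iff dvd_mult diff_add_cancel)
  moreover have "vanish_mod p M S y" if y: "y \<in> A" for y
    unfolding vanish_mod_def
  proof (intro allI impI)
    fix k assume k: "k < M"
    let ?U = "[:y-x, 1:] ^ M"
    obtain W where W: "R - [:-x, 1:] ^ M * S = [:p:] * W" using S(2) by (auto elim!: dvdE)
    have "pcompose (R - [:-x, 1:] ^ M * S) [:y, 1:] = [:p:] * pcompose W [:y,1:]"
      unfolding W by (simp add: pcompose_smult)
    hence eq: "?U * pcompose S [:y,1:] = pcompose R [:y,1:] - [:p:] * pcompose W [:y,1:]"
      by (simp add: pcompose_diff pcompose_mult pcompose_power_left pcompose_pCons algebra_simps)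
    have "p dvd coeff (?U * pcompose S [:y,1:]) k" if "k < M" for k
      unfolding eq using insert.prems(2)[of y] y that by (simp add: vanish_mod_def)
    moreover have "\<not> p dvd coeff ?U 0"
    proof -
      have "x \<noteq> y" "x \<in> {0..<p}" "y \<in> {0..<p}" using insert y by auto
      hence "\<not> p dvd y - x" 
        by (metis atLeastLessThan_iff mod_eq_dvd_iff mod_pos_pos_trivial)
      hence "\<not> p dvd (y - x) ^ M" using p prime_dvd_power by blast
      thus ?thesis by (simp add: coeff_0_power)
    qed
    ultimately show "p dvd coeff (pcompose S [:y,1:]) k"
      using vanish_mod_cancel[OF p] k by blast
  qed
  ultimately have "M * card A \<le> degree S" using insert by auto
  thus ?case using S(1) insert.hyps by simp
qed auto

text \<open>The k-th derivative at \<open>x\<close> is k! times the k-th Taylor coefficient, and k!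
  is invertible modulo \<open>p\<close> for k < M <= p.\<close>

lemma vanish_mod_pderiv:
  fixes R :: "int poly"
  assumes p: "prime p" and "int M \<le> p" 
    and d: "\<And>k. k < M \<Longrightarrow> p dvd poly ((pderiv ^^ k) R) x"
  shows "vanish_mod p M R x"
  unfolding vanish_mod_def
proof (intro allI impI)
  fix k assume k: "k < M"
  have *: "(pderiv ^^ k) (pcompose R [:x, 1:]) = pcompose ((pderiv ^^ k) R) [:x, 1:]" for k
    by (induction k) (simp_all add: pderiv_pcompose pderiv_pCons)
  have "fact k * coeff (pcompose R [:x, 1:]) k = coeff ((pderiv ^^ k) (pcompose R [:x, 1:])) 0"
    by (simp add: coeff_higher_pderiv pochhammer_fact)
  also have "\<dots> = poly ((pderiv ^^ k) R) x" by (simp add: * poly_0_coeff_0[symmetric] poly_pcompose)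
  finally have "p dvd fact k * coeff (pcompose R [:x, 1:]) k" using d[OF k] by simp
  moreover have "\<not> p dvd fact k"
  proof -
    have "\<not> nat p dvd fact k" 
      using p k assms(2) by (subst prime_dvd_fact_iff) (auto simp: nat_le_iff)
    moreover have "p = int (nat p)" using p prime_ge_0_int[of p] by simp
    ultimately show ?thesis by (metis int_dvd_int_iff of_nat_fact)
  qed
  ultimately show "p dvd coeff (pcompose R [:x, 1:]) k" using p by (simp add: prime_dvd_mult_iff)
qed

text \<open>The k-fold operator turns g into f^(k-n) times the k-th derivative of f^n * g, so all
  derivatives stay polynomial after a common power of f is removed.\<close>

definition lop :: "int poly \<Rightarrow> nat \<Rightarrow> int poly \<Rightarrow> int poly" where
  "lop f n h = smult (int n) (pderiv f * h) + f * pderiv h"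

fun lops :: "int poly \<Rightarrow> nat \<Rightarrow> nat \<Rightarrow> int poly \<Rightarrow> int poly" where
  "lops f n 0 h = h"
| "lops f n (Suc k) h = lop f (n - k) (lops f n k h)"

lemma pderiv_power_mult:
  "n > 0 \<Longrightarrow> pderiv (f ^ n * h) = f ^ (n - 1) * lop f n h"
  by (cases n) (simp_all add: lop_def pderiv_mult pderiv_power_Suc algebra_simps del: power_Suc of_nat_Suc,
    simp add: algebra_simps)

lemma higher_pderiv_power_mult:
  "k \<le> n \<Longrightarrow> (pderiv ^^ k) (f ^ n * h) = f ^ (n - k) * lops f n k h"
  by (induction k) (simp_all add: pderiv_power_mult del: of_nat_Suc)

lemma lop_add: "lop f n (g + h) = lop f n g + lop f n h"
  by (simp add: lop_def pderiv_add algebra_simps smult_add_right)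

lemma lop_0 [simp]: "lop f n 0 = 0"
  by (simp add: lop_def)

lemma lop_diff: "lop f n (g - h) = lop f n g - lop f n h"
  by (simp add: lop_def pderiv_diff algebra_simps smult_diff_right)

lemma lops_add: "lops f n k (g + h) = lops f n k g + lops f n k h"
  by (induction k) (simp_all add: lop_add)

lemma lops_diff: "lops f n k (g - h) = lops f n k g - lops f n k h"
  by (induction k) (simp_all add: lop_diff)

lemma lops_0 [simp]: "lops f n k 0 = 0"
  by (induction k) simp_all

lemma lops_sum: "lops f n k (\<Sum>j\<in>A. g j) = (\<Sum>j\<in>A. lops f n k (g j))"
  by (induction A rule: infinite_finite_induct) (simp_all add: lops_add)

lemma degree_lop: "degree f = 3 \<Longrightarrow> degree h \<le> d \<Longrightarrow> degree (lop f n h) \<le> d + 2"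
proof -
  assume f: "degree f = 3" and h: "degree h \<le> d"
  have "degree (smult (int n) (pderiv f * h)) \<le> d + 2"
    by (intro order.trans[OF degree_smult_le] order.trans[OF degree_mult_le])
       (use f h in \<open>auto simp: degree_pderiv\<close>)
  moreover have "degree (f * pderiv h) \<le> d + 2"
  proof (cases "degree h = 0")
    case True
    hence "pderiv h = 0" by (simp add: pderiv_eq_0_iff)
    thus ?thesis by simp
  next
    case False
    show ?thesis
      by (intro order.trans[OF degree_mult_le]) (use f h False in \<open>auto simp: degree_pderiv\<close>)
  qed
  ultimately show "degree (lop f n h) \<le> d + 2" unfolding lop_def by (rule degree_add_le)
qed

lemma degree_lops: "degree f = 3 \<Longrightarrow> degree h \<le> d \<Longrightarrow> degree (lops f n k h) \<le> d + 2 * k"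
  by (induction k) (auto dest!: degree_lop)

lemma pderiv_monom_p: "[:p:] dvd pderiv (monom 1 (nat p * j) :: int poly)"
  by (cases "p \<ge> 0") (auto simp: pderiv_monom const_poly_dvd_iff)

lemma lop_monom: "[:p:] dvd lop f n (h * monom 1 (nat p * j)) - lop f n h * monom 1 (nat p * j)"
proof -
  have "lop f n (h * monom 1 (nat p * j)) - lop f n h * monom 1 (nat p * j)
     = f * h * pderiv (monom 1 (nat p * j))"
    by (simp add: lop_def pderiv_mult algebra_simps)
  thus ?thesis using pderiv_monom_p by (metis dvd_mult)
qed

lemma lop_dvd: "[:p:] dvd g \<Longrightarrow> [:p:] dvd lop f n g"
  by (auto simp: lop_def const_poly_dvd_iff coeff_pderiv coeff_mult intro!: dvd_add dvd_mult dvd_sum)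

text \<open>X^(p*j) has derivative zero modulo \<open>p\<close> and so acts as a constant for the
  operator. High powers of X^p can therefore enter the auxiliary polynomial without raising the
  complexity of its derivatives.\<close>

lemma lops_monom: "[:p:] dvd lops f n k (h * monom 1 (nat p * j)) - lops f n k h * monom 1 (nat p * j)"
proof (induction k)
  case (Suc k)
  let ?X = "monom 1 (nat p * j)"
  have "lops f n (Suc k) (h * ?X) - lops f n (Suc k) h * ?X =
     lop f (n - k) (lops f n k (h * ?X) - lops f n k h * ?X) 
     + (lop f (n - k) (lops f n k h * ?X) - lop f (n-k) (lops f n k h) * ?X)"
    by (simp add: lop_diff)
  thus ?case using lop_dvd[OF Suc] lop_monom[of p f "n-k" "lops f n k h" j] by (simp add: dvd_add del: lops.simps)
qed auto

section \<open>Non-vanishing of the auxiliary polynomial\<close>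

lemma int_poly_mod_reduce:
  fixes r :: "int poly"
  assumes "p > 0" "\<not> [:p:] dvd r"
  obtains r0 where "[:p:] dvd r - r0" "\<not> p dvd lead_coeff r0" "degree r0 \<le> degree r" "r0 \<noteq> 0"
proof
  define r0 where "r0 = map_poly (\<lambda>c. c mod p) r"
  have c: "coeff r0 n = coeff r n mod p" for n by (simp add: r0_def coeff_map_poly)
  show d: "[:p:] dvd r - r0" by (auto simp: const_poly_dvd_iff c minus_mod_eq_mult_div)
  show r0: "r0 \<noteq> 0" using d assms by auto
  show "\<not> p dvd lead_coeff r0"
  proof
    assume "p dvd lead_coeff r0"
    hence "lead_coeff r0 = 0" using c[of "degree r0"] by (metis dvd_imp_mod_0 mod_mod_trivial)
    thus False using r0 by simp
  qed
  show "degree r0 \<le> degree r" by (rule degree_le) (auto simp: c coeff_eq_0)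
qed

text \<open>Over the field with \<open>p\<close> elements f r^2 has odd degree and s^2 even degree,
  so leading terms cannot cancel. Parity of the degree replaces the usual condition that f is not a
  square times a constant, which is why repeated roots are allowed.\<close>

lemma no_odd_square_ratio:
  fixes f r s :: "int poly"
  assumes p: "prime p" and f: "odd (degree f)" "\<not> p dvd lead_coeff f"
    and dv: "[:p:] dvd f * r^2 - s^2"
  shows "[:p:] dvd r \<and> [:p:] dvd s"
proof -
  have pe: "prime_elem [:p:]" using p by (intro lift_prime_elem_poly) auto
  have p0: "p > 0" using p by (simp add: prime_gt_0_int)
  have fn: "\<not> [:p:] dvd f" using f(2) by (auto simp: const_poly_dvd_iff)
  have s: "[:p:] dvd s" if "[:p:] dvd r"
  proof -
    have "[:p:] dvd s^2" using dv that
      by (metis dvd_diff_right_iff dvd_mult dvd_power zero_less_numeral dvd_trans)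
    thus ?thesis using pe prime_elem_dvd_power by blast
  qed
  have r: "[:p:] dvd r" if "[:p:] dvd s"
  proof -
    have "[:p:] dvd f * r^2" using dv that
      by (metis dvd_diff_left_iff dvd_power zero_less_numeral dvd_trans)
    thus ?thesis using pe fn by (metis prime_elem_dvd_mult_iff prime_elem_dvd_power)
  qed
  show ?thesis
  proof (cases "[:p:] dvd r \<or> [:p:] dvd s")
    case False
    obtain r0 where r0: "[:p:] dvd r - r0" "\<not> p dvd lead_coeff r0" "r0 \<noteq> 0"
      using int_poly_mod_reduce[OF p0] False by metis
    obtain s0 where s0: "[:p:] dvd s - s0" "\<not> p dvd lead_coeff s0" "s0 \<noteq> 0"
      using int_poly_mod_reduce[OF p0] False by metis
    have "f * r0^2 - s0^2 = (f * r^2 - s^2) - f * (r + r0) * (r - r0) + (s + s0) * (s - s0)"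
      by (simp add: power2_eq_square algebra_simps)
    hence d: "[:p:] dvd f * r0^2 - s0^2" using dv r0(1) s0(1) by (simp add: dvd_add dvd_diff dvd_mult)
    have f0: "f \<noteq> 0" using f by auto
    have deg: "degree (f * r0^2) = degree f + 2 * degree r0" "degree (s0^2) = 2 * degree s0"
      using f0 r0 by (simp_all add: degree_mult_eq degree_power_eq s0(3))
    have ne: "degree (f * r0^2) \<noteq> degree (s0^2)" using f(1) unfolding deg by presburger
    have l1: "\<not> p dvd lead_coeff (f * r0^2)" using p f(2) r0(2)
      by (simp add: lead_coeff_mult lead_coeff_power prime_dvd_mult_iff prime_dvd_power_iff)
    have l2: "\<not> p dvd lead_coeff (s0^2)" using p s0(2) 
      by (simp add: lead_coeff_power prime_dvd_power_iff)
    have all: "p dvd coeff (f * r0^2) n - coeff (s0^2) n" for n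
      using d by (auto simp: const_poly_dvd_iff)
    have False
    proof (cases "degree (f * r0^2) < degree (s0^2)")
      case True
      thus False using all[of "degree (s0^2)"] l2 by (simp add: coeff_eq_0)
    next
      case False
      hence "degree (f * r0^2) > degree (s0^2)" using ne by simp
      thus False using all[of "degree (f * r0^2)"] l1 by (simp add: coeff_eq_0)
    qed
    thus ?thesis ..
  qed (use r s in blast)
qed

text \<open>Frobenius: with f = 1 + X g the middle binomial coefficients are divisible by
  \<open>p\<close>, so f^p = 1 + X^p g^p modulo \<open>p\<close>. Modulo X^p the power f^p thus
  becomes 1 in \<open>stepanov_nonzero\<close>.\<close>

lemma power_prime_low_coeffs:
  fixes f :: "int poly"
  assumes p: "prime p" and f0: "coeff f 0 = 1"
  obtains T where "[:p:] dvd f ^ nat p - (1 + monom 1 (nat p) * T)"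
proof
  define q where "q = nat p"
  define g where "g = poly_shift 1 f"
  have q: "prime q" "p = int q" "q > 0" using p prime_gt_0_int[of p] by (auto simp: q_def)
  have f: "f = 1 + monom 1 1 * g"
    by (rule poly_eqI) (auto simp: g_def coeff_monom_mult coeff_poly_shift f0 coeff_1 not_less)
  have "f ^ q = (\<Sum>k\<le>q. of_nat (q choose k) * (monom 1 1 * g) ^ k * 1 ^ (q - k))"
    by (subst f, subst add.commute, rule binomial_ring)
  also have "\<dots> = 1 + (monom 1 1 * g)^q + (\<Sum>k\<in>{..q}-{0,q}. of_nat (q choose k) * (monom 1 1 * g) ^ k)"
    using q(3) by (subst sum.subset_diff[of "{0,q}"]) auto
  finally have "f ^ q - (1 + monom 1 q * g ^ q) = (\<Sum>k\<in>{..q}-{0,q}. of_nat (q choose k) * (monom 1 1 * g) ^ k)"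
    by (simp add: power_mult_distrib monom_power)
  moreover have "[:p:] dvd (of_nat (q choose k) :: int poly)" if "k \<in> {..q}-{0,q}" for k
  proof -
    have "k < q" "k \<noteq> 0" "q \<noteq> 0" using that q(3) by auto
    hence "q dvd q choose k" using dvd_choose_prime q(1) by blast
    hence "p dvd int (q choose k)" unfolding q(2) by (simp only: int_dvd_int_iff)
    thus ?thesis unfolding of_nat_poly const_poly_dvd_const_poly_iff by (simp only: of_nat_id)
  qed
  ultimately have "[:p:] dvd f ^ q - (1 + monom 1 q * g ^ q)"
    by (simp only:) (intro dvd_sum dvd_mult2; simp only:)
  thus "[:p:] dvd f ^ nat p - (1 + monom 1 (nat p) * g ^ nat p)"
    by (simp only: q_def)
qed

text \<open>If the sum vanishes modulo \<open>p\<close>, take the least j with \<open>r j\<close> or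
  \<open>s j\<close> nonzero; after division by X^(p*j) there remains r + s f^e = 0 modulo X^p.
  Multiplying by f (r - s f^e) and using f^p = 1 modulo X^p gives f r^2 = s^2 modulo X^p, and the
  degrees are too small for this to be anything but an identity.\<close>

lemma stepanov_nonzero:
  fixes f :: "int poly" and r s :: "nat \<Rightarrow> int poly"
  assumes p: "prime p" and f: "degree f = 3" "\<not> p dvd coeff f 3" "coeff f 0 = 1"
    and B: "2 * int B + 1 < p" and odd: "p = 2 * int e + 1"
    and deg: "\<And>j. j < J \<Longrightarrow> degree (r j) < B" "\<And>j. j < J \<Longrightarrow> degree (s j) < B"
    and dv: "[:p:] dvd (\<Sum>j<J. (r j + s j * f ^ e) * monom 1 (nat p * j))"
  shows "\<forall>j<J. [:p:] dvd r j \<and> [:p:] dvd s j"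
proof (rule ccontr)
  assume contra: "\<not> ?thesis"
  define P where "P = (\<lambda>j. j < J \<and> \<not> ([:p:] dvd r j \<and> [:p:] dvd s j))"
  have "\<exists>j. P j" using contra by (auto simp: P_def)
  then obtain j where j: "P j" "\<And>i. i < j \<Longrightarrow> \<not> P i" using exists_least_iff[of P] by blast
  have jJ: "j < J" using j by (simp add: P_def)
  define q where "q = nat p"
  have q: "p = int q" "q > 0" using p prime_gt_0_int[of p] by (auto simp: q_def)
  define t where "t = (\<lambda>j. r j + s j * f ^ e)"
  have low: "[:p:] dvd (\<Sum>i<j. t i * monom 1 (q * i))"
    using j jJ by (intro dvd_sum dvd_mult2) (auto simp: P_def t_def)
  define W where "W = (\<Sum>i\<in>{j<..<J}. t i * monom 1 (q * (i - j - 1)))"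
  have split: "{..<J} = {..<j} \<union> {j} \<union> {j<..<J}" using jJ by auto
  have hi: "(\<Sum>i\<in>{j<..<J}. t i * monom 1 (q * i)) = monom 1 (q * j) * (monom 1 q * W)"
    unfolding W_def sum_distrib_left
  proof (intro sum.cong refl)
    fix i assume "i \<in> {j<..<J}"
    then obtain k where k: "i = j + 1 + k" by (metis greaterThanLessThan_iff less_imp_Suc_add add_Suc_right Suc_eq_plus1 add_Suc)
    show "t i * monom 1 (q * i) = monom 1 (q * j) * (monom 1 q * (t i * monom 1 (q * (i - j - 1))))"
      by (simp add: k mult_monom algebra_simps)
  qed
  have "(\<Sum>i<J. t i * monom 1 (q * i)) = (\<Sum>i<j. t i * monom 1 (q * i)) + t j * monom 1 (q * j)
      + (\<Sum>i\<in>{j<..<J}. t i * monom 1 (q * i))"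
  proof -
    have "(\<Sum>i<J. t i * monom 1 (q * i)) = (\<Sum>i\<in>{..<j} \<union> {j}. t i * monom 1 (q * i))
      + (\<Sum>i\<in>{j<..<J}. t i * monom 1 (q * i))"
      by (subst split, rule sum.union_disjoint) auto
    moreover have "(\<Sum>i\<in>{..<j} \<union> {j}. t i * monom 1 (q * i)) = (\<Sum>i<j. t i * monom 1 (q * i)) + t j * monom 1 (q * j)"
      by (subst sum.union_disjoint) auto
    ultimately show ?thesis by (simp only:)
  qed
  also have "\<dots> = (\<Sum>i<j. t i * monom 1 (q * i)) + monom 1 (q * j) * (t j + monom 1 q * W)"
    unfolding hi by (simp only: distrib_left mult.commute[of "t j"] add.assoc)
  finally have "(\<Sum>i<J. t i * monom 1 (q * i)) = (\<Sum>i<j. t i * monom 1 (q * i)) + monom 1 (q * j) * (t j + monom 1 q * W)" .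
  hence "[:p:] dvd monom 1 (q * j) * (t j + monom 1 q * W)"
    using dv low by (metis (no_types, lifting) dvd_add_right_iff q_def t_def sum.cong)
  hence m: "p dvd coeff (monom 1 (q * j) * (t j + monom 1 q * W)) n" for n
    by (simp only: const_poly_dvd_iff)
  have "p dvd coeff (t j + monom 1 q * W) n" for n
    using m[of "q * j + n"] by (simp only: coeff_monom_mult) simp
  hence tj: "[:p:] dvd t j + monom 1 q * W"
    unfolding const_poly_dvd_iff by blast
  obtain T where T: "[:p:] dvd f ^ q - (1 + monom 1 q * T)"
    using power_prime_low_coeffs[OF p f(3)] q_def by metis
  have qe: "q = 2 * e + 1" using odd q by simp
  \<comment> \<open>The extra factor f completes f^(2 e) to f^p, since p = 2 e + 1.\<close>
  have "f * t j * (r j - s j * f ^ e) = f * (r j)^2 - (s j)^2 * f ^ q"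
  proof -
    have "f ^ q = f * f ^ e * f ^ e" by (simp add: qe power_add mult_2)
    thus ?thesis by (simp add: t_def power2_eq_square algebra_simps)
  qed
  hence "f * (r j)^2 - (s j)^2 = 
     f * (r j - s j * f ^ e) * (t j + monom 1 q * W) + (s j)^2 * (f ^ q - (1 + monom 1 q * T))
      + monom 1 q * ((s j)^2 * T - f * (r j - s j * f ^ e) * W)"
    by (simp add: algebra_simps)
  hence d: "[:p:] dvd (f * (r j)^2 - (s j)^2) - monom 1 q * ((s j)^2 * T - f * (r j - s j * f ^ e) * W)"
    using tj T by (simp add: dvd_add dvd_mult)
  \<comment> \<open>Coefficients below p are settled by the congruence modulo X^p; from p on they
    are zero because the degree is at most 2 B + 1 < p.\<close>
  have "[:p:] dvd f * (r j)^2 - (s j)^2"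
    unfolding const_poly_dvd_iff
  proof
    fix n
    show "p dvd coeff (f * (r j)^2 - (s j)^2) n"
    proof (cases "n < q")
      case True
      have "coeff (monom 1 q * X) n = 0" for X :: "int poly" using True by (simp add: coeff_monom_mult)
      thus ?thesis using d unfolding const_poly_dvd_iff by (metis coeff_diff diff_zero)
    next
      case False
      have "degree ((r j)^2) \<le> 2 * (B - 1)" "degree ((s j)^2) \<le> 2 * (B - 1)"
        using deg[OF jJ] degree_power_le[of "r j" 2] degree_power_le[of "s j" 2] by auto
      hence "degree (f * (r j)^2) \<le> 3 + 2 * (B - 1)" "degree ((s j)^2) \<le> 3 + 2 * (B - 1)"
        using f(1) degree_mult_le[of f "(r j)^2"] by auto
      moreover have "3 + 2 * (B - 1) \<le> 2 * B + 1" using deg[OF jJ] by simp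
      ultimately have "degree (f * (r j)^2 - (s j)^2) \<le> 2 * B + 1"
        using degree_diff_le order.trans by blast
      hence "degree (f * (r j)^2 - (s j)^2) < n" using False B q by linarith
      thus ?thesis by (simp only: coeff_eq_0 dvd_0_right)
    qed
  qed
  hence "[:p:] dvd r j \<and> [:p:] dvd s j" using f by (intro no_odd_square_ratio[OF p, of f]) auto
  thus False using j by (auto simp: P_def)
qed

section \<open>Construction and vanishing of the auxiliary polynomial\<close>

lemma int_power_prime_cong:
  fixes x :: int
  assumes p: "prime p"
  shows "[x ^ nat p = x] (mod p)"
proof (cases "p dvd x")
  case True
  hence "p dvd x ^ nat p" using p prime_gt_0_int[of p] by (intro dvd_trans[OF True dvd_power]) auto
  thus ?thesis using True by (simp add: cong_iff_dvd_diff)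
next
  case False
  define q where "q = nat p"
  have q: "p = int q" "prime q" using p prime_gt_0_int[of p] by (auto simp: q_def)
  define n where "n = nat (x mod p)"
  have xn: "[x = int n] (mod int q)" using q prime_gt_0_int[of p] p by (simp add: n_def cong_def)
  have "coprime x (int q)" using False p q
    by (metis coprime_commute prime_imp_coprime)
  hence "coprime n q" using xn by (metis cong_imp_coprime coprime_int_iff)
  hence "[n ^ totient q = 1] (mod q)" by (rule euler_theorem)
  hence "[int n ^ totient q = 1] (mod int q)" by (metis cong_int_iff of_nat_1 of_nat_power)
  hence "[x ^ totient q = 1] (mod int q)" using xn by (metis cong_pow cong_trans)
  hence "[x ^ totient q * x = 1 * x] (mod int q)" by (rule cong_mult) simp
  moreover have "x ^ totient q * x = x ^ q" using q(2) prime_gt_0_nat[of q]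
    by (simp add: totient_prime flip: power_Suc2)
  ultimately show ?thesis by (simp add: q_def[symmetric] q(1))
qed

text \<open>The unknowns of a linear system: \<open>c (t, j, i)\<close> is the coefficient of X^i in
  the factor of X^(p*j), in the family \<open>r\<close> for t = 0 and in the family \<open>s\<close>
  for t = 1.\<close>

definition coeff_poly :: "(nat \<times> nat \<times> nat \<Rightarrow> int) \<Rightarrow> nat \<Rightarrow> nat \<Rightarrow> nat \<Rightarrow> int poly" where
  "coeff_poly c B t j = (\<Sum>i<B. monom (c (t, j, i)) i)"

lemma coeff_coeff_poly: "coeff (coeff_poly c B t j) i = (if i < B then c (t, j, i) else 0)"
proof -
  have "coeff (coeff_poly c B t j) i = (\<Sum>i'<B. if i' = i then c (t, j, i') else 0)"
    by (simp add: coeff_poly_def coeff_sum)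
  also have "\<dots> = (if i < B then c (t, j, i) else 0)"
    by (subst sum.delta) auto
  finally show ?thesis .
qed

lemma degree_coeff_poly: "B > 0 \<Longrightarrow> degree (coeff_poly c B t j) < B"
proof -
  assume "B > 0"
  moreover have "degree (coeff_poly c B t j) \<le> B - 1"
    by (rule degree_le) (auto simp: coeff_coeff_poly)
  ultimately show ?thesis by simp
qed

text \<open>The k-th derivative of f^M times the sum of (r j + s j f^e) X^(p*j), read at a point x
  with f(x)^e = a: stripped of f^(M-k) and with x^p replaced by x. Its degree is about B + 2 k + J
  instead of p J, and this drop makes the linear system solvable.\<close>

definition stepanov_poly :: "int poly \<Rightarrow> nat \<Rightarrow> nat \<Rightarrow> int \<Rightarrow> nat \<Rightarrow> nat \<Rightarrow> (nat \<Rightarrow> int poly) \<Rightarrow> (nat \<Rightarrow> int poly) \<Rightarrow> int poly" where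
  "stepanov_poly f M e a J k r s =
     (\<Sum>j<J. (lops f M k (r j) + smult a (lops f (M + e) k (s j))) * monom 1 j)"

lemma degree_stepanov_poly:
  assumes "degree f = 3" "\<And>j. j < J \<Longrightarrow> degree (r j) < B" "\<And>j. j < J \<Longrightarrow> degree (s j) < B" "J > 0"
  shows "degree (stepanov_poly f M e a J k r s) < B + 2 * k + J"
proof -
  have B: "B > 0" using assms(2)[OF assms(4)] by simp
  have "degree (stepanov_poly f M e a J k r s) \<le> B - 1 + 2 * k + (J - 1)"
    unfolding stepanov_poly_def
  proof (rule degree_sum_le, simp)
    fix j assume "j \<in> {..<J}"
    hence j: "j < J" by simp
    have "degree (lops f M k (r j) + smult a (lops f (M + e) k (s j))) \<le> B - 1 + 2 * k"
      using assms(2,3)[OF j] B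
      by (intro degree_add_le order.trans[OF degree_smult_le] degree_lops assms) auto
    moreover have "degree (monom (1::int) j) \<le> J - 1" using j by (simp add: degree_monom_eq)
    ultimately show "degree ((lops f M k (r j) + smult a (lops f (M + e) k (s j))) * monom 1 j) \<le> B - 1 + 2 * k + (J - 1)"
      by (intro order.trans[OF degree_mult_le] add_mono)
  qed
  thus ?thesis using B assms(4) by linarith
qed

text \<open>More unknowns than equations: vanishing of the reduced polynomials for all k < 2 L is a
  homogeneous system modulo \<open>p\<close>. In place of linear algebra there is a pigeonhole
  argument: two coefficient vectors with entries in [0, p) have the same image, and their difference
  is the solution.\<close>

lemma stepanov_solution:
  fixes f :: "int poly" and a :: int
  assumes p: "prime p" and f: "degree f = 3" and L: "L > 0" and odd: "p = 2 * int e + 1" and "16 * (int L)^2 \<le> p"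
  obtains r s where "\<And>j. j < L + 1 \<Longrightarrow> degree (r j) < e - 1" "\<And>j. j < L + 1 \<Longrightarrow> degree (s j) < e - 1"
     "\<And>k. k < 2 * L \<Longrightarrow> [:p:] dvd stepanov_poly f (2*L) e a (L+1) k r s"
     "\<not> (\<forall>j<L+1. [:p:] dvd r j \<and> [:p:] dvd s j)"
proof -
  define q where "q = nat p"
  have q: "p = int q" "q > 0" "q > 1" using p prime_gt_1_int[of p] by (auto simp: q_def)
  define B where "B = e - 1"
  define M where "M = 2 * L"
  define J where "J = L + 1"
  have "16 * int (L^2) \<le> 2 * int e + 1" using assms by simp
  hence e: "8 * L^2 \<le> e" by linarith
  have LL: "L \<le> L^2" by (simp add: power2_eq_square)
  have B: "B > 0" "B + 1 = e" using e LL L unfolding B_def by linarith+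
  define X where "X = {..<2::nat} \<times> {..<J} \<times> {..<B}"
  define Y where "Y = {..<M} \<times> {..<B + 2 * M + J}"
  define F where "F = PiE X (\<lambda>_. {0..<p})"
  define \<Phi> where "\<Phi> = (\<lambda>c. restrict (\<lambda>(k,i). coeff (stepanov_poly f M e a J k (coeff_poly c B 0) (coeff_poly c B 1)) i mod p) Y)"
  have fin: "finite X" "finite Y" by (auto simp: X_def Y_def)
  \<comment> \<open>There are 2 (L + 1) B unknowns and 2 L (B + 5 L + 1) equations, so B > 5 L^2 + L
    is needed, which e >= 8 L^2 provides.\<close>
  have "card X > card Y"
  proof -
    have "card X = 2 * (L * B + B)" by (simp add: X_def card_cartesian_product J_def)
    moreover have "card Y = 2 * (L * B + (5 * L^2 + L))" by (simp add: Y_def card_cartesian_product M_def J_def algebra_simps power2_eq_square)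
    moreover have "B > 5 * L^2 + L" using e LL L B by linarith
    ultimately show ?thesis by simp
  qed
  have "card F = q ^ card X" using fin by (simp add: F_def card_PiE q)
  moreover have "card (PiE Y (\<lambda>_. {0..<p})) = q ^ card Y" using fin by (simp add: card_PiE q)
  moreover have "q ^ card X > q ^ card Y" using \<open>card X > card Y\<close> q by simp
  ultimately have "card (PiE Y (\<lambda>_. {0..<p})) < card F" by simp
  moreover have "\<Phi> ` F \<subseteq> PiE Y (\<lambda>_. {0..<p})"
    using q by (auto simp: \<Phi>_def)
  moreover have "finite (PiE Y (\<lambda>_. {0..<p}))" using fin by (intro finite_PiE) auto
  ultimately have "\<not> inj_on \<Phi> F" by (meson card_inj_on_le leD)
  then obtain c d where cd: "c \<in> F" "d \<in> F" "c \<noteq> d" "\<Phi> c = \<Phi> d" by (auto simp: inj_on_def)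
  define r where "r = (\<lambda>j. coeff_poly c B 0 j - coeff_poly d B 0 j)"
  define s where "s = (\<lambda>j. coeff_poly c B 1 j - coeff_poly d B 1 j)"
  have deg: "degree (r j) < B" "degree (s j) < B" for j
    unfolding r_def s_def using B by (auto intro!: degree_diff_less degree_coeff_poly)
  have eq: "stepanov_poly f M e a J k r s = stepanov_poly f M e a J k (coeff_poly c B 0) (coeff_poly c B 1)
      - stepanov_poly f M e a J k (coeff_poly d B 0) (coeff_poly d B 1)" for k
    by (simp add: stepanov_poly_def r_def s_def lops_diff smult_diff_right algebra_simps sum_subtractf sum.distrib)
  have "[:p:] dvd stepanov_poly f M e a J k r s" if k: "k < M" for k
    unfolding const_poly_dvd_iff
  proof
    fix i
    show "p dvd coeff (stepanov_poly f M e a J k r s) i"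
    proof (cases "i < B + 2 * M + J")
      case True
      hence "(k, i) \<in> Y" using k by (simp add: Y_def)
      hence "coeff (stepanov_poly f M e a J k (coeff_poly c B 0) (coeff_poly c B 1)) i mod p
           = coeff (stepanov_poly f M e a J k (coeff_poly d B 0) (coeff_poly d B 1)) i mod p"
        using fun_cong[OF cd(4), of "(k,i)"] by (simp add: \<Phi>_def)
      thus ?thesis unfolding eq by (simp add: mod_eq_dvd_iff)
    next
      case False
      have "degree (stepanov_poly f M e a J k r s) < B + 2 * k + J"
        by (rule degree_stepanov_poly) (use f deg in \<open>auto simp: J_def\<close>)
      hence "degree (stepanov_poly f M e a J k r s) < i" using False k by simp
      thus ?thesis by (simp add: coeff_eq_0)
    qed
  qed
  moreover have "\<not> (\<forall>j<J. [:p:] dvd r j \<and> [:p:] dvd s j)"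
  proof
    assume A: "\<forall>j<J. [:p:] dvd r j \<and> [:p:] dvd s j"
    have "c x = d x" if x: "x \<in> X" for x
    proof -
      obtain t j i where x': "x = (t, j, i)" "t < 2" "j < J" "i < B" using x by (auto simp: X_def)
      have "p dvd c x - d x"
      proof (cases "t = 0")
        case True
        have "p dvd coeff (r j) i" using A x' by (simp add: const_poly_dvd_iff)
        thus ?thesis using True x' by (simp add: r_def coeff_coeff_poly)
      next
        case False
        hence t: "t = 1" using x' by simp
        have "p dvd coeff (s j) i" using A x' by (simp add: const_poly_dvd_iff)
        thus ?thesis using t x' by (simp add: s_def coeff_coeff_poly)
      qed
      moreover have "c x \<in> {0..<p}" "d x \<in> {0..<p}" using cd x by (auto simp: F_def)
      ultimately show ?thesis by (metis atLeastLessThan_iff mod_eq_dvd_iff mod_pos_pos_trivial)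
    qed
    hence "c = d" using cd(1,2) unfolding F_def by (intro PiE_ext)
    thus False using cd by simp
  qed
  ultimately show ?thesis using that[of r s] deg unfolding B_def M_def J_def by blast
qed

text \<open>At such a point the k-th derivative is f(x)^(M-k) times the value of the reduced
  polynomial, because f(x)^(M+e-k) = f(x)^(M-k) a and x^p = x modulo \<open>p\<close>.\<close>

lemma stepanov_vanish:
  fixes f :: "int poly" and r s :: "nat \<Rightarrow> int poly"
  assumes p: "prime p" and k: "k \<le> M" and x: "[poly f x ^ e = a] (mod p)"
    and dv: "[:p:] dvd stepanov_poly f M e a J k r s"
  shows "p dvd poly ((pderiv ^^ k) (f ^ M * (\<Sum>j<J. (r j + s j * f ^ e) * monom 1 (nat p * j)))) x"
proof -
  define A where "A = (\<lambda>r :: nat \<Rightarrow> int poly. \<Sum>j<J. r j * monom 1 (nat p * j))"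
  have "f ^ M * (\<Sum>j<J. (r j + s j * f ^ e) * monom 1 (nat p * j)) = f ^ M * A r + f ^ (M + e) * A s"
    by (simp add: A_def sum.distrib distrib_left distrib_right sum_distrib_left power_add mult_ac)
  hence 1: "(pderiv ^^ k) (f ^ M * (\<Sum>j<J. (r j + s j * f ^ e) * monom 1 (nat p * j))) =
     f ^ (M - k) * lops f M k (A r) + f ^ (M + e - k) * lops f (M + e) k (A s)"
    using k by (simp add: higher_pderiv_power_mult higher_pderiv_add)
  have 2: "[poly (lops f n k (A r)) x = (\<Sum>j<J. poly (lops f n k (r j)) x * x ^ j)] (mod p)" for r n
  proof -
    have "[:p:] dvd (\<Sum>j<J. lops f n k (r j * monom 1 (nat p * j)) - lops f n k (r j) * monom 1 (nat p * j))"
      by (intro dvd_sum lops_monom)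
    then obtain W where W: "lops f n k (A r) - (\<Sum>j<J. lops f n k (r j) * monom 1 (nat p * j)) = [:p:] * W"
      by (auto simp: A_def lops_sum sum_subtractf elim!: dvdE)
    have "poly (lops f n k (A r)) x - (\<Sum>j<J. poly (lops f n k (r j)) x * x ^ (nat p * j)) = p * poly W x"
      using arg_cong[OF W, of "\<lambda>P. poly P x"] by (simp add: poly_sum poly_monom)
    hence "[poly (lops f n k (A r)) x = (\<Sum>j<J. poly (lops f n k (r j)) x * x ^ (nat p * j))] (mod p)"
      by (auto simp: cong_iff_dvd_diff)
    moreover have "[(\<Sum>j<J. poly (lops f n k (r j)) x * x ^ (nat p * j)) = (\<Sum>j<J. poly (lops f n k (r j)) x * x ^ j)] (mod p)"
      by (intro cong_sum cong_mult cong_refl) (simp add: power_mult cong_pow int_power_prime_cong[OF p])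
    ultimately show ?thesis by (rule cong_trans)
  qed
  have "[poly f x ^ (M + e - k) = poly f x ^ (M - k) * a] (mod p)"
    using k cong_scalar_left[OF x, of "poly f x ^ (M - k)"] by (simp flip: power_add)
  hence "[poly f x ^ (M - k) * poly (lops f M k (A r)) x + poly f x ^ (M + e - k) * poly (lops f (M + e) k (A s)) x
     = poly f x ^ (M - k) * (\<Sum>j<J. poly (lops f M k (r j)) x * x ^ j) 
       + poly f x ^ (M - k) * a * (\<Sum>j<J. poly (lops f (M + e) k (s j)) x * x ^ j)] (mod p)"
    by (intro cong_add cong_mult cong_refl 2)
  also have "poly f x ^ (M - k) * (\<Sum>j<J. poly (lops f M k (r j)) x * x ^ j) 
       + poly f x ^ (M - k) * a * (\<Sum>j<J. poly (lops f (M + e) k (s j)) x * x ^ j)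
     = poly f x ^ (M - k) * poly (stepanov_poly f M e a J k r s) x"
    by (simp add: stepanov_poly_def poly_sum poly_monom sum.distrib sum_distrib_left algebra_simps)
  also have "[\<dots> = 0] (mod p)"
    using dv by (auto simp: cong_0_iff elim!: dvdE)
  finally show ?thesis unfolding 1 by (simp add: cong_0_iff)
qed

text \<open>Vanishing order 2 L at each counted point is set against a degree of at most 6 L + 4 e +
  p L, where 4 e < 2 p. After division by 2 L the count is at most p/2 + p/L + 3.\<close>

lemma stepanov_count:
  fixes f :: "int poly" and a :: int
  assumes p: "prime p" and f: "degree f = 3" "\<not> p dvd coeff f 3" "coeff f 0 = 1" 
    and L: "L > 0" and odd: "p = 2 * int e + 1" and Lp: "16 * (int L)^2 \<le> p"
  shows "2 * int L * int (card {x\<in>{0..<p}. [poly f x ^ e = a] (mod p)}) \<le> p * int L + 2 * p + 6 * int L"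
proof -
  obtain r s where rs: "\<And>j. j < L + 1 \<Longrightarrow> degree (r j) < e - 1" "\<And>j. j < L + 1 \<Longrightarrow> degree (s j) < e - 1"
     "\<And>k. k < 2 * L \<Longrightarrow> [:p:] dvd stepanov_poly f (2*L) e a (L+1) k r s"
     "\<not> (\<forall>j<L+1. [:p:] dvd r j \<and> [:p:] dvd s j)"
    using stepanov_solution[OF p f(1) L odd Lp, of a] by metis
  define J where "J = L + 1"
  define S where "S = (\<Sum>j<J. (r j + s j * f ^ e) * monom 1 (nat p * j))"
  define R where "R = f ^ (2 * L) * S"
  have pe: "prime_elem [:p:]" using p by (intro lift_prime_elem_poly) auto
  have e1: "e > 1" using rs(1)[of 0] by simp
  have "\<not> [:p:] dvd S"
    using stepanov_nonzero[OF p f, of "e - 1" e J r s] rs odd e1 unfolding S_def J_def by force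
  moreover have "\<not> [:p:] dvd f" using f by (auto simp: const_poly_dvd_iff)
  ultimately have nR: "\<not> [:p:] dvd R" unfolding R_def
    using pe by (metis prime_elem_dvd_mult_iff prime_elem_dvd_power)
  have L1: "int L \<le> (int L)^2" using L by (simp add: power2_eq_square flip: of_nat_mult)
  have "vanish_mod p (2 * L) R x" if "x \<in> {x\<in>{0..<p}. [poly f x ^ e = a] (mod p)}" for x
  proof (rule vanish_mod_pderiv[OF p])
    show "int (2 * L) \<le> p" using Lp L1 L by (simp only: of_nat_mult)
    fix k assume "k < 2 * L"
    thus "p dvd poly ((pderiv ^^ k) R) x"
      unfolding R_def S_def using that rs(3) by (intro stepanov_vanish[OF p]) (auto simp: J_def)
  qed
  hence "2 * L * card {x\<in>{0..<p}. [poly f x ^ e = a] (mod p)} \<le> degree R"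
    using nR by (intro vanish_mod_card_le[OF p] finite_subset[of "{x\<in>{0..<p}. [poly f x ^ e = a] (mod p)}" "{0..<p}"]) auto
  also have "degree R \<le> 2 * L * 3 + (3 * e + e + nat p * L)"
  proof -
    have "degree S \<le> 3 * e + e + nat p * L"
      unfolding S_def
    proof (rule degree_sum_le, simp)
      fix j assume "j \<in> {..<J}"
      hence j: "j < L + 1" by (simp add: J_def)
      have "degree (f ^ e) \<le> 3 * e" using degree_power_le[of f e] f by simp
      hence "degree (s j * f ^ e) \<le> 3 * e + e" 
        using rs(2)[OF j] by (intro order.trans[OF degree_mult_le]) auto
      hence "degree (r j + s j * f ^ e) \<le> 3 * e + e"
        using rs(1)[OF j] by (intro degree_add_le) auto
      moreover have "degree (monom (1::int) (nat p * j)) \<le> nat p * L" using j by (simp add: degree_monom_eq)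
      ultimately show "degree ((r j + s j * f ^ e) * monom 1 (nat p * j)) \<le> 3 * e + e + nat p * L"
        by (intro order.trans[OF degree_mult_le] add_mono)
    qed
    moreover have "degree (f ^ (2 * L)) \<le> 2 * L * 3" using degree_power_le[of f "2 * L"] f by simp
    ultimately show ?thesis unfolding R_def by (intro order.trans[OF degree_mult_le] add_mono)
  qed
  finally have "int (2 * L * card {x\<in>{0..<p}. [poly f x ^ e = a] (mod p)}) \<le> int (2 * L * 3 + (3 * e + e + nat p * L))"
    by (simp only: of_nat_le_iff)
  thus ?thesis using odd by (simp add: algebra_simps)
qed


section \<open>From point counts to character sums of cubics\<close>

lemma Legendre_values: "Legendre a p \<in> {-1, 0, 1}"
  by (auto simp: Legendre_def)

lemma Legendre_eq_0_iff: "Legendre a p = 0 \<longleftrightarrow> p dvd a"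
  by (auto simp: Legendre_def cong_0_iff)

lemma euler_criterion_int:
  assumes "prime p" "p = 2 * int e + 1"
  shows "[Legendre a p = a ^ e] (mod p)"
proof -
  define q where "q = nat p"
  have q: "p = int q" "prime q" using assms prime_gt_0_int[of p] by (auto simp: q_def)
  have "e > 0" using prime_gt_1_int[OF assms(1)] assms(2) by simp
  moreover have "(q - 1) div 2 = e" using assms(2) q by simp
  ultimately show ?thesis using euler_criterion[of q a] q assms(2) by simp
qed

lemma Legendre_eq_iff_power:
  assumes "prime p" "p = 2 * int e + 1" "c = 1 \<or> c = -1"
  shows "Legendre a p = c \<longleftrightarrow> [a ^ e = c] (mod p)"
proof
  assume "Legendre a p = c"
  thus "[a ^ e = c] (mod p)" using euler_criterion_int[OF assms(1,2), of a] by (simp add: cong_sym_eq)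
next
  assume "[a ^ e = c] (mod p)"
  hence "[Legendre a p = c] (mod p)" using euler_criterion_int[OF assms(1,2), of a] cong_trans by blast
  have "e \<noteq> 0" using prime_gt_1_int[OF assms(1)] assms(2) by (intro notI) simp
  hence "p > 2" using assms(2) by linarith
  with \<open>[Legendre a p = c] (mod p)\<close> have "p dvd Legendre a p - c" "\<bar>Legendre a p - c\<bar> < p"
    using Legendre_values[of a p] assms(3) by (auto simp: cong_iff_dvd_diff)
  thus "Legendre a p = c" using zdvd_not_zless[of "\<bar>Legendre a p - c\<bar>" p] by fastforce
qed

lemma odd_prime_int_half:
  assumes "prime p" "p > (2::int)"
  obtains e where "p = 2 * int e + 1"
proof -
  have "odd p" using assms prime_odd_int by auto
  then obtain k where "p = 2 * k + 1" by (auto elim: oddE)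
  thus ?thesis using that[of "nat k"] assms by simp
qed

text \<open>The counts of symbol 1 and symbol -1 are bounded from above only; since they and at most
  three zeros add up to p, an upper bound for one count is a lower bound for the other.\<close>

lemma sum_Legendre_cubic_bound:
  fixes f :: "int poly"
  assumes p: "prime p" "p > 2" and f: "degree f = 3" "\<not> p dvd coeff f 3" "coeff f 0 = 1"
  shows "\<bar>\<Sum>x\<in>{0..<p}. real_of_int (Legendre (poly f x) p)\<bar> \<le> 25 * sqrt (real_of_int p)"
proof -
  obtain e where e: "p = 2 * int e + 1" using odd_prime_int_half[OF p] .
  define N where "N = (\<lambda>a. {x\<in>{0..<p}. Legendre (poly f x) p = a})"
  have U: "{0..<p} = N 1 \<union> N (-1) \<union> N 0" using Legendre_values by (auto simp: N_def)
  have fin: "finite (N a)" for a by (rule finite_subset[of _ "{0..<p}"]) (auto simp: N_def)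
  have dis: "N 1 \<inter> N (-1) = {}" "(N 1 \<union> N (-1)) \<inter> N 0 = {}" by (auto simp: N_def)
  have tot: "nat p = card (N 1) + card (N (-1)) + card (N 0)"
    using arg_cong[OF U, of card] fin dis by (simp add: card_Un_disjoint)
  have "(\<Sum>x\<in>{0..<p}. real_of_int (Legendre (poly f x) p)) =
     (\<Sum>x\<in>N 1. real_of_int (Legendre (poly f x) p)) + (\<Sum>x\<in>N (-1). real_of_int (Legendre (poly f x) p))
     + (\<Sum>x\<in>N 0. real_of_int (Legendre (poly f x) p))"
    unfolding U using fin dis by (simp add: sum.union_disjoint)
  also have "\<dots> = real (card (N 1)) - real (card (N (-1)))"
    by (simp add: N_def)
  finally have sum: "(\<Sum>x\<in>{0..<p}. real_of_int (Legendre (poly f x) p)) = real (card (N 1)) - real (card (N (-1)))" .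
  show ?thesis
  \<comment> \<open>From p = 64 on, rounding sqrt p / 4 down still leaves L >= sqrt p / 8.\<close>
  proof (cases "p < 64")
    case True
    have "\<bar>real (card (N 1)) - real (card (N (-1)))\<bar> \<le> real_of_int p" using tot p by linarith
    also have "real_of_int p = sqrt p * sqrt p" using p by simp
    also have "\<dots> \<le> 25 * sqrt p"
      using True p by (intro mult_right_mono) (auto intro!: real_le_lsqrt)
    finally show ?thesis unfolding sum .
  next
    case False
    \<comment> \<open>The largest \<open>L\<close> with 16 L^2 <= p; it makes p/L of order sqrt
      p.\<close>
    define L where "L = nat \<lfloor>sqrt p / 4\<rfloor>"
    have s8: "sqrt p \<ge> 8" using False by (intro real_le_rsqrt) auto
    have L: "real L \<le> sqrt p / 4" "real L > sqrt p / 4 - 1" unfolding L_def using s8 by linarith+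
    have L8: "real L \<ge> sqrt p / 8" using L s8 by linarith
    have L0: "L > 0" using L8 s8 p by (intro Nat.gr0I) auto
    have "(real L)^2 \<le> (sqrt p / 4)^2" using L by (intro power_mono) auto
    hence "16 * (real L)^2 \<le> real_of_int p" using p by (simp add: power_divide)
    hence L16: "16 * (int L)^2 \<le> p" by (metis (mono_tags, lifting) of_int_le_iff of_int_mult of_int_numeral of_int_of_nat_eq of_int_power)
    have cnt: "real (card (N a)) \<le> real_of_int p / 2 + 8 * sqrt p + 3" if a: "a = 1 \<or> a = -1" for a
    proof -
      have "N a = {x\<in>{0..<p}. [poly f x ^ e = a] (mod p)}"
        unfolding N_def using Legendre_eq_iff_power[OF p(1) e a] by simp
      hence "2 * int L * int (card (N a)) \<le> p * int L + 2 * p + 6 * int L"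
        using stepanov_count[OF p(1) f L0 e L16, of a] by simp
      hence "real_of_int (2 * int L * int (card (N a))) \<le> real_of_int (p * int L + 2 * p + 6 * int L)"
        by (simp only: of_int_le_iff)
      hence "2 * real L * real (card (N a)) \<le> p * real L + 2 * p + 6 * real L" by simp
      hence "real (card (N a)) \<le> p / 2 + p / real L + 3" using L0 by (simp add: field_simps)
      moreover have "p / real L \<le> 8 * sqrt p"
      proof -
        have "real_of_int p = sqrt p * sqrt p" using p by simp
        also have "\<dots> \<le> sqrt p * (8 * real L)" using L8 s8 p by (intro mult_left_mono) auto
        finally show ?thesis using L0 by (simp add: field_simps)
      qed
      ultimately show ?thesis by linarith
    qed
    have "1 * card (N 0) \<le> degree f"
    proof (rule vanish_mod_card_le[OF p(1)])
      show "\<not> [:p:] dvd f" using f by (auto simp: const_poly_dvd_iff)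
      fix x assume "x \<in> N 0"
      hence "p dvd poly f x" by (simp add: N_def Legendre_eq_0_iff)
      thus "vanish_mod p 1 f x" by (simp add: vanish_mod_def poly_0_coeff_0[symmetric] poly_pcompose)
    qed (use fin[of 0] in \<open>auto simp: N_def\<close>)
    hence N0: "real (card (N 0)) \<le> 3" using f by simp
    have tot': "real_of_int p = real (card (N 1)) + real (card (N (-1))) + real (card (N 0))"
      using tot p by linarith
    \<comment> \<open>Twice the excess 8 sqrt p + 3 plus the three zeros: 16 sqrt p + 9 <= 25 sqrt
      p.\<close>
    have "\<bar>real (card (N 1)) - real (card (N (-1)))\<bar> \<le> 25 * sqrt p"
      using cnt[of 1, simplified] cnt[of "-1", simplified] tot' N0 s8 by linarith
    thus ?thesis unfolding sum .
  qed
qed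

section \<open>Complete sums of Legendre symbols\<close>

lemma Legendre_cong: "[a = b] (mod p) \<Longrightarrow> Legendre a p = Legendre b p"
  by (simp add: Legendre_def QuadRes_def cong_def)

lemma Legendre_mod [simp]: "Legendre (a mod p) p = Legendre a p"
  by (rule Legendre_cong) (simp add: cong_def)

lemma Legendre_mult:
  assumes "prime p" "p > 2"
  shows "Legendre (a * b) p = Legendre a p * Legendre b p"
proof -
  obtain e where e: "p = 2 * int e + 1" using odd_prime_int_half assms .
  have "[Legendre a p * Legendre b p = a ^ e * b ^ e] (mod p)"
    by (intro cong_mult euler_criterion_int[OF assms(1) e])
  hence "[Legendre (a * b) p = Legendre a p * Legendre b p] (mod p)"
    using euler_criterion_int[OF assms(1) e, of "a * b"] 
    by (metis power_mult_distrib cong_trans cong_sym)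
  hence d: "p dvd Legendre (a * b) p - Legendre a p * Legendre b p" by (simp add: cong_iff_dvd_diff)
  have "\<bar>Legendre (a * b) p - Legendre a p * Legendre b p\<bar> < p"
    using assms(2) Legendre_values[of a p] Legendre_values[of b p] Legendre_values[of "a * b" p] by auto
  thus ?thesis using d zdvd_not_zless[of "\<bar>Legendre (a * b) p - Legendre a p * Legendre b p\<bar>" p] by fastforce
qed

lemma Legendre_1 [simp]: "prime p \<Longrightarrow> Legendre 1 p = 1"
proof -
  assume "prime p"
  hence "\<not> p dvd 1" by (metis not_prime_unit)
  hence "\<not> [1 = 0] (mod p)" by (simp only: cong_0_iff not_False_eq_True)
  moreover have "QuadRes p 1" unfolding QuadRes_def by (rule exI[of _ 1]) simp
  ultimately show ?thesis by (simp add: Legendre_def)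
qed

lemma sum_periodic_affine:
  fixes g :: "int \<Rightarrow> 'a :: comm_monoid_add"
  assumes m: "m > 0" and c: "coprime c m" and g: "\<And>x. g (x mod m) = g x"
  shows "(\<Sum>x\<in>{0..<m}. g (c * x + d)) = (\<Sum>x\<in>{0..<m}. g x)"
proof -
  let ?h = "\<lambda>x. (c * x + d) mod m"
  have inj: "inj_on ?h {0..<m}"
  proof
    fix x y assume xy: "x \<in> {0..<m}" "y \<in> {0..<m}" "?h x = ?h y"
    hence "m dvd c * (x - y)" by (simp add: mod_eq_dvd_iff algebra_simps)
    hence "m dvd x - y" using c by (simp add: coprime_dvd_mult_right_iff coprime_commute)
    thus "x = y" using xy by (metis atLeastLessThan_iff mod_eq_dvd_iff mod_pos_pos_trivial)
  qed
  have im: "?h ` {0..<m} = {0..<m}"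
    by (intro endo_inj_surj inj) (use m in auto)
  have "(\<Sum>x\<in>{0..<m}. g x) = (\<Sum>x\<in>?h ` {0..<m}. g x)" by (simp only: im)
  also have "\<dots> = (\<Sum>x\<in>{0..<m}. g (c * x + d))" by (subst sum.reindex[OF inj]) (simp add: g)
  finally show ?thesis by simp
qed

lemma sum_periodic_shift:
  fixes g :: "int \<Rightarrow> 'a :: comm_monoid_add"
  assumes "m > 0" "\<And>x. g (x mod m) = g x"
  shows "(\<Sum>x\<in>{0..<m}. g (x + d)) = (\<Sum>x\<in>{0..<m}. g x)"
  using sum_periodic_affine[of m 1 g d] assms by simp

text \<open>Otherwise squaring would map the residues onto themselves, hence injectively, although 1
  and p - 1 have the same square.\<close>

lemma exists_nonresidue:
  assumes "prime p" "p > (2::int)"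
  obtains c where "Legendre c p = -1"
proof (rule ccontr)
  assume "\<not> thesis"
  hence no: "Legendre c p \<noteq> -1" for c using that by blast
  let ?h = "\<lambda>x. (x ^ 2) mod p"
  have "{0..<p} \<subseteq> ?h ` {0..<p}"
  proof
    fix c assume c: "c \<in> {0..<p}"
    have "\<exists>y. [y^2 = c] (mod p)"
    proof (cases "p dvd c")
      case True
      thus ?thesis by (intro exI[of _ 0]) (simp add: cong_iff_dvd_diff)
    next
      case False
      thus ?thesis using no[of c] by (auto simp: Legendre_def QuadRes_def cong_0_iff split: if_splits)
    qed
    then obtain y where "[y^2 = c] (mod p)" ..
    hence "c = ?h (y mod p)" using c by (simp add: cong_def power_mod)
    moreover have "y mod p \<in> {0..<p}" using assms by simp
    ultimately show "c \<in> ?h ` {0..<p}" by blast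
  qed
  moreover have "?h ` {0..<p} \<subseteq> {0..<p}" using assms by auto
  ultimately have "?h ` {0..<p} = {0..<p}" by blast
  hence "inj_on ?h {0..<p}" by (intro eq_card_imp_inj_on) simp_all
  moreover have "?h 1 = ?h (p - 1)"
  proof -
    have "1 ^ 2 - (p - 1) ^ 2 = p * (2 - p)" by (simp add: power2_eq_square algebra_simps)
    thus ?thesis by (metis dvd_triv_left mod_eq_dvd_iff)
  qed
  ultimately have "1 = p - 1" using assms by (elim inj_onD) auto
  thus False using assms by simp
qed

text \<open>Multiplication by a nonresidue permutes the residues and flips every sign.\<close>

lemma sum_Legendre_complete:
  assumes "prime p" "p > 2"
  shows "(\<Sum>x\<in>{0..<p}. Legendre x p) = 0"
proof -
  obtain c where c: "Legendre c p = -1" using exists_nonresidue assms .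
  hence "\<not> p dvd c" using Legendre_eq_0_iff[of c p] by auto
  hence "coprime c p" using assms by (metis coprime_commute prime_imp_coprime)
  hence "(\<Sum>x\<in>{0..<p}. Legendre (c * x + 0) p) = (\<Sum>x\<in>{0..<p}. Legendre x p)"
    using assms by (intro sum_periodic_affine) auto
  also have "(\<Sum>x\<in>{0..<p}. Legendre (c * x + 0) p) = - (\<Sum>x\<in>{0..<p}. Legendre x p)"
    by (simp add: Legendre_mult assms c sum_negf)
  finally show ?thesis by simp
qed

section \<open>Inversion and correlations of shifted Legendre symbols\<close>

definition inv_mod :: "int \<Rightarrow> int \<Rightarrow> int" where
  "inv_mod p x = (x ^ (nat p - 2)) mod p"

lemma inv_mod:
  assumes p: "prime p" and x: "x \<in> {1..<p}"
  shows "[x * inv_mod p x = 1] (mod p)" "inv_mod p x \<in> {1..<p}"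
proof -
  have "\<not> p dvd x" using x by (auto simp: zdvd_not_zless)
  hence c: "coprime x p" using p by (metis coprime_commute prime_imp_coprime)
  have p2: "p \<ge> 2" using p prime_ge_2_int by blast
  have "Suc (Suc (nat p - 2)) = nat p" using p2 by simp
  hence "x * (x * x ^ (nat p - 2)) = x ^ nat p" by (metis power_Suc)
  hence "[x * (x * x ^ (nat p - 2)) = x * 1] (mod p)" using int_power_prime_cong[OF p, of x] by simp
  hence *: "[x * x ^ (nat p - 2) = 1] (mod p)" using c by (subst (asm) cong_mult_lcancel) (auto simp: coprime_commute)
  thus 1: "[x * inv_mod p x = 1] (mod p)" by (simp add: inv_mod_def cong_def mod_mult_right_eq)
  have "inv_mod p x \<noteq> 0" using 1 p2 by (auto simp: cong_def)
  thus "inv_mod p x \<in> {1..<p}" using p2 pos_mod_bound[of p "x ^ (nat p - 2)"] pos_mod_sign[of p "x ^ (nat p - 2)"]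
    unfolding inv_mod_def atLeastLessThan_iff by linarith
qed

lemma inv_mod_inv_mod:
  assumes p: "prime p" and x: "x \<in> {1..<p}"
  shows "inv_mod p (inv_mod p x) = x"
proof -
  let ?y = "inv_mod p x" let ?z = "inv_mod p ?y"
  note y = inv_mod[OF p x] note z = inv_mod[OF p y(2)]
  have "[x * (?y * ?z) = x * 1] (mod p)" by (intro cong_scalar_left z)
  moreover have "[x * ?y * ?z = 1 * ?z] (mod p)" by (intro cong_scalar_right y)
  ultimately have "[?z = x] (mod p)" by (metis cong_sym cong_trans mult.assoc mult_1 mult.right_neutral)
  thus ?thesis using x z(2) by (auto simp: cong_def)
qed

lemma sum_inv_mod:
  assumes "prime p"
  shows "(\<Sum>x\<in>{1..<p}. g (inv_mod p x)) = (\<Sum>x\<in>{1..<p}. g x)"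
  by (rule sum.reindex_bij_witness[of _ "inv_mod p" "inv_mod p"])
     (use inv_mod inv_mod_inv_mod assms in auto)

text \<open>From x + s = x (1 + s/x). In a product of an even number of shifts, one of them 0, the
  symbols of x cancel, and substituting 1/x lowers the degree by one.\<close>

lemma Legendre_plus_inv:
  assumes p: "prime p" "p > 2" and x: "x \<in> {1..<p}"
  shows "Legendre (x + s) p = Legendre x p * Legendre (1 + s * inv_mod p x) p"
proof -
  have "[x * 1 + s * (x * inv_mod p x) = x * 1 + s * 1] (mod p)"
    by (intro cong_add cong_refl cong_scalar_left inv_mod p x)
  hence "[x + s = x * (1 + s * inv_mod p x)] (mod p)" by (simp add: algebra_simps cong_sym_eq)
  thus ?thesis by (simp add: Legendre_cong flip: Legendre_mult[OF p])
qed

lemma sum_split_zero: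
  fixes g :: "int \<Rightarrow> 'a :: comm_monoid_add"
  shows "p > 0 \<Longrightarrow> (\<Sum>x\<in>{0..<p}. g x) = g 0 + (\<Sum>x\<in>{1..<p}. g x)"
proof -
  assume "p > 0"
  hence "{0..<p} = insert 0 {1..<p}" by auto
  thus ?thesis by simp
qed

lemma Legendre_square: "p dvd x \<or> Legendre x p * Legendre x p = 1"
  using Legendre_values[of x p] Legendre_eq_0_iff[of x p] by auto

text \<open>Inversion makes the argument linear; the complete sum is zero, and the term missing at 0
  leaves -1.\<close>

lemma sum_Legendre_pair:
  assumes p: "prime p" "p > 2" and cd: "\<not> p dvd c - d"
  shows "(\<Sum>x\<in>{0..<p}. Legendre (x + c) p * Legendre (x + d) p) = -1"
proof -
  have "(\<Sum>x\<in>{0..<p}. Legendre (x + c) p * Legendre (x + d) p)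
      = (\<Sum>x\<in>{0..<p}. Legendre ((x + c)) p * Legendre ((x + c) + (d - c)) p)" by simp
  also have "\<dots> = (\<Sum>x\<in>{0..<p}. Legendre x p * Legendre (x + (d - c)) p)"
    by (rule sum_periodic_shift[where g = "\<lambda>x. Legendre x p * Legendre (x + (d - c)) p"])
       (use p in \<open>auto intro!: arg_cong2[of _ _ _ _ "(*)"] Legendre_cong cong_add simp: cong_def\<close>)
  also have "\<dots> = (\<Sum>x\<in>{1..<p}. Legendre x p * Legendre (x + (d - c)) p)"
    using p by (subst sum_split_zero) (auto simp: Legendre_eq_0_iff)
  also have "\<dots> = (\<Sum>x\<in>{1..<p}. Legendre (1 + (d - c) * inv_mod p x) p)"
  proof (intro sum.cong refl)
    fix x assume x: "x \<in> {1..<p}"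
    hence "\<not> p dvd x" by (auto simp: zdvd_not_zless)
    thus "Legendre x p * Legendre (x + (d - c)) p = Legendre (1 + (d - c) * inv_mod p x) p"
      using Legendre_plus_inv[OF p x, of "d - c"] Legendre_square[of p x] by (simp flip: mult.assoc)
  qed
  also have "\<dots> = (\<Sum>x\<in>{1..<p}. Legendre (1 + (d - c) * x) p)"
    by (rule sum_inv_mod[OF p(1)])
  also have "\<dots> = (\<Sum>x\<in>{0..<p}. Legendre ((d - c) * x + 1) p) - 1"
    using p by (subst sum_split_zero) (auto simp: add.commute)
  also have "(\<Sum>x\<in>{0..<p}. Legendre ((d - c) * x + 1) p) = (\<Sum>x\<in>{0..<p}. Legendre x p)"
  proof (rule sum_periodic_affine)
    have "\<not> p dvd d - c" using cd by (metis dvd_minus_iff minus_diff_eq)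
    thus "coprime (d - c) p" using p by (metis coprime_commute prime_imp_coprime)
  qed (use p in auto)
  finally show ?thesis using sum_Legendre_complete[OF p] by simp
qed

definition quad_sum :: "int \<Rightarrow> int \<Rightarrow> int \<Rightarrow> int \<Rightarrow> int \<Rightarrow> int" where
  "quad_sum p a b c d = (\<Sum>x\<in>{0..<p}. Legendre (x + a) p * Legendre (x + b) p * Legendre (x + c) p * Legendre (x + d) p)"

lemma quad_sum_trivial: "p > 0 \<Longrightarrow> \<bar>quad_sum p a b c d\<bar> \<le> p"
proof -
  assume p: "p > 0"
  have "\<bar>quad_sum p a b c d\<bar> \<le> (\<Sum>x\<in>{0..<p}. 1)"
    unfolding quad_sum_def
  proof (intro order.trans[OF sum_abs] sum_mono)
    fix x
    show "\<bar>Legendre (x + a) p * Legendre (x + b) p * Legendre (x + c) p * Legendre (x + d) p\<bar> \<le> 1"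
      using Legendre_values[of "x+a" p] Legendre_values[of "x+b" p] Legendre_values[of "x+c" p] Legendre_values[of "x+d" p]
      by auto
  qed
  thus ?thesis using p by simp
qed

text \<open>The coinciding pair contributes 1 except at x = -a, so a correlation of two shifts
  remains, short of a single term: at most 1 + 1.\<close>

lemma quad_sum_equal:
  assumes p: "prime p" "p > 2" and ab: "p dvd a - b" and cd: "\<not> p dvd c - d"
  shows "\<bar>quad_sum p a b c d\<bar> \<le> 2"
proof -
  have L: "Legendre (x + b) p = Legendre (x + a) p" for x
    using ab by (intro Legendre_cong) (simp add: cong_iff_dvd_diff dvd_diff_commute)
  define y where "y = (-a) mod p"
  have y: "y \<in> {0..<p}" using p by (simp add: y_def)
  have "p dvd y + a" by (simp add: y_def dvd_eq_mod_eq_0 mod_simps)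
  hence y0: "Legendre (y + a) p = 0" by (simp add: Legendre_eq_0_iff)
  have yn: "\<not> p dvd x + a" if "x \<in> {0..<p} - {y}" for x
  proof
    assume "p dvd x + a"
    hence "[x = y] (mod p)" using \<open>p dvd y + a\<close> 
      by (metis add_diff_cancel_right cong_iff_dvd_diff dvd_diff)
    thus False using that y by (auto simp: cong_def)
  qed
  have "quad_sum p a b c d = (\<Sum>x\<in>{0..<p}-{y}. Legendre (x + a) p * Legendre (x + b) p * Legendre (x + c) p * Legendre (x + d) p)"
    unfolding quad_sum_def using y by (subst sum.remove[of _ y]) (auto simp: y0)
  also have "\<dots> = (\<Sum>x\<in>{0..<p}-{y}. Legendre (x + c) p * Legendre (x + d) p)"
    unfolding L using yn Legendre_square by (intro sum.cong refl) fastforce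
  also have "\<dots> = (\<Sum>x\<in>{0..<p}. Legendre (x + c) p * Legendre (x + d) p) - Legendre (y + c) p * Legendre (y + d) p"
    using y by (subst (2) sum.remove[of _ y]) auto
  also have "\<dots> = -1 - Legendre (y + c) p * Legendre (y + d) p"
    by (simp add: sum_Legendre_pair[OF p cd])
  finally show ?thesis using Legendre_values[of "y+c" p] Legendre_values[of "y+d" p] by auto
qed

text \<open>Only the differences from \<open>a\<close> have to be nonzero; b, c, d may coincide,
  since Stepanov's argument uses just the odd degree. Inversion also yields the constant coefficient
  1 that the argument demands. The constant is 25 plus the missing term at 0.\<close>

lemma quad_sum_distinct:
  assumes p: "prime p" "p > 2" and s: "\<not> p dvd b - a" "\<not> p dvd c - a" "\<not> p dvd d - a"
  shows "\<bar>real_of_int (quad_sum p a b c d)\<bar> \<le> 26 * sqrt (real_of_int p)"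
proof -
  let ?L = "\<lambda>x. Legendre x p"
  define f where "f = [:1, b - a:] * [:1, c - a:] * [:1, d - a:]"
  have pf: "poly f x = (1 + (b - a) * x) * (1 + (c - a) * x) * (1 + (d - a) * x)" for x
    by (simp add: f_def algebra_simps)
  have c3: "coeff f 3 = (b - a) * (c - a) * (d - a)"
    by (simp add: f_def eval_nat_numeral)
  have np: "\<not> p dvd coeff f 3" unfolding c3 using s p by (simp add: prime_dvd_mult_iff)
  have deg: "degree f = 3"
  proof (rule antisym)
    show "degree f \<le> 3" unfolding f_def by (intro order.trans[OF degree_mult_le]) auto
    show "3 \<le> degree f" using np by (intro le_degree) auto
  qed
  have "quad_sum p a b c d = (\<Sum>x\<in>{0..<p}. ?L (x + a) * ?L ((x + a) + (b - a)) * ?L ((x + a) + (c - a)) * ?L ((x + a) + (d - a)))"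
    by (simp add: quad_sum_def)
  also have "\<dots> = (\<Sum>x\<in>{0..<p}. ?L x * ?L (x + (b - a)) * ?L (x + (c - a)) * ?L (x + (d - a)))"
    by (rule sum_periodic_shift[where g = "\<lambda>x. ?L x * ?L (x + (b - a)) * ?L (x + (c - a)) * ?L (x + (d - a))"])
       (use p in \<open>auto intro!: arg_cong2[of _ _ _ _ "(*)"] Legendre_cong cong_add simp: cong_def\<close>)
  also have "\<dots> = (\<Sum>x\<in>{1..<p}. ?L x * ?L (x + (b - a)) * ?L (x + (c - a)) * ?L (x + (d - a)))"
    using p by (subst sum_split_zero) (auto simp: Legendre_eq_0_iff)
  also have "\<dots> = (\<Sum>x\<in>{1..<p}. ?L (poly f (inv_mod p x)))"
  proof (intro sum.cong refl)
    fix x assume x: "x \<in> {1..<p}"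
    hence "\<not> p dvd x" by (auto simp: zdvd_not_zless)
    hence "?L x * ?L x = 1" using Legendre_square by blast
    hence *: "?L x = 1 \<or> ?L x = -1" by (simp add: zmult_eq_1_iff)
    show "?L x * ?L (x + (b - a)) * ?L (x + (c - a)) * ?L (x + (d - a)) = ?L (poly f (inv_mod p x))"
      unfolding Legendre_plus_inv[OF p x] pf Legendre_mult[OF p] using * by auto
  qed
  also have "\<dots> = (\<Sum>x\<in>{1..<p}. ?L (poly f x))" by (rule sum_inv_mod[OF p(1)])
  also have "\<dots> = (\<Sum>x\<in>{0..<p}. ?L (poly f x)) - 1"
    using p by (subst sum_split_zero) (auto simp: pf)
  finally have "real_of_int (quad_sum p a b c d) = (\<Sum>x\<in>{0..<p}. real_of_int (?L (poly f x))) - 1"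
    by simp
  moreover have "\<bar>\<Sum>x\<in>{0..<p}. real_of_int (?L (poly f x))\<bar> \<le> 25 * sqrt p"
    using np deg by (intro sum_Legendre_cubic_bound p) (auto simp: f_def)
  moreover have "sqrt p \<ge> 1" using p by simp
  ultimately show ?thesis by linarith
qed

text \<open>Exactly the cases in which (x+a)(x+b)(x+c)(x+d) is the square of a polynomial modulo
  \<open>p\<close>, so that no cancellation can be expected.\<close>

definition quad_paired :: "int \<Rightarrow> int \<Rightarrow> int \<Rightarrow> int \<Rightarrow> int \<Rightarrow> bool" where
  "quad_paired p a b c d \<longleftrightarrow> (p dvd a - b \<and> p dvd c - d) \<or> (p dvd a - c \<and> p dvd b - d) \<or> (p dvd a - d \<and> p dvd b - c)"

text \<open>If \<open>a\<close> agrees with none of the other shifts, the cubic bound applies; if it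
  agrees with one of them, the remaining two differ because the quadruple is not paired.\<close>

lemma quad_sum_bound:
  assumes p: "prime p" "p > 2" and np: "\<not> quad_paired p a b c d"
  shows "\<bar>real_of_int (quad_sum p a b c d)\<bar> \<le> 26 * sqrt (real_of_int p)"
proof -
  have perm: "quad_sum p a b c d = quad_sum p a c b d" "quad_sum p a b c d = quad_sum p a d b c" 
     "quad_sum p a b c d = quad_sum p b c a d" "quad_sum p a b c d = quad_sum p b d a c" "quad_sum p a b c d = quad_sum p c d a b"
    by (simp_all add: quad_sum_def mult_ac)
  have s: "sqrt p \<ge> 1" using p by simp
  have sym: "p dvd x - y \<longleftrightarrow> p dvd y - x" for x y using dvd_minus_iff[of p "x - y"] by simp
  have *: ?thesis if "\<bar>quad_sum p a b c d\<bar> \<le> 2"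
    using that s by linarith
  show ?thesis
  proof (cases "p dvd b - a \<or> p dvd c - a \<or> p dvd d - a")
    case False
    thus ?thesis using quad_sum_distinct[OF p] by blast
  next
    case True
    hence "\<bar>quad_sum p a b c d\<bar> \<le> 2"
      using np quad_sum_equal[OF p, of a b c d] quad_sum_equal[OF p, of a c b d] quad_sum_equal[OF p, of a d b c] perm sym
      unfolding quad_paired_def by metis
    thus ?thesis by (rule *)
  qed
qed

section \<open>Jacobi symbols and their fourth moment\<close>

definition jac :: "int \<Rightarrow> nat \<Rightarrow> int" where
  "jac m q = (\<Prod>p\<in>#prime_factorization q. Legendre m (int p))"

lemma jac_mult_bottom: "a \<noteq> 0 \<Longrightarrow> b \<noteq> 0 \<Longrightarrow> jac m (a * b) = jac m a * jac m b"
  by (simp add: jac_def prime_factorization_mult)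

lemma jac_1_right [simp]: "jac m (Suc 0) = 1"
  by (simp add: jac_def)

lemma jac_prime: "prime p \<Longrightarrow> jac m p = Legendre m (int p)"
  by (simp add: jac_def prime_factorization_prime)

lemma prime_decomp_induct [consumes 1, case_names one mult]:
  fixes q :: nat
  assumes "q > 0" "P 1" "\<And>p q. prime p \<Longrightarrow> q > 0 \<Longrightarrow> P q \<Longrightarrow> P (p * q)"
  shows "P q"
  using assms(1)
proof (induction q rule: less_induct)
  case (less q)
  show ?case
  proof (cases "q = 1")
    case False
    then obtain p where p: "prime p" "p dvd q" using prime_factor_nat by blast
    then obtain r where r: "q = p * r" by (auto elim: dvdE)
    have "r > 0" "r < q" using less.prems r prime_gt_1_nat[OF p(1)] by auto
    thus ?thesis using less.IH assms(3) p r by blast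
  qed (use assms in simp)
qed

lemma jac_mult_top:
  assumes "odd q"
  shows "jac (m * n) q = jac m q * jac n q"
proof -
  have "q > 0" using assms by (auto intro: Nat.gr0I)
  thus ?thesis using assms
  proof (induction q rule: prime_decomp_induct)
    case (mult p q)
    hence "int p > 2" using prime_gt_1_nat[of p] by (cases "p = 2") auto
    thus ?case using mult by (simp add: jac_mult_bottom jac_prime Legendre_mult)
  qed auto
qed

lemma jac_cong:
  assumes "q > 0" "[m = n] (mod int q)"
  shows "jac m q = jac n q"
  using assms
proof (induction q rule: prime_decomp_induct)
  case (mult p q)
  have "[m = n] (mod int p)" "[m = n] (mod int q)"
    using mult.prems by (auto intro: cong_dvd_modulus)
  hence "jac m q = jac n q" "Legendre m (int p) = Legendre n (int p)"
    using mult.IH Legendre_cong by auto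
  thus ?case using mult by (simp add: jac_mult_bottom jac_prime)
qed auto

lemma jac_mod [simp]: "q > 0 \<Longrightarrow> jac (m mod int q) q = jac m q"
  by (rule jac_cong) (simp_all add: cong_def)

lemma jac_values:
  assumes "q > 0"
  shows "jac m q \<in> {-1, 0, 1}"
  using assms
proof (induction q rule: prime_decomp_induct)
  case (mult p q)
  thus ?case using Legendre_values[of m "int p"] by (auto simp: jac_mult_bottom jac_prime)
qed auto

lemma abs_jac_le: "q > 0 \<Longrightarrow> \<bar>jac m q\<bar> \<le> 1"
  using jac_values[of q m] by auto

lemma jac_eq_0_iff:
  assumes "q > 0"
  shows "jac m q = 0 \<longleftrightarrow> \<not> coprime m (int q)"
  using assms
proof (induction q rule: prime_decomp_induct)
  case (mult p q)
  have "coprime m (int p) \<longleftrightarrow> \<not> int p dvd m"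
    using mult.hyps(1) prime_imp_coprime[of "int p" m] coprime_absorb_left[of "int p" m]
    by (auto simp: coprime_commute)
  thus ?case using mult by (simp add: jac_mult_bottom jac_prime Legendre_eq_0_iff)
qed auto

lemma jac_1_left [simp]: "q > 0 \<Longrightarrow> jac 1 q = 1"
proof (induction q rule: prime_decomp_induct)
  case (mult p q)
  thus ?case by (simp add: jac_mult_bottom jac_prime)
qed auto

text \<open>With x = b y + a z modulo a b, \<open>g\<close> sees only b y and \<open>h\<close> only
  a z; multiplication by the units b and a then permutes the residues.\<close>

lemma sum_crt:
  fixes g h :: "int \<Rightarrow> 'a :: comm_semiring_0"
  assumes ab: "a > 0" "b > 0" "coprime a b" and g: "\<And>x. g (x mod a) = g x" and h: "\<And>x. h (x mod b) = h x"
  shows "(\<Sum>x\<in>{0..<a*b}. g x * h x) = (\<Sum>x\<in>{0..<a}. g x) * (\<Sum>x\<in>{0..<b}. h x)"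
proof -
  let ?f = "\<lambda>(y,z). (b * y + a * z) mod (a * b)"
  let ?D = "{0..<a} \<times> {0..<b}"
  have eq: "y = y'" if "y \<in> {0..<m}" "y' \<in> {0..<m}" "m dvd n * (y - y')" "coprime m n" for y y' m n :: int
  proof -
    have "m dvd y - y'" using that by (simp add: coprime_dvd_mult_right_iff)
    thus ?thesis using that by (metis atLeastLessThan_iff mod_eq_dvd_iff mod_pos_pos_trivial)
  qed
  have inj: "inj_on ?f ?D"
  proof (rule inj_onI, clarify)
    fix y z y' z' assume A: "y \<in> {0..<a}" "z \<in> {0..<b}" "y' \<in> {0..<a}" "z' \<in> {0..<b}"
      "(b * y + a * z) mod (a * b) = (b * y' + a * z') mod (a * b)"
    hence d: "a * b dvd b * (y - y') + a * (z - z')" by (simp add: mod_eq_dvd_iff algebra_simps)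
    have "a dvd b * (y - y') + a * (z - z')" using d by (rule dvd_trans[rotated]) simp
    hence 1: "a dvd b * (y - y')" by (simp add: dvd_add_left_iff)
    have "b dvd b * (y - y') + a * (z - z')" using d by (rule dvd_trans[rotated]) simp
    hence 2: "b dvd a * (z - z')" by (simp add: dvd_add_right_iff)
    show "y = y' \<and> z = z'"
      using eq[OF A(1,3) 1] eq[OF A(2,4) 2] ab by (simp add: coprime_commute)
  qed
  have im: "?f ` ?D = {0..<a*b}"
  proof (rule card_subset_eq)
    show "?f ` ?D \<subseteq> {0..<a*b}" using ab by auto
    show "card (?f ` ?D) = card {0..<a*b}" using ab by (simp add: card_image[OF inj] nat_mult_distrib)
  qed auto
  have "(\<Sum>x\<in>{0..<a*b}. g x * h x) = (\<Sum>(y,z)\<in>?D. g (b * y + a * z) * h (b * y + a * z))"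
  proof -
    have "g (w mod (a * b)) = g w" "h (w mod (a * b)) = h w" for w
      using g[of "w mod (a * b)"] g[of w] h[of "w mod (a * b)"] h[of w] by (simp_all add: mod_mod_cancel)
    thus ?thesis unfolding im[symmetric] by (subst sum.reindex[OF inj]) (auto simp: case_prod_unfold)
  qed
  also have "\<dots> = (\<Sum>(y,z)\<in>?D. g (b * y + 0) * h (a * z + 0))"
  proof (intro sum.cong refl, clarify)
    fix y z
    have "g (b * y + a * z) = g (b * y)" using g[of "b * y + a * z"] g[of "b * y"] by simp
    moreover have "h (b * y + a * z) = h (a * z)" using h[of "b * y + a * z"] h[of "a * z"] by simp
    ultimately show "g (b * y + a * z) * h (b * y + a * z) = g (b * y + 0) * h (a * z + 0)" by simp
  qed
  also have "\<dots> = (\<Sum>y\<in>{0..<a}. g (b * y + 0)) * (\<Sum>z\<in>{0..<b}. h (a * z + 0))"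
    by (simp only: sum_product sum.cartesian_product)
  also have "(\<Sum>y\<in>{0..<a}. g (b * y + 0)) = (\<Sum>y\<in>{0..<a}. g y)"
    by (rule sum_periodic_affine) (use ab g in \<open>auto simp: coprime_commute\<close>)
  also have "(\<Sum>y\<in>{0..<b}. h (a * y + 0)) = (\<Sum>y\<in>{0..<b}. h y)"
    by (rule sum_periodic_affine) (use ab h in \<open>auto simp: coprime_commute\<close>)
  finally show ?thesis .
qed

lemma squarefree_prime_induct [consumes 1, case_names one mult]:
  fixes q :: nat
  assumes "squarefree q" "P 1" "\<And>p q. prime p \<Longrightarrow> squarefree q \<Longrightarrow> q > 0 \<Longrightarrow> \<not> p dvd q \<Longrightarrow> P q \<Longrightarrow> P (p * q)"
  shows "P q"
proof -
  have "q > 0" using assms(1) by (auto intro: Nat.gr0I)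
  thus ?thesis using assms(1)
  proof (induction q rule: prime_decomp_induct)
    case (mult p q)
    have sq: "squarefree q" using mult.prems by (rule squarefree_mono[rotated]) simp
    have "\<not> p dvd q"
    proof
      assume "p dvd q"
      hence "p ^ 2 dvd p * q" by (simp add: power2_eq_square mult_dvd_mono)
      hence "p dvd 1" using mult.prems squarefreeD by blast
      thus False using mult.hyps by simp
    qed
    thus ?case using assms(3) sq mult by blast
  qed (use assms in simp)
qed

text \<open>A prime factor of a squarefree modulus splits off coprimely, and its complete Legendre
  sum annihilates the product.\<close>

lemma sum_jac_complete:
  assumes "squarefree q" "odd q" "q > 1"
  shows "(\<Sum>x\<in>{0..<int q}. jac x q) = 0"
proof -
  have "q > 0" using assms by simp
  obtain p where p: "prime p" "p dvd q" using assms prime_factor_nat[of q] by auto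
  then obtain r where r: "q = p * r" by (auto elim: dvdE)
  have r0: "r > 0" using assms r by (auto intro: Nat.gr0I)
  have "\<not> p dvd r" 
  proof
    assume "p dvd r"
    hence "p ^ 2 dvd q" by (simp add: r power2_eq_square mult_dvd_mono)
    hence "p dvd 1" using assms squarefreeD by blast
    thus False using p by simp
  qed
  hence c: "coprime (int p) (int r)" using p prime_imp_coprime by auto
  have p2: "int p > 2" using p assms r prime_gt_1_nat[of p] by (cases "p = 2") auto
  have "(\<Sum>x\<in>{0..<int q}. jac x q) = (\<Sum>x\<in>{0..<int p * int r}. Legendre x (int p) * jac x r)"
    using p r r0 by (simp add: jac_mult_bottom jac_prime)
  also have "\<dots> = (\<Sum>x\<in>{0..<int p}. Legendre x (int p)) * (\<Sum>x\<in>{0..<int r}. jac x r)"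
    by (rule sum_crt) (use p2 r0 c in auto)
  finally show ?thesis using sum_Legendre_complete[of "int p"] p p2 by simp
qed

section \<open>Correlations for squarefree moduli\<close>

definition quad_jac :: "nat \<Rightarrow> int \<Rightarrow> int \<Rightarrow> int \<Rightarrow> int \<Rightarrow> int" where
  "quad_jac q a b c d = (\<Sum>x\<in>{0..<int q}. jac (x + a) q * jac (x + b) q * jac (x + c) q * jac (x + d) q)"

lemma prime_factors_insert: "prime p \<Longrightarrow> q > 0 \<Longrightarrow> prime_factors (p * q) = insert p (prime_factors q)" for p :: nat
  by (simp add: prime_factors_product prime_prime_factors)

lemma quad_jac_eq_prod:
  assumes "squarefree q"
  shows "quad_jac q a b c d = (\<Prod>p\<in>prime_factors q. quad_sum (int p) a b c d)"
  using assms
proof (induction q rule: squarefree_prime_induct)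
  case one
  thus ?case by (simp add: quad_jac_def)
next
  case (mult p q)
  let ?L = "\<lambda>x. Legendre (x + a) (int p) * Legendre (x + b) (int p) * Legendre (x + c) (int p) * Legendre (x + d) (int p)"
  let ?J = "\<lambda>x. jac (x + a) q * jac (x + b) q * jac (x + c) q * jac (x + d) q"
  have c: "coprime (int p) (int q)" using mult prime_imp_coprime by auto
  have "quad_jac (p * q) a b c d = (\<Sum>x\<in>{0..<int p * int q}. ?L x * ?J x)"
    unfolding quad_jac_def using mult by (intro sum.cong) (simp_all add: jac_mult_bottom jac_prime)
  also have "\<dots> = (\<Sum>x\<in>{0..<int p}. ?L x) * (\<Sum>x\<in>{0..<int q}. ?J x)"
  proof (rule sum_crt)
    fix x
    show "?L (x mod int p) = ?L x"
      by (intro arg_cong2[of _ _ _ _ "(*)"] Legendre_cong) (auto simp: cong_def mod_simps)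
    show "?J (x mod int q) = ?J x"
      using mult by (intro arg_cong2[of _ _ _ _ "(*)"] jac_cong) (auto simp: cong_def mod_simps)
  qed (use mult prime_gt_0_nat c in auto)
  also have "\<dots> = quad_sum (int p) a b c d * quad_jac q a b c d"
    by (simp add: quad_sum_def quad_jac_def)
  finally have "quad_jac (p * q) a b c d = quad_sum (int p) a b c d * quad_jac q a b c d" .
  moreover have "p \<notin> prime_factors q" using mult by auto
  ultimately show ?case using mult by (simp add: prime_factors_insert)
qed

text \<open>For the prime factors \<open>P\<close> of a squarefree q this is gcd(q, x, y), written
  prime by prime to match a bound that is a product over primes.\<close>

definition prime_gcd :: "nat set \<Rightarrow> int \<Rightarrow> int \<Rightarrow> nat" where
  "prime_gcd P x y = (\<Prod>p\<in>P. if int p dvd x \<and> int p dvd y then p else 1)"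

lemma prod_primes_dvd:
  fixes z :: int
  assumes "finite P" "\<And>p. p \<in> P \<Longrightarrow> prime p" "\<And>p. p \<in> P \<Longrightarrow> C p \<Longrightarrow> int p dvd z"
  shows "int (\<Prod>p\<in>P. if C p then p else 1) dvd z"
  using assms
proof (induction P rule: finite_induct)
  case (insert p P)
  have "coprime p (\<Prod>p\<in>P. if C p then p else 1)"
    using insert by (intro prod_coprime_right) (auto intro!: primes_coprime)
  hence "coprime (int p) (int (\<Prod>p\<in>P. if C p then p else 1))" by (simp only: coprime_int_iff)
  moreover have "int (\<Prod>p\<in>P. if C p then p else 1) dvd z" using insert by blast
  ultimately show ?case using insert.hyps insert.prems(2)[of p] by (auto intro: divides_mult)
qed auto

lemma prime_gcd_dvd:
  assumes "finite P" "\<And>p. p \<in> P \<Longrightarrow> prime p"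
  shows "int (prime_gcd P x y) dvd x" "int (prime_gcd P x y) dvd y" "prime_gcd P x y dvd \<Prod>P" "prime_gcd P x y > 0"
proof -
  show "int (prime_gcd P x y) dvd x" "int (prime_gcd P x y) dvd y"
    unfolding prime_gcd_def by (rule prod_primes_dvd[OF assms]; simp)+
  show "prime_gcd P x y dvd \<Prod>P" unfolding prime_gcd_def by (rule prod_dvd_prod) simp
  show "prime_gcd P x y > 0" unfolding prime_gcd_def using assms(2) prime_gt_0_nat by (intro prod_pos) auto
qed

lemma squarefree_eq_prod_primes: "squarefree q \<Longrightarrow> \<Prod>(prime_factors q) = q" for q :: nat
proof (induction q rule: squarefree_prime_induct)
  case (mult p q)
  moreover have "p \<notin> prime_factors q" using mult by auto
  ultimately show ?case by (simp add: prime_factors_insert)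
qed auto

lemma prod_three_ge:
  fixes A B C s :: real
  assumes "A \<ge> 1" "B \<ge> 1" "C \<ge> 1" "A = s \<or> B = s \<or> C = s"
  shows "A * B * C \<ge> s"
proof -
  have m: "x * (y * z) \<ge> x" if "x \<ge> 1" "y \<ge> 1" "z \<ge> 1" for x y z :: real
  proof -
    have "y * z \<ge> 1 * 1" using that by (intro mult_mono) auto
    hence "x * (y * z) \<ge> x * 1" using that by (intro mult_left_mono) auto
    thus ?thesis by simp
  qed
  show ?thesis using assms m[of A B C] m[of B A C] m[of C A B] by (auto simp: mult_ac)
qed

text \<open>One expression for both regimes: sqrt p in general, and a further sqrt p, which gives
  the trivial bound p, when a pairing holds modulo \<open>p\<close>. In this shape the product over
  the primes of a modulus turns into square roots of gcds.\<close>

lemma quad_sum_uniform_bound: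
  assumes pp: "prime p" "p > 2"
  defines "t \<equiv> \<lambda>x y. sqrt (real (if int p dvd x \<and> int p dvd y then p else 1))"
  shows "\<bar>real_of_int (quad_sum (int p) a b c d)\<bar> \<le> 26 * (sqrt p * (t (a - b) (c - d) * t (a - c) (b - d) * t (a - d) (b - c)))"
proof -
  define A B C where "A = t (a - b) (c - d)" "B = t (a - c) (b - d)" "C = t (a - d) (b - c)"
  have ge1: "A \<ge> 1" "B \<ge> 1" "C \<ge> 1" using pp by (auto simp: A_B_C_def t_def)
  have ip: "prime (int p)" "int p > 2" using pp by auto
  have "\<bar>real_of_int (quad_sum (int p) a b c d)\<bar> \<le> 26 * (sqrt p * (A * B * C))"
  proof (cases "quad_paired (int p) a b c d")
    case False
    have "\<bar>real_of_int (quad_sum (int p) a b c d)\<bar> \<le> 26 * (sqrt p * 1)"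
      using quad_sum_bound[OF ip False] by simp
    also have "\<dots> \<le> 26 * (sqrt p * (A * B * C))"
    proof (intro mult_left_mono)
      have "1 \<le> A" by (rule ge1)
      also have "A \<le> A * B * C" by (rule prod_three_ge[OF ge1]) simp
      finally show "1 \<le> A * B * C" .
    qed auto
    finally show ?thesis .
  next
    case True
    have "A = sqrt p \<or> B = sqrt p \<or> C = sqrt p"
      using True by (auto simp: quad_paired_def A_B_C_def t_def)
    hence "A * B * C \<ge> sqrt p" by (rule prod_three_ge[OF ge1])
    hence "sqrt p * (A * B * C) \<ge> sqrt p * sqrt p" by (intro mult_left_mono) auto
    moreover have "\<bar>real_of_int (quad_sum (int p) a b c d)\<bar> \<le> real p"
      using quad_sum_trivial[of "int p" a b c d] ip(2) by linarith
    ultimately show ?thesis by simp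
  qed
  thus ?thesis by (simp add: A_B_C_def)
qed

lemma quad_jac_bound:
  assumes q: "squarefree q" "odd q"
  defines "P \<equiv> prime_factors q"
  shows "\<bar>real_of_int (quad_jac q a b c d)\<bar> \<le> 26 ^ card P * sqrt q *
     (sqrt (prime_gcd P (a - b) (c - d)) * sqrt (prime_gcd P (a - c) (b - d)) * sqrt (prime_gcd P (a - d) (b - c)))"
proof -
  have P: "finite P" "\<And>p. p \<in> P \<Longrightarrow> prime p" by (auto simp: P_def)
  define t where "t = (\<lambda>x y p. if int p dvd x \<and> int p dvd y then p else 1)"
  have "\<bar>real_of_int (quad_jac q a b c d)\<bar> = (\<Prod>p\<in>P. \<bar>real_of_int (quad_sum (int p) a b c d)\<bar>)"
    by (simp add: quad_jac_eq_prod[OF q(1)] P_def abs_prod)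
  also have "\<dots> \<le> (\<Prod>p\<in>P. 26 * (sqrt p * (sqrt (t (a - b) (c - d) p) * sqrt (t (a - c) (b - d) p) * sqrt (t (a - d) (b - c) p))))"
  proof (intro prod_mono conjI)
    fix p assume p: "p \<in> P"
    hence pp: "prime p" using P by auto
    have "p \<noteq> 2" using p q by (auto simp: P_def)
    hence "p > 2" using prime_gt_1_nat[OF pp(1)] by simp
    thus "\<bar>real_of_int (quad_sum (int p) a b c d)\<bar> \<le> 26 * (sqrt p * (sqrt (t (a - b) (c - d) p) * sqrt (t (a - c) (b - d) p) * sqrt (t (a - d) (b - c) p)))"
      unfolding t_def by (rule quad_sum_uniform_bound[OF pp])
  qed auto
  also have "\<dots> = 26 ^ card P * ((\<Prod>p\<in>P. sqrt p) * ((\<Prod>p\<in>P. sqrt (t (a - b) (c - d) p)) * (\<Prod>p\<in>P. sqrt (t (a - c) (b - d) p)) * (\<Prod>p\<in>P. sqrt (t (a - d) (b - c) p))))"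
    by (simp only: prod.distrib prod_constant)
  finally have le: "\<bar>real_of_int (quad_jac q a b c d)\<bar> \<le> \<dots>" .
  have sp: "(\<Prod>p\<in>P. sqrt (real (h p))) = sqrt (real (\<Prod>p\<in>P. h p))" for h :: "nat \<Rightarrow> nat"
    using P(1) by (induction P rule: finite_induct) (simp_all add: real_sqrt_mult)
  have "(\<Prod>p\<in>P. sqrt p) = sqrt (real (\<Prod>p\<in>P. p))" by (rule sp)
  hence sq: "(\<Prod>p\<in>P. sqrt p) = sqrt q" using squarefree_eq_prod_primes[OF q(1)] by (simp only: P_def)
  have pg: "prime_gcd P x y = (\<Prod>p\<in>P. t x y p)" for x y by (simp add: prime_gcd_def t_def)
  show ?thesis using le unfolding sq sp pg by (simp only: mult.assoc)
qed

section \<open>Counting in residue classes and fourfold sums\<close>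

lemma int_div_less_iff:
  fixes A g k :: int
  assumes "g > 0"
  shows "A div g < k \<longleftrightarrow> A < g * k"
proof
  assume "A div g < k"
  hence "g * (A div g + 1) \<le> g * k" using assms by (intro mult_left_mono) auto
  moreover have "A = g * (A div g) + A mod g" "A mod g < g" using assms by simp_all
  ultimately show "A < g * k" unfolding distrib_left by linarith
next
  assume "A < g * k"
  moreover have "A = g * (A div g) + A mod g" "A mod g \<ge> 0" using assms by simp_all
  ultimately have "g * (A div g) < g * k" by linarith
  thus "A div g < k" using assms by simp
qed

lemma multiples_in_interval:
  fixes g A B :: int
  assumes "g > 0"
  shows "{n\<in>{A<..B}. g dvd n} = (\<lambda>k. g * k) ` {A div g<..B div g}"
proof -
  have iff: "k \<in> {A div g<..B div g} \<longleftrightarrow> g * k \<in> {A<..B}" for k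
    using int_div_less_iff[OF assms, of A k] int_div_less_iff[OF assms, of B k] 
    unfolding greaterThanAtMost_iff not_less[symmetric] by blast
  show ?thesis
  proof (intro equalityI subsetI)
    fix n assume n: "n \<in> {n\<in>{A<..B}. g dvd n}"
    then obtain k where k: "n = g * k" by blast
    with n have "k \<in> {A div g<..B div g}" unfolding iff by blast
    with k show "n \<in> (\<lambda>k. g * k) ` {A div g<..B div g}" by blast
  next
    fix n assume "n \<in> (\<lambda>k. g * k) ` {A div g<..B div g}"
    then obtain k where k: "n = g * k" "k \<in> {A div g<..B div g}" by blast
    hence "n \<in> {A<..B}" unfolding iff by blast
    moreover have "g dvd n" using k(1) by (rule dvdI)
    ultimately show "n \<in> {n\<in>{A<..B}. g dvd n}" by blast
  qed
qed

lemma div_interval_length: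
  fixes A B g :: int
  assumes "g > 0" "A \<le> B"
  shows "real_of_int (B div g - A div g) \<le> (B - A) / g + 1" "B div g - A div g \<le> B - A" "A div g \<le> B div g"
proof -
  have "real_of_int (B div g) \<le> B / g"
  proof -
    have "B = g * (B div g) + B mod g" "B mod g \<ge> 0" using assms by simp_all
    hence "g * (B div g) \<le> B" by linarith
    hence "real_of_int (g * (B div g)) \<le> real_of_int B" by (simp only: of_int_le_iff)
    thus ?thesis using assms by (simp add: field_simps)
  qed
  moreover have "real_of_int (A div g) > A / g - 1"
  proof -
    have "A = g * (A div g) + A mod g" "A mod g < g" using assms by simp_all
    hence "A < g * (A div g) + g" by linarith
    hence "real_of_int A < real_of_int (g * (A div g) + g)" by (simp only: of_int_less_iff)
    thus ?thesis using assms by (simp add: field_simps)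
  qed
  ultimately show "real_of_int (B div g - A div g) \<le> (B - A) / g + 1"
    by (simp add: diff_divide_distrib)
  show "A div g \<le> B div g" using assms by (simp add: zdiv_mono1)
  have "B div g \<le> (A + (B - A) * g) div g"
  proof (rule zdiv_mono1)
    have "(B - A) * 1 \<le> (B - A) * g" using assms by (intro mult_left_mono) auto
    thus "B \<le> A + (B - A) * g" by simp
  qed (use assms in auto)
  thus "B div g - A div g \<le> B - A" using assms by simp
qed

lemma card_congruent_interval:
  assumes "g > 0"
  shows "real (card {b\<in>{A<..A + int V}. int g dvd b - a}) \<le> V / g + 1"
proof -
  have "{b\<in>{A<..A + int V}. int g dvd b - a} = (\<lambda>n. n + a) ` {n\<in>{A - a<..A - a + int V}. int g dvd n}"
  proof (intro equalityI subsetI)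
    fix x assume "x \<in> {b\<in>{A<..A + int V}. int g dvd b - a}"
    thus "x \<in> (\<lambda>n. n + a) ` {n\<in>{A - a<..A - a + int V}. int g dvd n}"
      by (intro image_eqI[of _ _ "x - a"]) auto
  qed auto
  hence "card {b\<in>{A<..A + int V}. int g dvd b - a} = card {n\<in>{A - a<..A - a + int V}. int g dvd n}"
    by (simp add: card_image)
  also have "\<dots> = card {(A - a) div int g<..(A - a + int V) div int g}"
  proof -
    have "int g > 0" using assms by simp
    thus ?thesis unfolding multiples_in_interval[OF \<open>int g > 0\<close>]
      by (intro card_image inj_onI) simp
  qed
  also have "real \<dots> = real_of_int ((A - a + int V) div int g - (A - a) div int g)"
    using div_interval_length(3)[of "int g" "A - a" "A - a + int V"] assms by simp
  also have "\<dots> \<le> V / g + 1"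
    using div_interval_length(1)[of "int g" "A - a" "A - a + int V"] assms by simp
  finally show ?thesis .
qed

definition sum4 :: "'b set \<Rightarrow> ('b \<Rightarrow> 'b \<Rightarrow> 'b \<Rightarrow> 'b \<Rightarrow> 'a) \<Rightarrow> 'a :: comm_monoid_add" where
  "sum4 I F = (\<Sum>a\<in>I. \<Sum>b\<in>I. \<Sum>c\<in>I. \<Sum>d\<in>I. F a b c d)"

lemma sum4_mono:
  fixes F G :: "'b \<Rightarrow> 'b \<Rightarrow> 'b \<Rightarrow> 'b \<Rightarrow> real"
  assumes "\<And>a b c d. a \<in> I \<Longrightarrow> b \<in> I \<Longrightarrow> c \<in> I \<Longrightarrow> d \<in> I \<Longrightarrow> F a b c d \<le> G a b c d"
  shows "sum4 I F \<le> sum4 I G"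
proof -
  have 1: "(\<Sum>d\<in>I. F a b c d) \<le> (\<Sum>d\<in>I. G a b c d)" if "a \<in> I" "b \<in> I" "c \<in> I" for a b c
    using assms that by (simp add: sum_mono)
  have 2: "(\<Sum>c\<in>I. \<Sum>d\<in>I. F a b c d) \<le> (\<Sum>c\<in>I. \<Sum>d\<in>I. G a b c d)" if "a \<in> I" "b \<in> I" for a b
    using 1 that by (simp add: sum_mono)
  have 3: "(\<Sum>b\<in>I. \<Sum>c\<in>I. \<Sum>d\<in>I. F a b c d) \<le> (\<Sum>b\<in>I. \<Sum>c\<in>I. \<Sum>d\<in>I. G a b c d)" if "a \<in> I" for a
    using 2 that by (simp add: sum_mono)
  show ?thesis unfolding sum4_def using 3 by (simp add: sum_mono)
qed

lemma sum4_add: "sum4 I (\<lambda>a b c d. F a b c d + G a b c d) = sum4 I F + sum4 I G"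
  by (simp add: sum4_def sum.distrib)

lemma sum4_cmult: "sum4 I (\<lambda>a b c d. (k::real) * F a b c d) = k * sum4 I F"
  by (simp add: sum4_def sum_distrib_left)

lemma sum4_swap23: "sum4 I (\<lambda>a b c d. F a c b d) = sum4 I F"
proof -
  have "(\<lambda>a. \<Sum>b\<in>I. \<Sum>c\<in>I. \<Sum>d\<in>I. F a c b d) = (\<lambda>a. \<Sum>b\<in>I. \<Sum>c\<in>I. \<Sum>d\<in>I. F a b c d)"
    by (rule ext) (rule sum.swap)
  thus ?thesis unfolding sum4_def by (rule arg_cong[of _ _ "\<lambda>f. sum f I"])
qed

lemma sum4_swap34: "sum4 I (\<lambda>a b c d. F a b d c) = sum4 I F"
proof -
  have "(\<lambda>a b. \<Sum>c\<in>I. \<Sum>d\<in>I. F a b d c) = (\<lambda>a b. \<Sum>c\<in>I. \<Sum>d\<in>I. F a b c d)"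
    by (rule ext, rule ext) (rule sum.swap)
  thus ?thesis unfolding sum4_def by (rule arg_cong[of _ _ "\<lambda>f. \<Sum>a\<in>I. \<Sum>b\<in>I. f a b"])
qed

lemma sum4_rotate: "sum4 I (\<lambda>a b c d. F a d b c) = sum4 I F"
  using sum4_swap34[of I "\<lambda>a b c d. F a c b d"] sum4_swap23[of I F] by simp

lemma sum4_pairs: "sum4 I (\<lambda>a b c d. (f a b :: real) * g c d) = (\<Sum>a\<in>I. \<Sum>b\<in>I. f a b) * (\<Sum>c\<in>I. \<Sum>d\<in>I. g c d)"
  unfolding sum4_def sum_distrib_left[symmetric] sum_distrib_right[symmetric] ..

lemma sum4_sum: "(\<Sum>x\<in>X. sum4 I (F x)) = sum4 I (\<lambda>a b c d. \<Sum>x\<in>X. F x a b c d)"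
proof -
  have "(\<Sum>x\<in>X. \<Sum>a\<in>I. \<Sum>b\<in>I. \<Sum>c\<in>I. \<Sum>d\<in>I. F x a b c d) = (\<Sum>a\<in>I. \<Sum>x\<in>X. \<Sum>b\<in>I. \<Sum>c\<in>I. \<Sum>d\<in>I. F x a b c d)"
    by (rule sum.swap)
  also have "\<dots> = (\<Sum>a\<in>I. \<Sum>b\<in>I. \<Sum>x\<in>X. \<Sum>c\<in>I. \<Sum>d\<in>I. F x a b c d)"
    by (intro sum.cong refl sum.swap)
  also have "\<dots> = (\<Sum>a\<in>I. \<Sum>b\<in>I. \<Sum>c\<in>I. \<Sum>x\<in>X. \<Sum>d\<in>I. F x a b c d)"
    by (intro sum.cong refl sum.swap)
  also have "\<dots> = (\<Sum>a\<in>I. \<Sum>b\<in>I. \<Sum>c\<in>I. \<Sum>d\<in>I. \<Sum>x\<in>X. F x a b c d)"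
    by (intro sum.cong refl sum.swap)
  finally show ?thesis by (simp add: sum4_def)
qed

lemma power4_sum: "(\<Sum>a\<in>I. f a) ^ 4 = sum4 I (\<lambda>a b c d. f a * f b * f c * (f d :: 'a :: comm_ring_1))"
  by (simp add: eval_nat_numeral sum4_def sum_distrib_left sum_distrib_right mult_ac)

lemma card_divisors_squarefree:
  fixes q :: nat
  assumes "squarefree q"
  shows "card {g. g dvd q} \<le> 2 ^ card (prime_factors q)"
proof -
  have q0: "q > 0" using assms by (auto intro: Nat.gr0I)
  have "inj_on prime_factors {g. g dvd q}"
  proof (rule inj_onI)
    fix x y assume "x \<in> {g. g dvd q}" "y \<in> {g. g dvd q}" "prime_factors x = prime_factors y"
    thus "x = y" using assms squarefree_eq_prod_primes squarefree_mono by (metis mem_Collect_eq)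
  qed
  moreover have "prime_factors ` {g. g dvd q} \<subseteq> Pow (prime_factors q)"
    using q0 dvd_prime_factors by blast
  ultimately have "card {g. g dvd q} \<le> card (Pow (prime_factors q))"
    by (metis card_inj_on_le finite_Pow_iff finite_set_mset)
  thus ?thesis by (simp add: card_Pow)
qed

lemma sum_dvd_pairs_le:
  assumes "g > 0"
  shows "(\<Sum>a\<in>{1..int V}. \<Sum>b\<in>{1..int V}. if int g dvd a - b then 1 else 0) \<le> real V * (V / g + 1)"
proof -
  have "(\<Sum>b\<in>{1..int V}. if int g dvd a - b then 1 else 0) \<le> V / g + 1" for a
  proof -
    have "{b\<in>{1..int V}. int g dvd a - b} = {b\<in>{0<..0 + int V}. int g dvd b - a}"
      by (auto simp: dvd_diff_commute)
    thus ?thesis using card_congruent_interval[OF assms, of 0 V a]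
      by (simp flip: sum.inter_filter)
  qed
  hence "(\<Sum>a\<in>{1..int V}. \<Sum>b\<in>{1..int V}. if int g dvd a - b then 1 else 0) \<le> (\<Sum>a\<in>{1..int V}. V / g + 1)"
    by (intro sum_mono)
  thus ?thesis by simp
qed

text \<open>Grouped by the gcd g <= V: the pairs with g dividing a - b number at most V (V/g + 1) <=
  2 V^2/g, so two such pairs save g^2, more than the weight g^(3/2). What remains is the number of
  divisors of q. The cut-off at \<open>V\<close> guards against the degenerate quadruples with a = b
  and c = d, whose gcd is all of q.\<close>

lemma sum4_prime_gcd_le:
  assumes q: "squarefree q"
  defines "P \<equiv> prime_factors q"
  shows "sum4 {1..int V} (\<lambda>a b c d. if prime_gcd P (a - b) (c - d) \<le> V then real (prime_gcd P (a - b) (c - d)) powr (3/2) else 0)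
      \<le> 4 * 2 ^ card P * real V ^ 4"
proof -
  let ?I = "{1..int V}"
  let ?G = "{g. g dvd q}"
  have q0: "q > 0" using q by (auto intro: Nat.gr0I)
  have fin: "finite ?G" using q0 by simp
  have P: "finite P" "\<And>p. p \<in> P \<Longrightarrow> prime p" by (auto simp: P_def)
  define h where "h = (\<lambda>g::nat. if g \<le> V then real g powr (3/2) else 0)"
  define e where "e = (\<lambda>(g::nat) (a::int) b. if int g dvd a - b then 1 else (0::real))"
  have h0: "h g \<ge> 0" for g by (simp add: h_def)
  have "sum4 ?I (\<lambda>a b c d. h (prime_gcd P (a - b) (c - d))) \<le> sum4 ?I (\<lambda>a b c d. \<Sum>g\<in>?G. h g * (e g a b * e g c d))"
  proof (rule sum4_mono)
    fix a b c d
    let ?g = "prime_gcd P (a - b) (c - d)"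
    have g: "?g \<in> ?G" using prime_gcd_dvd(3)[OF P, of "a - b" "c - d"] squarefree_eq_prod_primes[OF q] by (simp add: P_def)
    have "h ?g = h ?g * (e ?g a b * e ?g c d)" using prime_gcd_dvd(1,2)[OF P] by (simp add: e_def)
    also have "\<dots> \<le> (\<Sum>g\<in>?G. h g * (e g a b * e g c d))"
      by (rule member_le_sum[OF g]) (use fin h0 in \<open>auto simp: e_def\<close>)
    finally show "h ?g \<le> (\<Sum>g\<in>?G. h g * (e g a b * e g c d))" .
  qed
  also have "\<dots> = (\<Sum>g\<in>?G. h g * (\<Sum>a\<in>?I. \<Sum>b\<in>?I. e g a b)\<^sup>2)"
    by (simp add: sum4_pairs sum4_cmult power2_eq_square flip: sum4_sum)
  also have "\<dots> \<le> (\<Sum>g\<in>?G. 4 * real V ^ 4)"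
  proof (rule sum_mono)
    fix g assume "g \<in> ?G"
    hence g: "g > 0" using q0 by (auto intro: Nat.gr0I)
    show "h g * (\<Sum>a\<in>?I. \<Sum>b\<in>?I. e g a b)\<^sup>2 \<le> 4 * real V ^ 4"
    proof (cases "g \<le> V")
      case True
      have "(\<Sum>a\<in>?I. \<Sum>b\<in>?I. e g a b) \<le> real V * (V / g + 1)" unfolding e_def by (rule sum_dvd_pairs_le[OF g])
      also have "\<dots> \<le> real V * (V / g + V / g)" using True g by (intro mult_left_mono add_left_mono) auto
      also have "\<dots> = 2 * V^2 / g" by (simp add: power2_eq_square)
      finally have "(\<Sum>a\<in>?I. \<Sum>b\<in>?I. e g a b) \<le> 2 * V^2 / g" .
      hence "(\<Sum>a\<in>?I. \<Sum>b\<in>?I. e g a b)\<^sup>2 \<le> (2 * V^2 / g)^2"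
        by (intro power_mono sum_nonneg) (auto simp: e_def)
      hence "h g * (\<Sum>a\<in>?I. \<Sum>b\<in>?I. e g a b)\<^sup>2 \<le> real g powr (3/2) * (2 * V^2 / g)^2"
        using True by (simp add: h_def mult_left_mono)
      also have "\<dots> \<le> real g powr 2 * (2 * V^2 / g)^2"
        using g by (intro mult_right_mono powr_mono) auto
      also have "\<dots> = 4 * real V ^ 4" using g by (simp add: power_divide power_mult_distrib flip: power_mult)
      finally show ?thesis .
    qed (simp add: h_def)
  qed
  also have "\<dots> = card ?G * (4 * real V ^ 4)" by simp
  also have "\<dots> \<le> 2 ^ card P * (4 * real V ^ 4)"
    using card_divisors_squarefree[OF q] unfolding P_def by (intro mult_right_mono) (auto simp flip: of_nat_le_iff)
  finally show ?thesis by (simp add: h_def mult_ac)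
qed

lemma sum4_eq_pairs: 
  "sum4 {1..int V} (\<lambda>a b c d. if a = b \<and> c = d then 1 else 0 :: real) = real V ^ 2"
proof -
  have "sum4 {1..int V} (\<lambda>a b c d. if a = b \<and> c = d then 1 else 0 :: real)
     = sum4 {1..int V} (\<lambda>a b c d. (if a = b then 1 else 0 :: real) * (if c = d then 1 else 0))"
    by (intro arg_cong2[of _ _ _ _ sum4] refl ext) auto
  thus ?thesis by (simp add: sum4_pairs power2_eq_square)
qed

text \<open>The largest of the three bounds each root. This is crude, but the gcd sums can afford
  powers up to 2.\<close>

lemma sqrt_three_le:
  fixes x y z :: real
  assumes "x \<ge> 0" "y \<ge> 0" "z \<ge> 0"
  shows "sqrt x * sqrt y * sqrt z \<le> x powr (3/2) + y powr (3/2) + z powr (3/2)"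
proof -
  define m where "m = Max {x, y, z}"
  have m: "x \<le> m" "y \<le> m" "z \<le> m" "m = x \<or> m = y \<or> m = z" by (auto simp: m_def max_def)
  have m0: "m \<ge> 0" using m assms by auto
  have "sqrt x * sqrt y * sqrt z \<le> sqrt m * sqrt m * sqrt m"
    using m assms by (intro mult_mono) auto
  also have "\<dots> = m powr (1/2 + 1/2 + 1/2)" 
    using m0 by (simp only: powr_add powr_half_sqrt)
  also have "\<dots> \<le> x powr (3/2) + y powr (3/2) + z powr (3/2)"
    using m(4) by auto
  finally show ?thesis .
qed

lemma prime_gcd_le:
  assumes "finite P" "\<And>p. p \<in> P \<Longrightarrow> prime p" "x \<noteq> 0 \<or> y \<noteq> 0" "\<bar>x\<bar> \<le> int V" "\<bar>y\<bar> \<le> int V"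
  shows "prime_gcd P x y \<le> V"
proof -
  have "int (prime_gcd P x y) dvd x" "int (prime_gcd P x y) dvd y" using prime_gcd_dvd assms by blast+
  hence "int (prime_gcd P x y) \<le> int V" using assms(3-5) zdvd_imp_le[of "int (prime_gcd P x y)" "\<bar>x\<bar>"]
    zdvd_imp_le[of "int (prime_gcd P x y)" "\<bar>y\<bar>"] by auto
  thus ?thesis by simp
qed

text \<open>Expand the fourth power. Quadruples that pair up as integers number at most 3 V^2 and
  cost q each; for all others the gcds are at most \<open>V\<close> and the correlation bound
  applies. Constants: 12 = 3 * 4 from the pairings and the gcd sum, 52 = 26 * 2 from the
  correlations and the divisors.\<close>

lemma jac_fourth_moment:
  assumes q: "squarefree q" "odd q"
  shows "(\<Sum>x\<in>{0..<int q}. real_of_int (\<Sum>b\<in>{1..int V}. jac (x + b) q) ^ 4)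
     \<le> 3 * real V ^ 2 * q + 12 * 52 ^ card (prime_factors q) * sqrt q * real V ^ 4"
proof -
  define P where "P = prime_factors q"
  let ?I = "{1..int V}"
  have q0: "q > 0" using q by (auto intro: Nat.gr0I)
  have P: "finite P" "\<And>p. p \<in> P \<Longrightarrow> prime p" by (auto simp: P_def)
  define h where "h = (\<lambda>x y. if prime_gcd P x y \<le> V then real (prime_gcd P x y) powr (3/2) else 0)"
  define D where "D = (\<lambda>(a::int) b (c::int) d. if a = b \<and> c = d then 1 else 0 :: real)"
  have triv: "\<bar>real_of_int (quad_jac q a b c d)\<bar> \<le> q" for a b c d
  proof -
    have "\<bar>quad_jac q a b c d\<bar> \<le> (\<Sum>x\<in>{0..<int q}. 1)"
      unfolding quad_jac_def
    proof (intro order.trans[OF sum_abs] sum_mono)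
      fix x
      show "\<bar>jac (x + a) q * jac (x + b) q * jac (x + c) q * jac (x + d) q\<bar> \<le> 1"
        using jac_values[OF q0, of "x+a"] jac_values[OF q0, of "x+b"] jac_values[OF q0, of "x+c"] jac_values[OF q0, of "x+d"]
        by auto
    qed
    hence "\<bar>quad_jac q a b c d\<bar> \<le> int q" by simp
    thus ?thesis by linarith
  qed
  have D0: "D a b c d \<ge> 0" for a b c d by (simp add: D_def)
  have h0: "h x y \<ge> 0" for x y by (simp add: h_def)
  have e1: "(\<Sum>x\<in>{0..<int q}. (\<Sum>b\<in>?I. jac (x + b) q) ^ 4) = sum4 ?I (quad_jac q)"
    by (simp only: power4_sum sum4_sum quad_jac_def[abs_def])
  have e2: "real_of_int (sum4 ?I F) = sum4 ?I (\<lambda>a b c d. real_of_int (F a b c d))" for F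
    unfolding sum4_def by (simp only: of_int_sum)
  have e3: "(\<Sum>x\<in>{0..<int q}. real_of_int (\<Sum>b\<in>?I. jac (x + b) q) ^ 4)
    = real_of_int (\<Sum>x\<in>{0..<int q}. (\<Sum>b\<in>?I. jac (x + b) q) ^ 4)"
    by (simp only: of_int_sum of_int_power)
  have e4: "(\<Sum>x\<in>{0..<int q}. real_of_int (\<Sum>b\<in>?I. jac (x + b) q) ^ 4) = sum4 ?I (\<lambda>a b c d. real_of_int (quad_jac q a b c d))"
    unfolding e3 e1 e2 ..
  have hs: "sum4 ?I (\<lambda>a b c d. h (a - b) (c - d)) \<le> 4 * 2 ^ card P * real V ^ 4"
    unfolding h_def P_def by (rule sum4_prime_gcd_le[OF q(1)])
  have Ds: "sum4 ?I D = real V ^ 2"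
    unfolding D_def by (rule sum4_eq_pairs)
  define K where "K = 26 ^ card P * sqrt (real q)"
  have K0: "K \<ge> 0" by (simp add: K_def)
  have le: "sum4 ?I (\<lambda>a b c d. real_of_int (quad_jac q a b c d)) \<le> sum4 ?I (\<lambda>a b c d. real q * (D a b c d + D a c b d + D a d b c) 
      + K * (h (a - b) (c - d) + h (a - c) (b - d) + h (a - d) (b - c)))"
  proof (rule sum4_mono)
    fix a b c d assume I: "a \<in> ?I" "b \<in> ?I" "c \<in> ?I" "d \<in> ?I"
    let ?D = "D a b c d + D a c b d + D a d b c"
    let ?h = "h (a - b) (c - d) + h (a - c) (b - d) + h (a - d) (b - c)"
    have nn: "?D \<ge> 0" "?h \<ge> 0" using D0 h0 by (simp_all add: add_nonneg_nonneg)
    show "real_of_int (quad_jac q a b c d) \<le> real q * ?D + K * ?h"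
    proof (cases "?D \<ge> 1")
      case True
      have "real_of_int (quad_jac q a b c d) \<le> real q * 1" using triv[of a b c d] by simp
      also have "\<dots> \<le> real q * ?D" using True by (intro mult_left_mono) auto
      also have "\<dots> \<le> real q * ?D + K * ?h" using nn K0 by simp
      finally show ?thesis .
    next
      case False
      hence "D a b c d \<noteq> 1" "D a c b d \<noteq> 1" "D a d b c \<noteq> 1"
        using D0[of a b c d] D0[of a c b d] D0[of a d b c] by linarith+
      hence ne: "\<not> (a = b \<and> c = d)" "\<not> (a = c \<and> b = d)" "\<not> (a = d \<and> b = c)"
        unfolding D_def by metis+
      have "prime_gcd P (a - b) (c - d) \<le> V" "prime_gcd P (a - c) (b - d) \<le> V" "prime_gcd P (a - d) (b - c) \<le> V"
        using ne I by (intro prime_gcd_le P; auto)+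
      hence "sqrt (prime_gcd P (a - b) (c - d)) * sqrt (prime_gcd P (a - c) (b - d)) * sqrt (prime_gcd P (a - d) (b - c)) \<le> ?h"
        using sqrt_three_le[of "prime_gcd P (a - b) (c - d)" "prime_gcd P (a - c) (b - d)" "prime_gcd P (a - d) (b - c)"]
        by (simp add: h_def)
      hence "K * (sqrt (prime_gcd P (a - b) (c - d)) * sqrt (prime_gcd P (a - c) (b - d)) * sqrt (prime_gcd P (a - d) (b - c)))
         \<le> K * ?h" using K0 by (intro mult_left_mono) auto
      hence "real_of_int (quad_jac q a b c d) \<le> K * ?h"
        using quad_jac_bound[OF q, of a b c d] unfolding P_def K_def by linarith
      thus ?thesis using nn by (simp add: add_increasing)
    qed
  qed
  also have "sum4 ?I (\<lambda>a b c d. real q * (D a b c d + D a c b d + D a d b c) 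
      + K * (h (a - b) (c - d) + h (a - c) (b - d) + h (a - d) (b - c)))
      = real q * (3 * sum4 ?I D) + K * (3 * sum4 ?I (\<lambda>a b c d. h (a - b) (c - d)))"
    using sum4_swap23[of ?I D] sum4_rotate[of ?I D]
      sum4_swap23[of ?I "\<lambda>a b c d. h (a - b) (c - d)"] sum4_rotate[of ?I "\<lambda>a b c d. h (a - b) (c - d)"]
    by (simp only: sum4_add sum4_cmult) simp
  also have "\<dots> \<le> real q * (3 * real V ^ 2) + K * (3 * (4 * 2 ^ card P * real V ^ 4))"
    using hs Ds K0 by (intro add_mono mult_left_mono) simp_all
  also have "\<dots> = 3 * real V ^ 2 * real q + 12 * (26 ^ card P * 2 ^ card P) * sqrt (real q) * real V ^ 4"
    by (simp add: K_def mult_ac)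
  also have "26 ^ card P * 2 ^ card P = (52 ^ card P :: real)" by (simp flip: power_mult_distrib)
  finally show ?thesis unfolding e4 P_def .
qed

text \<open>Only finitely many primes have p^\<epsilon> < C, and these contribute a constant; every
  other prime factor pays for its C with p^\<epsilon>.\<close>

lemma power_card_prime_factors_le:
  fixes C \<epsilon> :: real
  assumes "C \<ge> 1" "\<epsilon> > 0"
  obtains K where "K \<ge> 1" "\<And>q :: nat. q > 0 \<Longrightarrow> C ^ card (prime_factors q) \<le> K * real q powr \<epsilon>"
proof
  define T where "T = {p :: nat. real p powr \<epsilon> < C}"
  have "T \<subseteq> {..nat \<lceil>C powr (1/\<epsilon>)\<rceil>}"
  proof
    fix p assume "p \<in> T"
    hence "(real p powr \<epsilon>) powr (1/\<epsilon>) \<le> C powr (1/\<epsilon>)"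
      using assms by (intro powr_mono2) (auto simp: T_def)
    hence "real p \<le> C powr (1/\<epsilon>)" using assms by (simp add: powr_powr)
    thus "p \<in> {..nat \<lceil>C powr (1/\<epsilon>)\<rceil>}" unfolding atMost_iff by linarith
  qed
  hence finT: "finite T" by (rule finite_subset) simp
  show "C ^ card T \<ge> 1" using assms by simp
  fix q :: nat assume q: "q > 0"
  let ?P = "prime_factors q"
  have "C ^ card ?P = C ^ card (?P \<inter> T) * C ^ card (?P - T)"
    by (simp flip: power_add card_Un_disjoint) (metis Int_Diff_Un Int_Diff_disjoint card_Un_disjoint finite_Diff finite_Int finite_set_mset)
  also have "\<dots> \<le> C ^ card T * real q powr \<epsilon>"
  proof (intro mult_mono)
    show "C ^ card (?P \<inter> T) \<le> C ^ card T"
      using assms finT by (intro power_increasing card_mono) auto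
    have "C ^ card (?P - T) = (\<Prod>p\<in>?P - T. C)" by simp
    also have "\<dots> \<le> (\<Prod>p\<in>?P - T. real p powr \<epsilon>)"
      using assms by (intro prod_mono) (auto simp: T_def not_less)
    also have "\<dots> = (\<Prod>p\<in>?P - T. real p) powr \<epsilon>" by (simp add: prod_powr_distrib)
    also have "\<dots> \<le> real q powr \<epsilon>"
    proof (intro powr_mono2)
      have "(\<Prod>p\<in>?P - T. p) dvd (\<Prod>p\<in>?P. p)" by (intro prod_dvd_prod_subset) auto
      also have "(\<Prod>p\<in>?P. p) dvd (\<Prod>p\<in>?P. p ^ multiplicity p q)"
        by (intro prod_dvd_prod dvd_power) (auto simp: prime_factors_multiplicity)
      also have "(\<Prod>p\<in>?P. p ^ multiplicity p q) = q" using q by (intro prime_factorization_nat[symmetric])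
      finally have "(\<Prod>p\<in>?P - T. p) \<le> q" using q by (simp add: dvd_imp_le)
      thus "(\<Prod>p\<in>?P - T. real p) \<le> real q" by (simp flip: of_nat_prod)
    qed (use assms in \<open>auto intro: prod_nonneg\<close>)
    finally show "C ^ card (?P - T) \<le> real q powr \<epsilon>" .
  qed (use assms in auto)
  finally show "C ^ card ?P \<le> C ^ card T * real q powr \<epsilon>" .
qed

lemma card_prime_factors_le_log: "q > 0 \<Longrightarrow> real (card (prime_factors q)) \<le> log 2 (real q)" for q :: nat
proof -
  assume q: "q > 0"
  let ?P = "prime_factors q"
  have "2 ^ card ?P = (\<Prod>p\<in>?P. 2::nat)" by simp
  also have "\<dots> \<le> (\<Prod>p\<in>?P. p ^ multiplicity p q)"
  proof (rule prod_mono, safe)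
    fix p assume p: "p \<in> prime_factors q"
    have "2 \<le> p" using p prime_ge_2_nat by (auto simp: in_prime_factors_iff)
    also have "p ^ 1 \<le> p ^ multiplicity p q" using p \<open>2 \<le> p\<close>
      by (intro power_increasing) (auto simp: prime_factors_multiplicity)
    finally show "2 \<le> p ^ multiplicity p q" by simp
  qed
  also have "\<dots> = q" using q by (intro prime_factorization_nat[symmetric])
  finally have "real (2 ^ card ?P) \<le> real q" by (simp only: of_nat_le_iff)
  hence "2 powr real (card ?P) \<le> real q" by (simp add: powr_realpow)
  thus ?thesis using q by (simp add: le_log_iff)
qed

section \<open>Chebyshev's lower bound\<close>

lemma card_prime_powers_le:
  assumes p: "prime p" and N: "N > 0"
  shows "real (card {d\<in>{1..N}. primepow d \<and> aprimedivisor d = p}) * ln (real p) \<le> ln (real N)"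
proof -
  define E where "E = {k. k > 0 \<and> p ^ k \<le> N}"
  have p2: "p \<ge> 2" using p prime_ge_2_nat by blast
  have sub: "E \<subseteq> {1..N}"
  proof
    fix k assume "k \<in> E"
    hence "k > 0" "p ^ k \<le> N" by (auto simp: E_def)
    moreover have "k < p ^ k" using p2 by (intro power_gt_expt) auto
    ultimately show "k \<in> {1..N}" by simp
  qed
  hence fin: "finite E" by (rule finite_subset) simp
  have "{d\<in>{1..N}. primepow d \<and> aprimedivisor d = p} \<subseteq> (\<lambda>k. p ^ k) ` E"
  proof
    fix d assume d: "d \<in> {d\<in>{1..N}. primepow d \<and> aprimedivisor d = p}"
    then obtain q k where qk: "prime q" "k > 0" "d = q ^ k" by (auto simp: primepow_def)
    have "q = p" using d qk by (simp add: aprimedivisor_prime_power)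
    thus "d \<in> (\<lambda>k. p ^ k) ` E" using d qk by (auto simp: E_def)
  qed
  hence "card {d\<in>{1..N}. primepow d \<and> aprimedivisor d = p} \<le> card E"
    using fin by (rule surj_card_le[rotated])
  moreover have "real (card E) * ln (real p) \<le> ln (real N)"
  proof (cases "E = {}")
    case False
    have M: "Max E \<in> E" using fin False by simp
    have "E \<subseteq> {1..Max E}" using fin by (auto simp: E_def)
    hence "card E \<le> Max E" by (metis card_atLeastAtMost card_mono diff_Suc_1 finite_atLeastAtMost)
    hence "real (card E) * ln (real p) \<le> real (Max E) * ln (real p)"
      using p2 by (intro mult_right_mono) auto
    also have "\<dots> = ln (real (p ^ Max E))" using p2 by (simp add: ln_realpow)
    also have "\<dots> \<le> ln (real N)"
    proof (subst ln_le_cancel_iff)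
      show "real (p ^ Max E) \<le> real N" using M unfolding E_def of_nat_le_iff by blast
    qed (use p2 N in auto)
    finally show ?thesis .
  qed (use N in simp)
  moreover have "ln (real p) \<ge> 0" using p2 by simp
  ultimately show ?thesis by (meson mult_right_mono of_nat_le_iff order_trans)
qed

text \<open>A prime p contributes log p for each of its powers up to N, in total at most log
  N.\<close>

lemma sum_mangoldt_le:
  assumes N: "N > 0"
  shows "(\<Sum>d\<in>{1..N}. mangoldt d :: real) \<le> real (card {p. prime p \<and> p \<le> N}) * ln (real N)"
proof -
  define A where "A = {d\<in>{1..N}. primepow d}"
  define P where "P = {p. prime p \<and> p \<le> N}"
  have finP: "finite P" by (rule finite_subset[of _ "{..N}"]) (auto simp: P_def)
  have img: "aprimedivisor ` A \<subseteq> P"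
  proof (intro image_subsetI)
    fix d assume "d \<in> A"
    hence d: "d > 1" "d \<le> N" by (auto simp: A_def dest: primepow_gt_Suc_0)
    have "aprimedivisor d \<le> d" using d by (intro aprimedivisor_le_nat) auto
    moreover have "prime (aprimedivisor d)"
    proof -
      obtain q k where "prime q" "k > 0" "d = q ^ k" using \<open>d \<in> A\<close> by (auto simp: A_def primepow_def)
      thus ?thesis by (simp add: aprimedivisor_prime_power)
    qed
    ultimately show "aprimedivisor d \<in> P" using d by (simp add: P_def)
  qed
  have "(\<Sum>d\<in>{1..N}. mangoldt d :: real) = (\<Sum>d\<in>A. ln (real (aprimedivisor d)))"
    unfolding A_def by (subst sum.inter_filter) (auto simp: mangoldt_def intro!: sum.cong)
  also have "\<dots> = (\<Sum>p\<in>P. \<Sum>d\<in>{d\<in>A. aprimedivisor d = p}. ln (real (aprimedivisor d)))"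
    by (rule sum.group[symmetric]) (use finP img in \<open>auto simp: A_def\<close>)
  also have "\<dots> \<le> (\<Sum>p\<in>P. ln (real N))"
  proof (rule sum_mono)
    fix p assume "p \<in> P"
    hence p: "prime p" by (simp add: P_def)
    have "(\<Sum>d\<in>{d\<in>A. aprimedivisor d = p}. ln (real (aprimedivisor d)))
        = (\<Sum>d\<in>{d\<in>{1..N}. primepow d \<and> aprimedivisor d = p}. ln (real p))"
      by (rule sum.cong) (auto simp: A_def)
    also have "\<dots> \<le> ln (real N)" using card_prime_powers_le[OF p N] by simp
    finally show "(\<Sum>d\<in>{d\<in>A. aprimedivisor d = p}. ln (real (aprimedivisor d))) \<le> ln (real N)" .
  qed
  finally show ?thesis by (simp add: P_def)
qed

text \<open>Legendre's formula for the factorial. The range may extend to any N >= n because n div d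
  = 0 beyond n; this lets m! and (2m)! share one range.\<close>

lemma ln_fact_mangoldt:
  "N \<ge> n \<Longrightarrow> ln (fact n) = (\<Sum>d\<in>{1..N}. mangoldt d * real (n div d))"
proof -
  assume N: "N \<ge> n"
  have "ln (fact n :: real) = (\<Sum>k\<in>{1..n}. ln (real k))"
    by (simp add: fact_prod, subst ln_prod) auto
  also have "\<dots> = (\<Sum>k\<in>{1..n}. \<Sum>d | d dvd k. mangoldt d)"
    by (intro sum.cong refl) (simp add: mangoldt_sum)
  also have "\<dots> = (\<Sum>k\<in>{1..n}. \<Sum>d\<in>{1..N}. if d dvd k then mangoldt d else 0)"
  proof (rule sum.cong[OF refl])
    fix k assume k: "k \<in> {1..n}"
    have "{d. d dvd k} = {d\<in>{1..N}. d dvd k}" 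
      using k N by (auto dest: dvd_imp_le intro!: Nat.gr0I simp: Suc_le_eq)
    thus "(\<Sum>d | d dvd k. mangoldt d :: real) = (\<Sum>d\<in>{1..N}. if d dvd k then mangoldt d else 0)"
      by (simp only:) (rule sum.inter_filter, simp)
  qed
  also have "\<dots> = (\<Sum>d\<in>{1..N}. \<Sum>k\<in>{1..n}. if d dvd k then mangoldt d else 0)"
    by (rule sum.swap)
  also have "\<dots> = (\<Sum>d\<in>{1..N}. mangoldt d * real (n div d))"
  proof (intro sum.cong refl)
    fix d assume d: "d \<in> {1..N}"
    have "{k\<in>{1..n}. d dvd k} = (\<lambda>j. d * j) ` {1..n div d}"
    proof (intro equalityI subsetI)
      fix k assume "k \<in> {k\<in>{1..n}. d dvd k}"
      then obtain j where j: "k = d * j" "1 \<le> d * j" "d * j \<le> n" by (auto elim!: dvdE)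
      have "j \<le> n div d" using j d by (simp add: less_eq_div_iff_mult_less_eq mult.commute)
      moreover have "j \<ge> 1" using j by (cases j) auto
      ultimately show "k \<in> (\<lambda>j. d * j) ` {1..n div d}" using j by auto
    next
      fix k assume "k \<in> (\<lambda>j. d * j) ` {1..n div d}"
      then obtain j where "k = d * j" "j \<in> {1..n div d}" by blast
      hence j: "k = d * j" "1 \<le> j" "j \<le> n div d" by auto
      have "d * j \<le> n" using j d by (simp add: less_eq_div_iff_mult_less_eq mult.commute)
      thus "k \<in> {k\<in>{1..n}. d dvd k}" using j d by auto
    qed
    hence "card {k\<in>{1..n}. d dvd k} = n div d" using d by (simp add: card_image inj_on_def)
    moreover have "(\<Sum>k\<in>{1..n}. if d dvd k then mangoldt d else 0 :: real) = (\<Sum>k\<in>{k\<in>{1..n}. d dvd k}. mangoldt d)"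
      by (rule sum.inter_filter[symmetric]) simp
    ultimately show "(\<Sum>k\<in>{1..n}. if d dvd k then mangoldt d else 0) = mangoldt d * real (n div d)"
      by simp
  qed
  finally show ?thesis .
qed

text \<open>In the Mangoldt expansion of the central binomial coefficient the weights floor(2m/d) -
  2 floor(m/d) are at most 1.\<close>

lemma ln_central_binomial_le:
  assumes "m > 0"
  shows "ln (real ((2 * m) choose m)) \<le> real (card {p. prime p \<and> p \<le> 2 * m}) * ln (real (2 * m))"
proof -
  have "real ((2 * m) choose m) = fact (2 * m) / (fact m * fact m)"
    by (subst binomial_fact) (simp_all add: mult_2)
  hence "ln (real ((2 * m) choose m)) = ln (fact (2 * m)) - 2 * ln (fact m)"
    by (simp add: ln_div ln_mult)
  also have "\<dots> = (\<Sum>d\<in>{1..2*m}. mangoldt d * (real (2 * m div d) - 2 * real (m div d)))"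
    using ln_fact_mangoldt[of "2*m" "2*m"] ln_fact_mangoldt[of m "2*m"]
    by (simp add: right_diff_distrib sum_subtractf sum_distrib_left mult_ac)
  also have "\<dots> \<le> (\<Sum>d\<in>{1..2*m}. mangoldt d * 1)"
  proof (intro sum_mono mult_left_mono mangoldt_nonneg)
    fix d assume d: "d \<in> {1..2*m}"
    have "2 * m = 2 * (d * (m div d) + m mod d)" by simp
    moreover have "m mod d < d" using d by simp
    ultimately have "2 * m < d * (2 * (m div d) + 2)" by (simp only: distrib_left)
    hence "2 * m div d < 2 * (m div d) + 2" by (simp add: less_mult_imp_div_less mult.commute)
    thus "real (2 * m div d) - 2 * real (m div d) \<le> 1" by linarith
  qed
  also have "\<dots> \<le> real (card {p. prime p \<and> p \<le> 2 * m}) * ln (real (2 * m))"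
    using sum_mangoldt_le[of "2 * m"] assms by simp
  finally show ?thesis .
qed

lemma prime_pi_eq: "x \<ge> 0 \<Longrightarrow> prime_pi x = card {p. prime p \<and> p \<le> nat \<lfloor>x\<rfloor>}"
  unfolding prime_pi_def by (intro arg_cong[of _ _ card] Collect_cong conj_cong refl) linarith

text \<open>From 4^m/(2m) <= binomial(2m, m) with m = floor(x/2). The crude ln 4 >= 1 gives about
  x/(2 ln x), twice the claim, which leaves room for rounding and for the factor 2m.\<close>

lemma prime_pi_lower_bound: "\<forall>\<^sub>F x in at_top. real (prime_pi x) \<ge> x / (4 * ln x)"
proof -
  have ev: "\<forall>\<^sub>F x::real in at_top. x / (4 * ln x) * ln x \<le> (x / 2 - 1) - ln x \<and> x \<ge> 4"
    by (intro eventually_conj eventually_ge_at_top) real_asymp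
  have ln4: "ln 4 \<ge> (1::real)"
    using ln2_ge_two_thirds ln_realpow[of 2 2] by simp
  show ?thesis using ev
  proof eventually_elim
    case (elim x)
    define m where "m = nat \<lfloor>x / 2\<rfloor>"
    have m: "real m \<le> x / 2" "real m > x / 2 - 1" "m > 0" using elim unfolding m_def by linarith+
    have lnx: "ln x > 0" using elim by simp
    have fin: "finite {p. prime p \<and> p \<le> nat \<lfloor>x\<rfloor>}" by (rule finite_subset[of _ "{..nat \<lfloor>x\<rfloor>}"]) auto
    have "(x / 2 - 1) * 1 - ln x \<le> real m * ln 4 - ln (real (2 * m))"
      using m elim ln4 by (intro diff_mono mult_mono) auto
    also have "\<dots> = ln (4 ^ m / (2 * real m))" using m by (simp add: ln_div ln_realpow)
    also have "\<dots> \<le> ln (real ((2 * m) choose m))"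
      using central_binomial_lower_bound[OF m(3)] m by (subst ln_le_cancel_iff) auto
    also have "\<dots> \<le> real (card {p. prime p \<and> p \<le> 2 * m}) * ln (real (2 * m))"
      by (rule ln_central_binomial_le[OF m(3)])
    also have "\<dots> \<le> real (prime_pi x) * ln x"
    proof (intro mult_mono)
      have "2 * m \<le> nat \<lfloor>x\<rfloor>" using m by linarith
      hence "{p. prime p \<and> p \<le> 2 * m} \<subseteq> {p. prime p \<and> p \<le> nat \<lfloor>x\<rfloor>}" by auto
      thus "real (card {p. prime p \<and> p \<le> 2 * m}) \<le> real (prime_pi x)"
        using elim fin by (simp add: prime_pi_eq card_mono)
    qed (use m elim in auto)
    finally have "x / 2 - 1 - ln x \<le> real (prime_pi x) * ln x" by simp
    hence "x / (4 * ln x) * ln x \<le> real (prime_pi x) * ln x" by (rule order.trans[OF conjunct1[OF elim]])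
    thus ?case using lnx by (simp only: mult_le_cancel_right)
  qed
qed

section \<open>Burgess's bound\<close>

definition jac_sum :: "nat \<Rightarrow> int \<Rightarrow> nat \<Rightarrow> int" where
  "jac_sum q A N = (\<Sum>n\<in>{A<..A + int N}. jac n q)"

lemma jac_sum_add: "jac_sum q A (M + N) = jac_sum q A M + jac_sum q (A + int M) N"
proof -
  have "{A<..A + int (M + N)} = {A<..A + int M} \<union> {A + int M<..A + int M + int N}" by auto
  thus ?thesis unfolding jac_sum_def by (simp only:) (rule sum.union_disjoint; force)
qed

text \<open>Sliding the interval costs only the two end pieces.\<close>

lemma jac_sum_shift: "jac_sum q A N = jac_sum q (A + int k) N + jac_sum q A k - jac_sum q (A + int N) k"
  using jac_sum_add[of q A k N] jac_sum_add[of q A N k] by (simp add: add.commute)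

lemma abs_jac_sum_le: "q > 0 \<Longrightarrow> \<bar>jac_sum q A N\<bar> \<le> int N"
proof -
  assume "q > 0"
  hence "\<bar>jac_sum q A N\<bar> \<le> (\<Sum>n\<in>{A<..A + int N}. 1)"
    unfolding jac_sum_def by (intro order.trans[OF sum_abs] sum_mono abs_jac_le)
  thus ?thesis by simp
qed

text \<open>Hoelder's inequality with exponents 2, 4, 4, as two applications of
  Cauchy-Schwarz.\<close>

lemma holder_four:
  fixes \<nu> f :: "'a \<Rightarrow> real"
  assumes "\<And>x. x \<in> X \<Longrightarrow> \<nu> x \<ge> 0"
  shows "(\<Sum>x\<in>X. \<nu> x * f x) ^ 4 \<le> (\<Sum>x\<in>X. \<nu> x)\<^sup>2 * (\<Sum>x\<in>X. (\<nu> x)\<^sup>2) * (\<Sum>x\<in>X. f x ^ 4)"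
proof -
  have "(\<Sum>x\<in>X. \<nu> x * f x)\<^sup>2 = (\<Sum>x\<in>X. sqrt (\<nu> x) * (sqrt (\<nu> x) * f x))\<^sup>2"
    using assms by (simp add: mult.assoc[symmetric])
  also have "\<dots> \<le> (\<Sum>x\<in>X. (sqrt (\<nu> x))\<^sup>2) * (\<Sum>x\<in>X. (sqrt (\<nu> x) * f x)\<^sup>2)"
    by (rule Cauchy_Schwarz_ineq_sum)
  also have "\<dots> = (\<Sum>x\<in>X. \<nu> x) * (\<Sum>x\<in>X. \<nu> x * (f x)\<^sup>2)"
    using assms by (simp add: power_mult_distrib)
  finally have 1: "(\<Sum>x\<in>X. \<nu> x * f x)\<^sup>2 \<le> (\<Sum>x\<in>X. \<nu> x) * (\<Sum>x\<in>X. \<nu> x * (f x)\<^sup>2)" .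
  have 2: "(\<Sum>x\<in>X. \<nu> x * (f x)\<^sup>2)\<^sup>2 \<le> (\<Sum>x\<in>X. (\<nu> x)\<^sup>2) * (\<Sum>x\<in>X. ((f x)\<^sup>2)\<^sup>2)"
    by (rule Cauchy_Schwarz_ineq_sum)
  have "(\<Sum>x\<in>X. \<nu> x * f x) ^ 4 = ((\<Sum>x\<in>X. \<nu> x * f x)\<^sup>2)\<^sup>2" by simp
  also have "\<dots> \<le> ((\<Sum>x\<in>X. \<nu> x) * (\<Sum>x\<in>X. \<nu> x * (f x)\<^sup>2))\<^sup>2"
    by (intro power_mono 1) simp
  also have "\<dots> \<le> (\<Sum>x\<in>X. \<nu> x)\<^sup>2 * ((\<Sum>x\<in>X. (\<nu> x)\<^sup>2) * (\<Sum>x\<in>X. ((f x)\<^sup>2)\<^sup>2))"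
    unfolding power_mult_distrib by (intro mult_left_mono 2) simp
  finally show ?thesis by (simp add: mult.assoc)
qed

lemma sum_fibre_count:
  fixes F :: "'b \<Rightarrow> real"
  assumes "finite T" "finite X" "f ` T \<subseteq> X"
  shows "(\<Sum>t\<in>T. F (f t)) = (\<Sum>x\<in>X. real (card {t\<in>T. f t = x}) * F x)"
proof -
  have "(\<Sum>t\<in>T. F (f t)) = (\<Sum>x\<in>X. \<Sum>t\<in>{t\<in>T. f t = x}. F (f t))"
    by (rule sum.group[symmetric]) (use assms in auto)
  also have "\<dots> = (\<Sum>x\<in>X. real (card {t\<in>T. f t = x}) * F x)"
    by (intro sum.cong refl) simp
  finally show ?thesis .
qed

text \<open>Counts the coincidences n/a = m/b modulo q. The difference of two solutions satisfies
  the same congruence with both sides below q/2 in absolute value, hence as an equation of integers;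
  as a and b are coprime, this fixes n modulo a, and n determines m.\<close>

lemma ratio_pairs_le:
  assumes q: "2 * U * N \<le> q" "q > 0" and a: "prime a" "prime b" "a \<noteq> b" "a \<le> U" "b \<le> U" "\<not> a dvd q" "coprime a q"
  shows "real (card {(n, m). n \<in> {A<..A + int N} \<and> m \<in> {A<..A + int N} \<and> int q dvd n * int b - m * int a}) \<le> N / a + 1"
proof -
  let ?I = "{A<..A + int N}"
  let ?E = "{(n, m). n \<in> ?I \<and> m \<in> ?I \<and> int q dvd n * int b - m * int a}"
  have fin: "finite ?E" by (rule finite_subset[of _ "?I \<times> ?I"]) auto
  have a0: "a > 0" "b > 0" using a prime_gt_0_nat by auto
  have key: "(n1 - n2) * int b = (m1 - m2) * int a" if "(n1, m1) \<in> ?E" "(n2, m2) \<in> ?E" for n1 m1 n2 m2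
  proof -
    have "int q dvd (n1 * int b - m1 * int a) - (n2 * int b - m2 * int a)"
      by (rule dvd_diff) (use that in auto)
    hence d: "int q dvd (n1 - n2) * int b - (m1 - m2) * int a" by (simp add: algebra_simps)
    have N: "\<bar>n1 - n2\<bar> < int N" "\<bar>m1 - m2\<bar> < int N" using that by auto
    have "\<bar>(n1 - n2) * int b\<bar> < int N * int U"
    proof -
      have "\<bar>(n1 - n2) * int b\<bar> = \<bar>n1 - n2\<bar> * int b" by (simp add: abs_mult)
      also have "\<dots> < int N * int b" using N a0 by (intro mult_strict_right_mono) auto
      also have "\<dots> \<le> int N * int U" using a by (intro mult_left_mono) auto
      finally show ?thesis .
    qed
    moreover have "\<bar>(m1 - m2) * int a\<bar> < int N * int U"
    proof -
      have "\<bar>(m1 - m2) * int a\<bar> = \<bar>m1 - m2\<bar> * int a" by (simp add: abs_mult)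
      also have "\<dots> < int N * int a" using N a0 by (intro mult_strict_right_mono) auto
      also have "\<dots> \<le> int N * int U" using a by (intro mult_left_mono) auto
      finally show ?thesis .
    qed
    moreover have "2 * (int N * int U) \<le> int q" using q(1) by (simp flip: of_nat_mult add: mult_ac)
    ultimately have "\<bar>(n1 - n2) * int b - (m1 - m2) * int a\<bar> < int q" by linarith
    thus ?thesis using d zdvd_not_zless[of "\<bar>(n1 - n2) * int b - (m1 - m2) * int a\<bar>" "int q"] by fastforce
  qed
  show ?thesis
  proof (cases "?E = {}")
    case False
    then obtain n0 m0 where E0: "(n0, m0) \<in> ?E" by auto
    have "inj_on fst ?E"
    proof (rule inj_onI)
      fix x y assume xy: "x \<in> ?E" "y \<in> ?E" "fst x = fst y"
      have "(fst x - fst y) * int b = (snd x - snd y) * int a"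
        using xy(1,2) by (intro key) (simp_all only: prod.collapse)
      thus "x = y" using xy(3) a0 by (simp add: prod_eq_iff)
    qed
    moreover have "fst ` ?E \<subseteq> {n\<in>?I. int a dvd n - n0}"
    proof clarify
      fix n m assume nm: "n \<in> ?I" "m \<in> ?I" "int q dvd n * int b - m * int a"
      hence "(n - n0) * int b = (m - m0) * int a" using E0 by (intro key) auto
      hence "int a dvd (n - n0) * int b" by simp
      moreover have "coprime (int a) (int b)" using a primes_coprime by simp
      ultimately have "int a dvd n - n0" by (simp add: coprime_dvd_mult_left_iff)
      thus "fst (n, m) \<in> ?I \<and> int a dvd fst (n, m) - n0" using nm by simp
    qed
    moreover have "finite {n\<in>?I. int a dvd n - n0}" by (rule finite_subset[of _ ?I]) auto
    ultimately have "card ?E \<le> card {n\<in>?I. int a dvd n - n0}"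
      by (rule card_inj_on_le)
    thus ?thesis using card_congruent_interval[OF a0(1), of A N n0] by linarith
  qed (simp only:, simp)
qed

lemma sum_max_le:
  "(\<Sum>a\<in>{1..U}. \<Sum>b\<in>{1..U}. 1 / real (max a b)) \<le> 2 * real U"
proof -
  define g where "g = (\<lambda>a b. if b \<le> a then 1 / real a else 0 :: real)"
  have g0: "g a b \<ge> 0" for a b by (simp add: g_def)
  have le: "1 / real (max a b) \<le> g a b + g b a" for a b
    by (cases "a \<le> b") (auto simp: g_def max_def)
  have g1: "(\<Sum>b\<in>{1..U}. g a b) = 1" if "a \<in> {1..U}" for a
  proof -
    have "(\<Sum>b\<in>{1..U}. g a b) = (\<Sum>b\<in>{1..a}. 1 / real a)"
      by (rule sum.mono_neutral_cong_right) (use that in \<open>auto simp: g_def\<close>)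
    also have "\<dots> = 1" using that by simp
    finally show ?thesis .
  qed
  have s1: "(\<Sum>a\<in>{1..U}. \<Sum>b\<in>{1..U}. g a b) = real U"
    by (subst sum.cong[OF refl g1]) simp_all
  have s2: "(\<Sum>a\<in>{1..U}. \<Sum>b\<in>{1..U}. g b a) = real U"
    by (subst sum.swap) (rule s1)
  have "(\<Sum>a\<in>{1..U}. \<Sum>b\<in>{1..U}. 1 / real (max a b)) \<le> (\<Sum>a\<in>{1..U}. \<Sum>b\<in>{1..U}. g a b + g b a)"
    by (rule sum_mono, rule sum_mono, rule le)
  also have "\<dots> = 2 * real U" unfolding sum.distrib s1 s2 by simp
  finally show ?thesis .
qed

text \<open>A second moment: the number of coincidences among the residues n/a. For distinct a, b
  the bounds N/a + 1 and N/b + 1 combine to N/max(a, b) + 1; over all a, b this sums to at most 2 N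
  U + U^2, and the diagonal adds N U.\<close>

lemma burgess_multiplicity:
  assumes q: "q > 0" "2 * U * N \<le> q" "U \<le> N" 
    and \<A>: "\<And>a. a \<in> \<A> \<Longrightarrow> prime a \<and> a \<le> U \<and> \<not> a dvd q"
    and f: "\<And>n a. n \<in> {A<..A + int N} \<Longrightarrow> a \<in> \<A> \<Longrightarrow> [int a * f (n, a) = n] (mod int q)"
  defines "T \<equiv> {A<..A + int N} \<times> \<A>"
  shows "(\<Sum>t\<in>T. real (card {t'\<in>T. f t' = f t})) \<le> 4 * real N * real U"
proof -
  let ?I = "{A<..A + int N}"
  have sub: "\<A> \<subseteq> {1..U}" using \<A> prime_gt_0_nat by (force simp: Suc_le_eq)
  hence fin\<A>: "finite \<A>" by (rule finite_subset) simp
  have cop: "coprime a q" if "a \<in> \<A>" for a using \<A>[OF that] by (simp add: prime_imp_coprime)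
  define E where "E = (\<lambda>a b. {(n, m). n \<in> ?I \<and> m \<in> ?I \<and> int q dvd n * int b - m * int a})"
  have finE: "finite (E a b)" for a b by (rule finite_subset[of _ "?I \<times> ?I"]) (auto simp: E_def)
  have E_sym: "card (E a b) = card (E b a)" for a b
    by (rule bij_betw_same_card[of "\<lambda>(n, m). (m, n)"], rule bij_betw_byWitness[where f' = "\<lambda>(n, m). (m, n)"])
       (auto simp: E_def dvd_diff_commute)
  have E_le: "real (card (E a b)) \<le> real N / real (max a b) + 1 + (if a = b then real N else 0)" if ab: "a \<in> \<A>" "b \<in> \<A>" for a b
  proof (cases "a = b")
    case True
    have "E a a \<subseteq> (\<lambda>n. (n, n)) ` ?I"
    proof (rule subsetI)
      fix x assume "x \<in> E a a"
      then obtain n m where x: "x = (n, m)" and nm: "A < n" "n \<le> A + int N" "A < m" "m \<le> A + int N" 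
        "int q dvd n * int a - m * int a"
        unfolding E_def by auto
      hence "int q dvd (n - m) * int a" by (simp add: algebra_simps)
      hence "int q dvd n - m" using cop[OF ab(1)] by (simp add: coprime_dvd_mult_left_iff coprime_commute)
      moreover have "U > 0" using sub ab by auto
      hence "1 * N \<le> 2 * U * N" by (intro mult_right_mono) auto
      hence "\<bar>n - m\<bar> < int q" using nm q(2) by linarith
      ultimately have "n = m" using zdvd_not_zless[of "\<bar>n - m\<bar>" "int q"] by fastforce
      thus "x \<in> (\<lambda>n. (n, n)) ` ?I" using x nm by auto
    qed
    hence "card (E a a) \<le> card ((\<lambda>n. (n, n)) ` ?I)" by (intro card_mono) auto
    also have "\<dots> \<le> card ?I" by (rule card_image_le) simp
    finally have c: "real (card (E a a)) \<le> real N" by simp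
    have "real N / real (max a b) \<ge> 0" by simp
    thus ?thesis using c unfolding True[symmetric] if_P[OF refl] by linarith
  next
    case False
    have "real (card (E a b)) \<le> N / a + 1"
      unfolding E_def using \<A>[OF ab(1)] \<A>[OF ab(2)] cop[OF ab(1)] q False by (intro ratio_pairs_le[of U]) auto
    moreover have "real (card (E b a)) \<le> N / b + 1"
      unfolding E_def using \<A>[OF ab(1)] \<A>[OF ab(2)] cop[OF ab(2)] q False by (intro ratio_pairs_le[of U]) auto
    ultimately show ?thesis using False E_sym[of a b] by (simp add: max_def)
  qed
  have imp: "int q dvd n * int b - m * int a" if "n \<in> ?I" "m \<in> ?I" "a \<in> \<A>" "b \<in> \<A>" "f (n, a) = f (m, b)" for n m a b
  proof -
    have "[int a * f (n, a) * int b = n * int b] (mod int q)" by (intro cong_mult f that cong_refl)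
    moreover have "[int b * f (m, b) * int a = m * int a] (mod int q)" by (intro cong_mult f that cong_refl)
    moreover have "int a * f (n, a) * int b = int b * f (m, b) * int a" using that by simp
    ultimately have "[n * int b = m * int a] (mod int q)" by (metis cong_sym cong_trans)
    thus ?thesis by (simp add: cong_iff_dvd_diff)
  qed
  have c0: "(\<Sum>t\<in>T. real (card {t'\<in>T. f t' = f t})) = real (card (SIGMA t:T. {t'\<in>T. f t' = f t}))"
    using fin\<A> by (simp add: T_def)
  have c1: "card (SIGMA t:T. {t'\<in>T. f t' = f t}) \<le> card (SIGMA ab:\<A> \<times> \<A>. E (fst ab) (snd ab))"
  proof (rule card_inj_on_le)
    show "inj_on (\<lambda>((n, a), (m, b)). ((a, b), (n, m))) (SIGMA t:T. {t'\<in>T. f t' = f t})"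
      by (auto simp: inj_on_def)
    show "(\<lambda>((n, a), (m, b)). ((a, b), (n, m))) ` (SIGMA t:T. {t'\<in>T. f t' = f t}) \<subseteq> (SIGMA ab:\<A> \<times> \<A>. E (fst ab) (snd ab))"
    proof (rule image_subsetI)
      fix x assume x: "x \<in> (SIGMA t:T. {t'\<in>T. f t' = f t})"
      obtain n a m b where x': "x = ((n, a), (m, b))" by (metis surj_pair)
      show "(\<lambda>((n, a), (m, b)). ((a, b), (n, m))) x \<in> (SIGMA ab:\<A> \<times> \<A>. E (fst ab) (snd ab))"
        using x imp[of n m a b] unfolding x' T_def E_def by auto
    qed
    show "finite (SIGMA ab:\<A> \<times> \<A>. E (fst ab) (snd ab))" using fin\<A> finE by auto
  qed
  have c2: "card (SIGMA ab:\<A> \<times> \<A>. E (fst ab) (snd ab)) = (\<Sum>ab\<in>\<A> \<times> \<A>. card (E (fst ab) (snd ab)))"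
    using fin\<A> finE by (subst card_SigmaI) auto
  have c3: "(\<Sum>ab\<in>\<A> \<times> \<A>. card (E (fst ab) (snd ab))) = (\<Sum>a\<in>\<A>. \<Sum>b\<in>\<A>. card (E a b))" by (simp add: sum.cartesian_product case_prod_unfold)
  have "(\<Sum>t\<in>T. real (card {t'\<in>T. f t' = f t})) \<le> real (\<Sum>a\<in>\<A>. \<Sum>b\<in>\<A>. card (E a b))"
    unfolding c0 using c1 unfolding c2 c3 of_nat_le_iff .
  also have "\<dots> \<le> (\<Sum>a\<in>\<A>. \<Sum>b\<in>\<A>. real N / real (max a b) + 1 + (if a = b then real N else 0))"
    unfolding of_nat_sum
  proof (rule sum_mono, rule sum_mono)
    fix a b assume "a \<in> \<A>" "b \<in> \<A>"
    thus "real (card (E a b)) \<le> real N / real (max a b) + 1 + (if a = b then real N else 0)" by (rule E_le)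
  qed
  also have "\<dots> = (\<Sum>a\<in>\<A>. \<Sum>b\<in>\<A>. real N / real (max a b)) + real (card \<A>) * real (card \<A>) + real (card \<A>) * real N"
    using fin\<A> by (simp add: sum.distrib)
  also have "\<dots> \<le> 2 * real N * real U + real N * real U + real N * real U"
  proof (intro add_mono)
    have "(\<Sum>a\<in>\<A>. \<Sum>b\<in>\<A>. real N / real (max a b)) \<le> (\<Sum>a\<in>{1..U}. \<Sum>b\<in>{1..U}. real N / real (max a b))"
    proof -
      have "(\<Sum>a\<in>\<A>. \<Sum>b\<in>\<A>. real N / real (max a b)) \<le> (\<Sum>a\<in>\<A>. \<Sum>b\<in>{1..U}. real N / real (max a b))"
        by (rule sum_mono, rule sum_mono2) (use sub in auto)
      also have "\<dots> \<le> (\<Sum>a\<in>{1..U}. \<Sum>b\<in>{1..U}. real N / real (max a b))"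
        by (rule sum_mono2) (use sub in \<open>auto intro: sum_nonneg\<close>)
      finally show ?thesis .
    qed
    also have "\<dots> = real N * (\<Sum>a\<in>{1..U}. \<Sum>b\<in>{1..U}. 1 / real (max a b))"
      by (simp add: sum_distrib_left)
    also have "\<dots> \<le> real N * (2 * real U)" by (intro mult_left_mono sum_max_le) auto
    finally show "(\<Sum>a\<in>\<A>. \<Sum>b\<in>\<A>. real N / real (max a b)) \<le> 2 * real N * real U" by simp
    have "card \<A> \<le> card {1..U}" using sub by (intro card_mono) auto
    hence c: "real (card \<A>) \<le> real U" by simp
    have "real (card \<A>) * real (card \<A>) \<le> real N * real U" using c q(3) by (intro mult_mono) auto
    thus "real (card \<A>) * real (card \<A>) \<le> real N * real U" .
    show "real (card \<A>) * real N \<le> real N * real U" using c by (simp add: mult.commute mult_left_mono)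
  qed
  finally show ?thesis by simp
qed

text \<open>Burgess's shift by a b: the symbol of n + a b is that of a times that of n/a + b. Short
  sums over b are thus weighted by the multiplicity of n/a, and Hoelder's inequality brings in their
  fourth moment. \<open>E\<close> controls the end pieces, of length at most U V, that the shift
  creates.\<close>

lemma burgess_step:
  assumes q: "squarefree q" "odd q" and NU: "2 * U * N \<le> q" "U \<le> N" 
    and \<A>: "\<And>a. a \<in> \<A> \<Longrightarrow> prime a \<and> a \<le> U \<and> \<not> a dvd q"
    and E: "\<And>A M. M \<le> U * V \<Longrightarrow> \<bar>real_of_int (jac_sum q A M)\<bar> \<le> E"
  obtains R where "R \<ge> 0" 
    "R ^ 4 \<le> 4 * (real N * real U) ^ 3 * (3 * real V ^ 2 * q + 12 * 52 ^ card (prime_factors q) * sqrt q * real V ^ 4)"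
    "real (card \<A>) * real V * \<bar>real_of_int (jac_sum q A N)\<bar> \<le> R + 2 * E * real (card \<A>) * real V"
proof -
  let ?I = "{A<..A + int N}"
  have q0: "q > 0" using q by (auto intro: Nat.gr0I)
  have sub: "\<A> \<subseteq> {1..U}" using \<A> prime_gt_0_nat by (force simp: Suc_le_eq)
  hence fin\<A>: "finite \<A>" by (rule finite_subset) simp
  have "\<exists>y. [int a * y = 1] (mod int q)" if "a \<in> \<A>" for a
  proof -
    have "coprime (int a) (int q)" using \<A>[OF that] by (simp add: prime_imp_coprime)
    thus ?thesis by (rule cong_solve_coprime_int)
  qed
  then obtain vi where vi: "\<And>a. a \<in> \<A> \<Longrightarrow> [int a * vi a = 1] (mod int q)" by metis
  \<comment> \<open>The residue n/a, with \<open>vi a\<close> an inverse of \<open>a\<close> modulo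
    \<open>q\<close>.\<close>
  define f where "f = (\<lambda>(n, a). (n * vi a) mod int q)"
  define T where "T = ?I \<times> \<A>"
  define X where "X = {0..<int q}"
  have finT: "finite T" and finX: "finite X" using fin\<A> by (auto simp: T_def X_def)
  have fT: "f ` T \<subseteq> X" using q0 by (auto simp: f_def X_def)
  have f: "[int a * f (n, a) = n] (mod int q)" if "a \<in> \<A>" for n a
  proof -
    have "[n * (int a * vi a) = n * 1] (mod int q)" by (intro cong_scalar_left vi that)
    thus ?thesis by (simp add: f_def cong_def mod_mult_right_eq mult_ac)
  qed
  define F where "F = (\<lambda>x. \<bar>real_of_int (\<Sum>b\<in>{1..int V}. jac (x + b) q)\<bar>)"
  define \<nu> where "\<nu> = (\<lambda>x. real (card {t\<in>T. f t = x}))"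
  define R where "R = (\<Sum>x\<in>X. \<nu> x * F x)"
  have R0: "R \<ge> 0" unfolding R_def \<nu>_def F_def by (intro sum_nonneg) auto
  have nu1: "(\<Sum>x\<in>X. \<nu> x) = real N * real (card \<A>)"
    using sum_fibre_count[OF finT finX fT, of "\<lambda>_. 1"] fin\<A> by (simp add: \<nu>_def T_def)
  have nu2: "(\<Sum>x\<in>X. (\<nu> x)\<^sup>2) \<le> 4 * real N * real U"
  proof -
    have "(\<Sum>x\<in>X. (\<nu> x)\<^sup>2) = (\<Sum>t\<in>T. real (card {t'\<in>T. f t' = f t}))"
      using sum_fibre_count[OF finT finX fT, of \<nu>] by (simp add: \<nu>_def power2_eq_square)
    also have "\<dots> \<le> 4 * real N * real U"
      unfolding T_def by (rule burgess_multiplicity[OF q0 NU \<A>]) (use f in auto)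
    finally show ?thesis .
  qed
  have cA: "real (card \<A>) \<le> real U"
  proof -
    have "card \<A> \<le> card {1..U}" using sub by (intro card_mono) auto
    thus ?thesis by simp
  qed
  have R4: "R ^ 4 \<le> 4 * (real N * real U) ^ 3 * (3 * real V ^ 2 * q + 12 * 52 ^ card (prime_factors q) * sqrt q * real V ^ 4)"
  proof -
    have "R ^ 4 \<le> (\<Sum>x\<in>X. \<nu> x)\<^sup>2 * (\<Sum>x\<in>X. (\<nu> x)\<^sup>2) * (\<Sum>x\<in>X. F x ^ 4)"
      unfolding R_def by (rule holder_four) (simp add: \<nu>_def)
    also have "\<dots> \<le> (real N * real U)\<^sup>2 * (4 * real N * real U) * (3 * real V ^ 2 * q + 12 * 52 ^ card (prime_factors q) * sqrt q * real V ^ 4)"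
    proof (intro mult_mono nu2)
      show "(\<Sum>x\<in>X. \<nu> x)\<^sup>2 \<le> (real N * real U)\<^sup>2"
        unfolding nu1 using cA by (intro power_mono mult_left_mono) auto
      show "(\<Sum>x\<in>X. F x ^ 4) \<le> 3 * real V ^ 2 * q + 12 * 52 ^ card (prime_factors q) * sqrt q * real V ^ 4"
        using jac_fourth_moment[OF q, of V] by (simp add: F_def X_def)
    qed (auto intro: sum_nonneg)
    finally show ?thesis by (simp add: power2_eq_square power3_eq_cube mult_ac)
  qed
  have main: "(\<Sum>a\<in>\<A>. \<Sum>b\<in>{1..int V}. real_of_int (jac_sum q (A + int a * b) N)) \<le> R"
    and main': "- (\<Sum>a\<in>\<A>. \<Sum>b\<in>{1..int V}. real_of_int (jac_sum q (A + int a * b) N)) \<le> R"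
  proof -
    have eq: "(\<Sum>b\<in>{1..int V}. jac_sum q (A + int a * b) N) = jac (int a) q * (\<Sum>n\<in>?I. \<Sum>b\<in>{1..int V}. jac (f (n, a) + b) q)"
      if a: "a \<in> \<A>" for a
    proof -
      have "jac_sum q (A + int a * b) N = (\<Sum>n\<in>?I. jac (n + int a * b) q)" for b
        unfolding jac_sum_def
        by (rule sum.reindex_bij_witness[of _ "\<lambda>n. n + int a * b" "\<lambda>n. n - int a * b"]) auto
      hence "(\<Sum>b\<in>{1..int V}. jac_sum q (A + int a * b) N) = (\<Sum>n\<in>?I. \<Sum>b\<in>{1..int V}. jac (n + int a * b) q)"
        by (simp only:) (rule sum.swap)
      also have "\<dots> = (\<Sum>n\<in>?I. \<Sum>b\<in>{1..int V}. jac (int a) q * jac (f (n, a) + b) q)"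
      proof (intro sum.cong refl)
        fix n b
        have "[int a * f (n, a) + int a * b = n + int a * b] (mod int q)"
          by (intro cong_add f a cong_refl)
        hence "jac (n + int a * b) q = jac (int a * (f (n, a) + b)) q"
          using q0 by (intro jac_cong) (auto simp: distrib_left cong_sym_eq)
        thus "jac (n + int a * b) q = jac (int a) q * jac (f (n, a) + b) q"
          by (simp add: jac_mult_top[OF q(2)])
      qed
      finally show ?thesis by (simp add: sum_distrib_left)
    qed
    have "\<bar>\<Sum>a\<in>\<A>. \<Sum>b\<in>{1..int V}. real_of_int (jac_sum q (A + int a * b) N)\<bar> \<le> (\<Sum>a\<in>\<A>. \<Sum>n\<in>?I. F (f (n, a)))"
    proof (rule order.trans[OF sum_abs], rule sum_mono)
      fix a assume a: "a \<in> \<A>"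
      have "\<bar>\<Sum>b\<in>{1..int V}. real_of_int (jac_sum q (A + int a * b) N)\<bar> = \<bar>real_of_int (\<Sum>b\<in>{1..int V}. jac_sum q (A + int a * b) N)\<bar>"
        by simp
      also have "\<dots> = \<bar>real_of_int (jac (int a) q)\<bar> * \<bar>real_of_int (\<Sum>n\<in>?I. \<Sum>b\<in>{1..int V}. jac (f (n, a) + b) q)\<bar>"
        unfolding eq[OF a] by (simp only: of_int_mult abs_mult)
      also have "\<dots> \<le> 1 * \<bar>\<Sum>n\<in>?I. real_of_int (\<Sum>b\<in>{1..int V}. jac (f (n, a) + b) q)\<bar>"
        using abs_jac_le[OF q0, of "int a"] by (intro mult_mono) auto
      also have "\<dots> \<le> (\<Sum>n\<in>?I. F (f (n, a)))" unfolding F_def mult_1 by (rule sum_abs)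
      finally show "\<bar>\<Sum>b\<in>{1..int V}. real_of_int (jac_sum q (A + int a * b) N)\<bar> \<le> (\<Sum>n\<in>?I. F (f (n, a)))" .
    qed
    also have "\<dots> = (\<Sum>n\<in>?I. \<Sum>a\<in>\<A>. F (f (n, a)))" by (rule sum.swap)
    also have "\<dots> = (\<Sum>t\<in>T. F (f t))" by (simp add: T_def sum.cartesian_product)
    also have "\<dots> = R" unfolding R_def \<nu>_def by (rule sum_fibre_count[OF finT finX fT])
    finally have "\<bar>\<Sum>a\<in>\<A>. \<Sum>b\<in>{1..int V}. real_of_int (jac_sum q (A + int a * b) N)\<bar> \<le> R" .
    thus "(\<Sum>a\<in>\<A>. \<Sum>b\<in>{1..int V}. real_of_int (jac_sum q (A + int a * b) N)) \<le> R"
      "- (\<Sum>a\<in>\<A>. \<Sum>b\<in>{1..int V}. real_of_int (jac_sum q (A + int a * b) N)) \<le> R" by linarith+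
  qed
  have sh: "\<bar>real_of_int (jac_sum q A N) - real_of_int (jac_sum q (A + int a * b) N)\<bar> \<le> 2 * E" 
    if "a \<in> \<A>" "b \<in> {1..int V}" for a b
  proof -
    define k where "k = a * nat b"
    have k: "int k = int a * b" using that by (simp add: k_def)
    have "nat b \<le> V" using that by (simp add: nat_le_iff)
    hence "k \<le> U * V" unfolding k_def using \<A>[OF that(1)] by (intro mult_le_mono) auto
    hence "\<bar>real_of_int (jac_sum q A k)\<bar> \<le> E" "\<bar>real_of_int (jac_sum q (A + int N) k)\<bar> \<le> E" by (simp_all add: E)
    thus ?thesis using jac_sum_shift[of q A N k] unfolding k by simp
  qed
  have "\<bar>real (card \<A>) * real V * real_of_int (jac_sum q A N) - (\<Sum>a\<in>\<A>. \<Sum>b\<in>{1..int V}. real_of_int (jac_sum q (A + int a * b) N))\<bar>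
     = \<bar>\<Sum>a\<in>\<A>. \<Sum>b\<in>{1..int V}. real_of_int (jac_sum q A N) - real_of_int (jac_sum q (A + int a * b) N)\<bar>"
    by (simp add: sum_subtractf)
  also have "\<dots> \<le> (\<Sum>a\<in>\<A>. \<Sum>b\<in>{1..int V}. 2 * E)"
    by (rule order.trans[OF sum_abs], rule sum_mono, rule order.trans[OF sum_abs], rule sum_mono, rule sh)
  also have "\<dots> = 2 * E * real (card \<A>) * real V" by simp
  finally have "\<bar>real (card \<A>) * real V * real_of_int (jac_sum q A N)\<bar> \<le> R + 2 * E * real (card \<A>) * real V"
    using main main' by linarith
  hence "real (card \<A>) * real V * \<bar>real_of_int (jac_sum q A N)\<bar> \<le> R + 2 * E * real (card \<A>) * real V"
    by (simp add: abs_mult)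
  thus ?thesis using that R0 R4 by blast
qed

lemma card_primes_not_dividing_ge:
  assumes "q > 0"
  shows "real (card {a. prime a \<and> a \<le> U \<and> \<not> a dvd q}) \<ge> real (prime_pi (real U)) - log 2 (real q)"
proof -
  have fin: "finite {a::nat. prime a \<and> a \<le> U \<and> \<not> a dvd q}" by (rule finite_subset[of _ "{..U}"]) auto
  have "{a. prime a \<and> a \<le> U} \<subseteq> {a. prime a \<and> a \<le> U \<and> \<not> a dvd q} \<union> prime_factors q"
    using assms by (auto simp: in_prime_factors_iff)
  hence "card {a. prime a \<and> a \<le> U} \<le> card ({a. prime a \<and> a \<le> U \<and> \<not> a dvd q} \<union> prime_factors q)"
    using fin by (intro card_mono) auto
  also have "\<dots> \<le> card {a. prime a \<and> a \<le> U \<and> \<not> a dvd q} + card (prime_factors q)" by (rule card_Un_le)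
  finally show ?thesis using card_prime_factors_le_log[OF assms] by (simp add: prime_pi_def)
qed

text \<open>Strong induction on the length: with U V <= N/16 the end pieces of the shift fall under
  the induction hypothesis and use up half of the constant, while the moment term has to fit into
  the other half. The limit N <= q^(5/8) ensures 2 U N <= q, as the count of coincidences
  requires.\<close>

lemma burgess:
  fixes \<epsilon> :: real
  assumes \<epsilon>: "\<epsilon> > 0"
  obtains C where "C > 0" "\<And>q A N. squarefree q \<Longrightarrow> odd q \<Longrightarrow> real N \<le> real q powr (5/8) \<Longrightarrow>
     \<bar>real_of_int (jac_sum q A N)\<bar> \<le> C * sqrt N * real q powr (3/16 + \<epsilon>)"
proof -
  define \<delta> where "\<delta> = \<epsilon> / 2"
  have \<delta>: "\<delta> > 0" using \<epsilon> by (simp add: \<delta>_def)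
  obtain K where K: "K \<ge> 1" "\<And>q :: nat. q > 0 \<Longrightarrow> 52 ^ card (prime_factors q) \<le> K * real q powr \<delta>"
    using power_card_prime_factors_le[of 52 \<delta>] \<delta> by auto
  \<comment> \<open>12 = 3 * 2^2 and 192 = 12 * 2^4 arise from V <= 2 q^(1/4) in the fourth moment;
    128 = 4 * 32 in \<open>K2\<close> from the Hoelder bound and from N <= 32 U V.\<close>
  define K1 where "K1 = 12 + 192 * K"
  define K2 where "K2 = (128 * K1) powr (1/4)"
  have K1: "K1 > 0" and K2: "K2 > 0" "K2 ^ 4 = 128 * K1" using K(1)
    by (auto simp: K1_def K2_def powr_powr simp flip: powr_numeral)
  obtain x0 where x0: "\<And>x. x \<ge> x0 \<Longrightarrow> real (prime_pi x) \<ge> x / (4 * ln x)"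
    using prime_pi_lower_bound unfolding eventually_at_top_linorder by blast
  have "\<forall>\<^sub>F x::real in at_top. x powr (1/8) / 64 \<ge> max x0 1 \<and> 1 / (4 * ln x) - x powr (-\<delta>) > 0 \<and>
      x powr (1/8) / 64 * (1 / (4 * ln x) - x powr (-\<delta>)) \<ge> log 2 x \<and> x > 1"
  proof (intro eventually_conj eventually_gt_at_top)
    have "filterlim (\<lambda>x::real. x powr (1/8) / 64) at_top at_top" by real_asymp
    thus "\<forall>\<^sub>F x::real in at_top. x powr (1/8) / 64 \<ge> max x0 1"
      unfolding filterlim_at_top by blast
    show "\<forall>\<^sub>F x::real in at_top. 1 / (4 * ln x) - x powr (-\<delta>) > 0" using \<delta> by real_asymp
    show "\<forall>\<^sub>F x::real in at_top. x powr (1/8) / 64 * (1 / (4 * ln x) - x powr (-\<delta>)) \<ge> log 2 x"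
      using \<delta> unfolding log_def by real_asymp
  qed
  then obtain q0 where q0: "\<And>x. x \<ge> q0 \<Longrightarrow> x powr (1/8) / 64 \<ge> max x0 1 \<and> 1 / (4 * ln x) - x powr (-\<delta>) > 0 \<and>
      x powr (1/8) / 64 * (1 / (4 * ln x) - x powr (-\<delta>)) \<ge> log 2 x \<and> x > 1"
    unfolding eventually_at_top_linorder by blast
  \<comment> \<open>The square root covers the moduli q < q0, where N <= q is bounded; 2 * K2 makes
    the moment term at most half of the final bound.\<close>
  define C where "C = max (max 1 (sqrt (max q0 0))) (2 * K2)"
  have C: "C \<ge> 1" "C \<ge> sqrt (max q0 0)" "C \<ge> 2 * K2" by (auto simp: C_def)
  have bound: "\<bar>real_of_int (jac_sum q A N)\<bar> \<le> C * sqrt N * real q powr (3/16 + \<epsilon>)"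
    if q: "squarefree q" "odd q" and N: "real N \<le> real q powr (5/8)" for q A N
    using N
  proof (induction N arbitrary: A rule: less_induct)
    case (less N)
    define X where "X = real q"
    have qpos: "q > 0" using q by (auto intro: Nat.gr0I)
    hence X1: "X \<ge> 1" by (simp add: X_def)
    have triv: "\<bar>real_of_int (jac_sum q A N)\<bar> \<le> sqrt N * sqrt N"
      using abs_jac_sum_le[OF qpos, of A N] by simp
    have X316: "X powr (3/16) \<le> X powr (3/16 + \<epsilon>)" using X1 \<epsilon> by (intro powr_mono) auto
    have X316': "1 \<le> X powr (3/16 + \<epsilon>)" using X1 \<epsilon> by (simp add: ge_one_powr_ge_zero)
    consider "X < q0" | "real N < X powr (3/8)" | "X \<ge> q0" "real N \<ge> X powr (3/8)" by linarith
    thus ?case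
    proof cases
      case 1
      have "real N \<le> X powr (5/8)" using less.prems by (simp only: X_def)
      also have "\<dots> \<le> X powr 1" using X1 by (intro powr_mono) simp_all
      also have "X powr 1 = X" using X1 by simp
      finally have "real N \<le> max q0 0" using 1 by linarith
      hence "sqrt N \<le> sqrt (max q0 0)" by (rule real_sqrt_le_mono)
      hence "sqrt N \<le> C" using C by linarith
      hence "sqrt N * sqrt N \<le> C * sqrt N" by (rule mult_right_mono) simp
      also have "C * sqrt N = (C * sqrt N) * 1" by simp
      also have "\<dots> \<le> (C * sqrt N) * X powr (3/16 + \<epsilon>)" using X316' C by (intro mult_left_mono) auto
      finally show ?thesis using triv by (simp add: X_def)
    next
      \<comment> \<open>Below q^(3/8) the trivial bound \<open>N\<close> is already at most sqrt N *
        q^(3/16).\<close>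
      case 2
      have "sqrt N \<le> sqrt (X powr (3/8))" using 2 by simp
      also have "\<dots> = X powr (3/16)" by (simp add: powr_half_sqrt[symmetric] powr_powr)
      finally have "sqrt N * sqrt N \<le> sqrt N * X powr (3/16)" by (rule mult_left_mono) simp
      also have "\<dots> \<le> (C * sqrt N) * X powr (3/16 + \<epsilon>)"
      proof (rule mult_mono[OF _ X316])
        have "1 * sqrt N \<le> C * sqrt N" using C(1) by (rule mult_right_mono) simp
        thus "sqrt N \<le> C * sqrt N" by simp
      qed (use C in simp_all)
      finally show ?thesis using triv by (simp add: X_def)
    next
      case 3
      note big = q0[OF 3(1)]
      hence bg: "X powr (1/8) / 64 \<ge> x0" "X powr (1/8) / 64 \<ge> 1" "1 / (4 * ln X) - X powr (-\<delta>) > 0" "X > 1"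
        unfolding max.bounded_iff by blast+
      \<comment> \<open>This size balances the two terms of the fourth moment: q V^2 and sqrt q V^4
        are both about q^(3/2).\<close>
      define V where "V = nat \<lceil>X powr (1/4)\<rceil>"
      have X14: "X powr (1/4) \<ge> 1" using X1 by (simp add: ge_one_powr_ge_zero)
      have V: "real V \<ge> X powr (1/4)" "real V \<le> 2 * X powr (1/4)" using X14 unfolding V_def by linarith+
      have V0: "real V > 0" using V(1) X14 by linarith
      have N0: "real N > 0" using 3(2) X1 by (smt (verit) powr_gt_zero)
      \<comment> \<open>The 16 makes sums of length U V four times smaller than the claimed bound,
        so that the term 2 E is half of it.\<close>
      define y where "y = real N / (16 * real V)"
      define U where "U = nat \<lfloor>y\<rfloor>"
      have y18: "y \<ge> X powr (1/8) / 32"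
      proof -
        have "X powr (1/8) / 32 = X powr (3/8) / (16 * (2 * X powr (1/4)))"
          using X1 by (simp add: field_simps flip: powr_add)
        also have "\<dots> \<le> real N / (16 * real V)" using 3(2) V V0 by (intro frac_le) auto
        finally show ?thesis by (simp add: y_def)
      qed
      have y1: "y \<ge> 1" using y18 bg by linarith
      have fl: "\<lfloor>y\<rfloor> \<ge> 1" using y1 by simp
      hence "real U = real_of_int \<lfloor>y\<rfloor>" by (simp add: U_def)
      moreover have "real_of_int \<lfloor>y\<rfloor> \<ge> 1" using fl by simp
      ultimately have U_ge: "real U \<ge> 1" "real U > y - 1" "real U \<le> y" by linarith+
      hence U: "real U \<le> y" "real U \<ge> y / 2" by linarith+
      have U0: "real U > 0" using U y1 by linarith
      have UV: "real U * real V \<le> real N / 16"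
      proof -
        have "real U * real V \<le> y * real V" using U V0 by (intro mult_right_mono) auto
        thus ?thesis using V0 by (simp add: y_def)
      qed
      have UV': "32 * (real U * real V) \<ge> real N"
      proof -
        have "y / 2 * real V \<le> real U * real V" using U V0 by (intro mult_right_mono) auto
        thus ?thesis using V0 by (simp add: y_def)
      qed
      have V1: "real V \<ge> 1" using V(1) X14 by linarith
      have UN: "U \<le> N"
      proof -
        have "real U * 1 \<le> real U * real V" using V1 by (intro mult_left_mono) auto
        hence "real U \<le> real N" using UV N0 by linarith
        thus ?thesis by simp
      qed
      have "2 * U * N \<le> q"
      proof -
        have "real U * real N * X powr (1/4) \<le> real U * real N * real V" using V by (intro mult_left_mono) auto
        also have "\<dots> = (real U * real V) * real N" by simp
        also have "\<dots> \<le> real N / 16 * real N" using UV by (intro mult_right_mono) auto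
        also have "\<dots> \<le> X powr (5/8) / 16 * X powr (5/8)"
          using less.prems by (intro mult_mono divide_right_mono) (auto simp: X_def)
        also have "\<dots> = X powr (5/8 + 5/8) / 16" unfolding powr_add by simp
        also have "\<dots> = (X / 16) * X powr (1/4)" using X1 powr_add[of X 1 "1/4"] by simp
        finally have "real U * real N \<le> X / 16" using X14 by (subst (asm) mult_le_cancel_right) auto
        hence "real (2 * U * N) \<le> real q" using X1 by (simp add: X_def)
        thus ?thesis by (simp only: of_nat_le_iff)
      qed
      define \<A> where "\<A> = {a. prime a \<and> a \<le> U \<and> \<not> a dvd q}"
      have cA: "real (card \<A>) \<ge> real U * X powr (-\<delta>)"
      proof -
        have U18: "real U \<ge> X powr (1/8) / 64" using U(2) y18 by linarith
        have "real U \<le> X powr (5/8)" using UN less.prems by (simp add: X_def)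
        also have "\<dots> \<le> X powr 1" using X1 by (intro powr_mono) auto
        finally have UX: "real U \<le> X" using X1 by simp
        have U1: "real U \<ge> 1" using U18 bg by linarith
        have "real (prime_pi (real U)) \<ge> real U / (4 * ln X)"
        proof (cases "real U = 1")
          \<comment> \<open>At U = 1 the quotient U / (4 ln U) collapses to 0, since ln 1 = 0 and
            HOL sets division by 0 to 0. The case is ruled out because y >= 2.\<close>
          case True
          hence "real U / (4 * ln (real U)) = 0" by simp
          have "x0 \<le> real U" using U18 bg by linarith
          show ?thesis
          proof -
            have "X powr (1/8) \<ge> 64" using bg(2) by simp
            hence "y \<ge> 2" using y18 by linarith
            hence "U \<ge> 2" unfolding U_def by linarith
            thus ?thesis using True by simp
          qed
        next
          case False
          hence "real U > 1" using U1 by simp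
          hence "real U / (4 * ln X) \<le> real U / (4 * ln (real U))"
            using UX by (intro divide_left_mono mult_pos_pos) auto
          also have "\<dots> \<le> real (prime_pi (real U))" using U18 bg by (intro x0) linarith
          finally show ?thesis .
        qed
        moreover have "real (card \<A>) \<ge> real (prime_pi (real U)) - log 2 X"
          unfolding \<A>_def X_def by (rule card_primes_not_dividing_ge[OF qpos])
        moreover have "log 2 X \<le> real U * (1 / (4 * ln X) - X powr (-\<delta>))"
        proof -
          have "log 2 X \<le> X powr (1/8) / 64 * (1 / (4 * ln X) - X powr (-\<delta>))" using big by blast
          also have "\<dots> \<le> real U * (1 / (4 * ln X) - X powr (-\<delta>))"
            using U18 bg by (intro mult_right_mono) simp_all
          finally show ?thesis .
        qed
        ultimately show ?thesis by (simp add: right_diff_distrib)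
      qed
      have c0: "real (card \<A>) > 0"
        using cA U0 X1 by (smt (verit) mult_pos_pos powr_gt_zero)
      define E where "E = C * (sqrt N / 4) * X powr (3/16 + \<epsilon>)"
      have E: "\<bar>real_of_int (jac_sum q B M)\<bar> \<le> E" if M: "M \<le> U * V" for B M
      proof -
        have MN: "real M \<le> real N / 16" using M UV by (metis of_nat_le_iff of_nat_mult order_trans)
        hence "M < N" using N0 by linarith
        moreover have "real M \<le> real q powr (5/8)" using MN N0 less.prems by linarith
        ultimately have "\<bar>real_of_int (jac_sum q B M)\<bar> \<le> C * sqrt M * X powr (3/16 + \<epsilon>)"
          unfolding X_def by (rule less.IH)
        also have "\<dots> \<le> E" unfolding E_def
        proof (intro mult_right_mono mult_left_mono)
          have "sqrt M \<le> sqrt (real N / 16)" using MN by simp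
          thus "sqrt M \<le> sqrt N / 4" by (simp add: real_sqrt_divide)
        qed (use C in auto)
        finally show ?thesis .
      qed
      obtain R where R: "R \<ge> 0" 
        "R ^ 4 \<le> 4 * (real N * real U) ^ 3 * (3 * real V ^ 2 * q + 12 * 52 ^ card (prime_factors q) * sqrt q * real V ^ 4)"
        "real (card \<A>) * real V * \<bar>real_of_int (jac_sum q A N)\<bar> \<le> R + 2 * E * real (card \<A>) * real V"
        using burgess_step[OF q \<open>2 * U * N \<le> q\<close> UN, of \<A> V E A] E unfolding \<A>_def by blast
      have F4: "3 * real V ^ 2 * q + 12 * 52 ^ card (prime_factors q) * sqrt q * real V ^ 4 \<le> K1 * X powr (3/2 + \<delta>)"
      proof -
        have V2: "real V ^ 2 \<le> 4 * X powr (1/2)"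
        proof -
          have "real V ^ 2 \<le> (2 * X powr (1/4)) ^ 2" using V by (intro power_mono) auto
          thus ?thesis using X1 by (simp add: power_mult_distrib powr_power)
        qed
        have V4: "real V ^ 4 \<le> 16 * X"
        proof -
          have "real V ^ 4 \<le> (2 * X powr (1/4)) ^ 4" using V by (intro power_mono) auto
          thus ?thesis using X1 by (simp add: power_mult_distrib powr_power)
        qed
        have "3 * real V ^ 2 * X \<le> 3 * (4 * X powr (1/2)) * X"
          using V2 X1 by (intro mult_right_mono mult_left_mono) auto
        also have "\<dots> = 12 * X powr (3/2)" using X1 powr_add[of X 1 "1/2"] by simp
        also have "\<dots> \<le> 12 * X powr (3/2 + \<delta>)" using X1 \<delta> by (intro mult_left_mono powr_mono) auto
        finally have 1: "3 * real V ^ 2 * X \<le> 12 * X powr (3/2 + \<delta>)" .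
        have "12 * 52 ^ card (prime_factors q) * sqrt X * real V ^ 4 \<le> 12 * (K * X powr \<delta>) * sqrt X * (16 * X)"
          using K(2)[OF qpos] V4 K(1) X1 by (intro mult_mono) (auto simp: X_def)
        also have "\<dots> = 192 * K * (X powr \<delta> * X powr (1/2) * X powr 1)" using X1 by (simp add: powr_half_sqrt)
        also have "X powr \<delta> * X powr (1/2) * X powr 1 = X powr (\<delta> + 1/2 + 1)" by (simp only: powr_add)
        also have "\<delta> + 1/2 + 1 = 3/2 + \<delta>" by simp
        finally have 2: "12 * 52 ^ card (prime_factors q) * sqrt X * real V ^ 4 \<le> 192 * K * X powr (3/2 + \<delta>)" .
        show ?thesis using 1 2 unfolding K1_def X_def distrib_right by linarith
      qed
      define G where "G = K2 * sqrt N * X powr (3/16 + \<epsilon>)"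
      have G0: "G \<ge> 0" using K2 by (simp add: G_def)
      have RG: "R \<le> G * real (card \<A>) * real V"
      proof (rule power_le_imp_le_base[where n = 3])
        have G4: "G ^ 4 = 128 * K1 * (real N)\<^sup>2 * X powr (3/4 + 8 * \<delta>)"
        proof -
          have "x ^ 4 = (x ^ 2) ^ 2" for x :: real by (simp flip: power_mult)
          from this[of "sqrt (real N)"] have "sqrt (real N) ^ 4 = (real N)\<^sup>2" by simp
          moreover have "(X powr (3/16 + \<epsilon>)) ^ 4 = X powr (3/4 + 8 * \<delta>)"
            using X1 by (simp add: powr_power \<delta>_def algebra_simps)
          ultimately show ?thesis by (simp add: G_def power_mult_distrib K2(2))
        qed
        have "R ^ 4 \<le> 4 * (real N * real U) ^ 3 * (K1 * X powr (3/2 + \<delta>))"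
          using R(2) F4 by (elim order.trans) (intro mult_left_mono; simp)
        also have "\<dots> = 4 * K1 * (real N)\<^sup>2 * real U ^ 3 * X powr (3/2 + \<delta>) * real N"
          by (simp add: power_mult_distrib power2_eq_square power3_eq_cube mult_ac)
        \<comment> \<open>One factor N is traded for 32 U V; this supplies the fourth power of
          \<open>U\<close> that is compared with the fourth power of
          \<open>card \<A>\<close>.\<close>
        also have "\<dots> \<le> 4 * K1 * (real N)\<^sup>2 * real U ^ 3 * X powr (3/2 + \<delta>) * (32 * (real U * real V))"
          using UV' K1 by (intro mult_left_mono) auto
        also have "\<dots> = 128 * K1 * (real N)\<^sup>2 * real U ^ 4 * real V * X powr (3/2 + \<delta>)"
          by (simp add: eval_nat_numeral mult_ac)
        also have "X powr (3/2 + \<delta>) \<le> X powr (3/2 + 4 * \<delta>)" using X1 \<delta> by (intro powr_mono) auto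
        also have "X powr (3/2 + 4 * \<delta>) = X powr (3/4 + 4 * \<delta>) * (X powr (1/4)) ^ 3"
          using X1 by (simp add: powr_power flip: powr_add)
        also have "(X powr (1/4)) ^ 3 \<le> real V ^ 3" using V by (intro power_mono) auto
        finally have "R ^ 4 \<le> 128 * K1 * (real N)\<^sup>2 * real U ^ 4 * real V * (X powr (3/4 + 4 * \<delta>) * real V ^ 3)"
          using K1 by (simp add: mult_left_mono)
        also have "\<dots> = (128 * K1 * (real N)\<^sup>2 * X powr (3/4 + 8 * \<delta>)) * (real U * X powr (-\<delta>)) ^ 4 * real V ^ 4"
        proof -
          have "X powr (3/4 + 4 * \<delta>) = X powr (3/4 + 8 * \<delta>) * (X powr (-\<delta>)) ^ 4"
            using X1 by (simp add: powr_power add.commute flip: powr_add)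
          thus ?thesis by (simp add: power_mult_distrib eval_nat_numeral mult_ac)
        qed
        also have "\<dots> \<le> (128 * K1 * (real N)\<^sup>2 * X powr (3/4 + 8 * \<delta>)) * (real (card \<A>)) ^ 4 * real V ^ 4"
          using K1 by (intro mult_right_mono mult_left_mono power_mono cA) auto
        also have "\<dots> = (G * real (card \<A>) * real V) ^ 4" by (simp add: power_mult_distrib G4)
        finally show "R ^ Suc 3 \<le> (G * real (card \<A>) * real V) ^ Suc 3" by simp
        show "0 \<le> G * real (card \<A>) * real V" using G0 by simp
      qed
      have "real (card \<A>) * real V * \<bar>real_of_int (jac_sum q A N)\<bar> \<le> (real (card \<A>) * real V) * (G + 2 * E)"
        using R(3) RG by (simp add: algebra_simps)
      hence "\<bar>real_of_int (jac_sum q A N)\<bar> \<le> G + 2 * E"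
        using c0 V0 by (subst (asm) mult_le_cancel_left_pos) auto
      also have "\<dots> = (K2 + C / 2) * (sqrt N * X powr (3/16 + \<epsilon>))" by (simp add: G_def E_def algebra_simps)
      also have "\<dots> \<le> C * (sqrt N * X powr (3/16 + \<epsilon>))" using C(3) by (intro mult_right_mono) auto
      finally show ?thesis by (simp add: X_def mult.assoc)
    qed
  qed
  show ?thesis
    by (rule that[of C]) (use C(1) bound in auto)
qed

section \<open>Long intervals and moduli that are not squarefree\<close>

lemma jac_sum_full_period:
  assumes "squarefree q" "odd q" "q > 1"
  shows "jac_sum q A q = 0"
proof -
  have "jac_sum q A q = (\<Sum>x\<in>{0..<int q}. jac (x + (A + 1)) q)"
    unfolding jac_sum_def
    by (rule sum.reindex_bij_witness[of _ "\<lambda>x. x + (A + 1)" "\<lambda>n. n - (A + 1)"]) auto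
  also have "\<dots> = (\<Sum>x\<in>{0..<int q}. jac x q)"
    by (rule sum_periodic_shift) (use assms in auto)
  finally show ?thesis using sum_jac_complete[OF assms] by simp
qed

lemma jac_sum_mod:
  assumes "squarefree q" "odd q" "q > 1"
  obtains A' where "jac_sum q A N = jac_sum q A' (N mod q)"
proof -
  have *: "jac_sum q B (q * k) = 0" for k B
    by (induction k arbitrary: B) (simp_all add: jac_sum_add jac_sum_full_period[OF assms], simp add: jac_sum_def)
  have "jac_sum q A N = jac_sum q A (q * (N div q)) + jac_sum q (A + int (q * (N div q))) (N mod q)"
    by (simp only: jac_sum_add[symmetric] mult_div_mod_eq)
  thus ?thesis using that * by simp
qed

lemma jac_sum_blocks:
  assumes B: "\<And>A m. m \<le> L \<Longrightarrow> \<bar>real_of_int (jac_sum q A m)\<bar> \<le> B" and r: "r \<le> L"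
  shows "\<bar>real_of_int (jac_sum q A (k * L + r))\<bar> \<le> (real k + 1) * B"
proof (induction k arbitrary: A)
  case 0
  show ?case using B[OF r, of A] by simp
next
  case (Suc k)
  have "jac_sum q A (Suc k * L + r) = jac_sum q A L + jac_sum q (A + int L) (k * L + r)"
    by (simp only: jac_sum_add[symmetric] mult_Suc add.assoc)
  thus ?case using Suc.IH[of "A + int L"] B[of L A] by (simp add: distrib_right)
qed

text \<open>Whole periods drop out, leaving a length M < q. For M <= q^(5/8) Burgess's bound gives
  Q^(1/2) (Q^2)^(3/16) = Q^(7/8). Longer sums are cut into blocks of length about q^(5/8), which
  yields M q^(-1/8) <= M^(7/8) because q > M; so small moduli do no harm.\<close>

lemma jac_sum_bound_squarefree:
  fixes \<epsilon> :: real
  assumes \<epsilon>: "\<epsilon> > 0"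
  obtains C where "C > 0" "\<And>q A N Q. squarefree q \<Longrightarrow> odd q \<Longrightarrow> q > 1 \<Longrightarrow> Q \<ge> 1 \<Longrightarrow> real q \<le> 4 * Q\<^sup>2 \<Longrightarrow> real N \<le> 2 * Q \<Longrightarrow>
     \<bar>real_of_int (jac_sum q A N)\<bar> \<le> C * Q powr (7/8 + \<epsilon>)"
proof -
  obtain C0 where C0: "C0 > 0" "\<And>q A N. squarefree q \<Longrightarrow> odd q \<Longrightarrow> real N \<le> real q powr (5/8) \<Longrightarrow>
     \<bar>real_of_int (jac_sum q A N)\<bar> \<le> C0 * sqrt N * real q powr (3/16 + \<epsilon>/2)"
    using burgess[of "\<epsilon>/2"] \<epsilon> by auto
  define c1 where "c1 = sqrt 2 * 4 powr (3/16 + \<epsilon>/2)"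
  define c2 where "c2 = 2 * sqrt 2 * 2 powr (7/8) * 4 powr (\<epsilon>/2)"
  define C where "C = C0 * (c1 + c2)"
  have c: "c1 > 0" "c2 > 0" by (auto simp: c1_def c2_def)
  have bound: "\<bar>real_of_int (jac_sum q A N)\<bar> \<le> C * Q powr (7/8 + \<epsilon>)"
    if q: "squarefree q" "odd q" "q > 1" and Q: "Q \<ge> 1" and qQ: "real q \<le> 4 * Q\<^sup>2" and NQ: "real N \<le> 2 * Q" for q A N Q
  proof -
    obtain A' where A': "jac_sum q A N = jac_sum q A' (N mod q)" using jac_sum_mod[OF q] .
    define M where "M = N mod q"
    define X where "X = real q"
    have X1: "X \<ge> 1" using q by (simp add: X_def)
    have "M \<le> N" by (simp add: M_def)
    hence MQ: "real M \<le> 2 * Q" using NQ by linarith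
    have "M < q" unfolding M_def using q by simp
    hence MX: "real M \<le> X" by (simp add: X_def)
    have powX: "X powr a \<le> 4 powr a * Q powr (2 * a)" if "a > 0" for a
    proof -
      have "X powr a \<le> (4 * Q\<^sup>2) powr a" using qQ X1 that by (intro powr_mono2) (auto simp: X_def)
      also have "\<dots> = 4 powr a * (Q powr 2) powr a" using Q by (simp add: powr_mult)
      finally show ?thesis by (simp add: powr_powr)
    qed
    show ?thesis
    proof (cases "real M \<le> X powr (5/8)")
      case True
      have "\<bar>real_of_int (jac_sum q A' M)\<bar> \<le> C0 * sqrt M * X powr (3/16 + \<epsilon>/2)"
        using C0(2)[OF q(1,2)] True unfolding X_def by blast
      also have "\<dots> \<le> C0 * sqrt (2 * Q) * (4 powr (3/16 + \<epsilon>/2) * Q powr (2 * (3/16 + \<epsilon>/2)))"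
        using C0(1) MQ Q \<epsilon> by (intro mult_mono powX) simp_all
      also have "\<dots> = C0 * c1 * (Q powr (1/2) * Q powr (2 * (3/16 + \<epsilon>/2)))"
        using Q by (simp add: c1_def real_sqrt_mult powr_half_sqrt)
      also have "Q powr (1/2) * Q powr (2 * (3/16 + \<epsilon>/2)) = Q powr (1/2 + 2 * (3/16 + \<epsilon>/2))" by (simp only: powr_add)
      also have "1/2 + 2 * (3/16 + \<epsilon>/2) = 7/8 + \<epsilon>" by (simp add: field_simps)
      also have "C0 * c1 * Q powr (7/8 + \<epsilon>) \<le> C * Q powr (7/8 + \<epsilon>)"
        unfolding C_def using C0 c by (intro mult_right_mono mult_left_mono) simp_all
      finally show ?thesis unfolding A' M_def[symmetric] .
    next
      case False
      define y where "y = X powr (5/8)"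
      have y1: "y \<ge> 1" unfolding y_def using X1 by (simp add: ge_one_powr_ge_zero)
      define L where "L = nat \<lfloor>y\<rfloor>"
      have fl: "\<lfloor>y\<rfloor> \<ge> 1" using y1 by simp
      hence "real L = real_of_int \<lfloor>y\<rfloor>" by (simp add: L_def)
      moreover have "real_of_int \<lfloor>y\<rfloor> \<ge> 1" using fl by simp
      ultimately have L: "real L \<ge> 1" "real L \<ge> y / 2" "real L \<le> y" by linarith+
      define B where "B = C0 * sqrt L * X powr (3/16 + \<epsilon>/2)"
      have B0: "B \<ge> 0" using C0 by (simp add: B_def)
      have B: "\<bar>real_of_int (jac_sum q A m)\<bar> \<le> B" if "m \<le> L" for A m
      proof -
        have "real m \<le> real q powr (5/8)" using that L(3) by (simp add: y_def X_def)
        hence "\<bar>real_of_int (jac_sum q A m)\<bar> \<le> C0 * sqrt m * X powr (3/16 + \<epsilon>/2)"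
          using C0(2)[OF q(1,2)] unfolding X_def by blast
        also have "\<dots> \<le> B" unfolding B_def using that C0(1) by (intro mult_right_mono mult_left_mono) simp_all
        finally show ?thesis .
      qed
      have L0: "L > 0" using L(1) by simp
      have "\<bar>real_of_int (jac_sum q A' (M div L * L + M mod L))\<bar> \<le> (real (M div L) + 1) * B"
        using L0 by (intro jac_sum_blocks B) simp_all
      hence "\<bar>real_of_int (jac_sum q A' M)\<bar> \<le> (real (M div L) + 1) * B" by simp
      also have "\<dots> \<le> (2 * M / L) * B"
      proof (rule mult_right_mono[OF _ B0])
        have "real L \<le> real M" using L(3) False by (simp add: y_def)
        hence "1 \<le> real M / real L" using L0 by simp
        moreover have "real (M div L * L) \<le> real M" unfolding of_nat_le_iff by (rule div_times_less_eq_dividend)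
        hence "real (M div L) \<le> real M / real L" using L0 by (simp add: field_simps)
        ultimately show "real (M div L) + 1 \<le> 2 * M / L" by simp
      qed
      also have "\<dots> = 2 * C0 * M * (sqrt L / L) * X powr (3/16 + \<epsilon>/2)" by (simp add: B_def)
      also have "sqrt L / L = 1 / sqrt L" using L0 by (simp add: real_div_sqrt field_simps)
      also have "2 * C0 * M * (1 / sqrt L) * X powr (3/16 + \<epsilon>/2) \<le> 2 * C0 * M * (sqrt 2 * X powr (-5/16)) * X powr (3/16 + \<epsilon>/2)"
      proof (intro mult_right_mono mult_left_mono)
        have "sqrt (y / 2) \<le> sqrt L" using L(2) by simp
        hence "1 / sqrt L \<le> 1 / sqrt (y / 2)" using y1 L0 by (intro divide_left_mono) simp_all
        also have "\<dots> = sqrt 2 / sqrt y" by (simp add: real_sqrt_divide)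
        also have "sqrt y = X powr (5/16)" using X1 by (simp add: y_def powr_half_sqrt[symmetric] powr_powr)
        also have "sqrt 2 / X powr (5/16) = sqrt 2 * X powr (-5/16)" using X1 by (simp add: powr_minus field_simps)
        finally show "1 / sqrt L \<le> sqrt 2 * X powr (-5/16)" .
      qed (use C0 in simp_all)
      also have "\<dots> = 2 * sqrt 2 * C0 * (M * (X powr (-5/16) * X powr (3/16 + \<epsilon>/2)))" by simp
      also have "X powr (-5/16) * X powr (3/16 + \<epsilon>/2) = X powr (-1/8) * X powr (\<epsilon>/2)"
        by (simp flip: powr_add)
      also have "2 * sqrt 2 * C0 * (M * (X powr (-1/8) * X powr (\<epsilon>/2))) = 2 * sqrt 2 * C0 * ((M * X powr (-1/8)) * X powr (\<epsilon>/2))" by simp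
      also have "\<dots> \<le> 2 * sqrt 2 * C0 * ((2 powr (7/8) * Q powr (7/8)) * (4 powr (\<epsilon>/2) * Q powr (2 * (\<epsilon>/2))))"
      proof (rule mult_left_mono, rule mult_mono)
        have M0: "real M > 0" using False X1 by (smt (verit) powr_gt_zero)
        have "real M * X powr (-1/8) \<le> real M * real M powr (-1/8)"
          using MX M0 by (intro mult_left_mono powr_mono2') simp_all
        also have "\<dots> = real M powr (1 + -1/8)" using M0 by (simp only: powr_add) simp
        also have "1 + -1/8 = (7/8 :: real)" by simp
        also have "real M powr (7/8) \<le> (2 * Q) powr (7/8)" using MQ M0 by (intro powr_mono2) simp_all
        also have "\<dots> = 2 powr (7/8) * Q powr (7/8)" using Q by (simp add: powr_mult)
        finally show "real M * X powr (-1/8) \<le> 2 powr (7/8) * Q powr (7/8)" .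
        show "X powr (\<epsilon>/2) \<le> 4 powr (\<epsilon>/2) * Q powr (2 * (\<epsilon>/2))" using \<epsilon> by (intro powX) simp
      qed (use C0 in simp_all)
      also have "\<dots> = C0 * c2 * (Q powr (7/8) * Q powr \<epsilon>)" by (simp add: c2_def)
      also have "\<dots> = C0 * c2 * Q powr (7/8 + \<epsilon>)" by (simp only: powr_add)
      also have "\<dots> \<le> C * Q powr (7/8 + \<epsilon>)"
        unfolding C_def using C0 c by (intro mult_right_mono mult_left_mono) simp_all
      finally show ?thesis unfolding A' M_def[symmetric] .
    qed
  qed
  have "C > 0" using C0 c by (simp add: C_def)
  thus ?thesis using that bound by blast
qed

text \<open>Primes are removed one at a time: the sum over the multiples of \<open>p\<close> is the
  symbol of \<open>p\<close> times a sum over the interval divided by \<open>p\<close>. Therefore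
  \<open>\<beta>\<close> is assumed for all intervals up to the given length, and each prime doubles
  the bound.\<close>

lemma jac_sum_coprime_primes:
  fixes \<beta> :: real
  assumes q: "odd q" and P: "finite P" "\<And>p. p \<in> P \<Longrightarrow> prime p"
    and \<beta>: "\<And>A B. A \<le> B \<Longrightarrow> B - A \<le> N \<Longrightarrow> \<bar>real_of_int (\<Sum>n\<in>{A<..B}. jac n q)\<bar> \<le> \<beta>"
    and AB: "A \<le> B" "B - A \<le> N"
  shows "\<bar>real_of_int (\<Sum>n\<in>{n\<in>{A<..B}. \<forall>p\<in>P. \<not> int p dvd n}. jac n q)\<bar> \<le> 2 ^ card P * \<beta>"
  using P AB
proof (induction P arbitrary: A B rule: finite_induct)
  case empty
  have "{n\<in>{A<..B}. \<forall>p\<in>{}. \<not> int p dvd n} = {A<..B}" by auto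
  thus ?case using \<beta>[OF empty.prems(2,3)] by (simp only: card.empty power_0 mult_1)
next
  case (insert p P)
  let ?G = "\<lambda>A B. {n\<in>{A<..B}. \<forall>p\<in>P. \<not> int p dvd n}"
  have p: "prime p" using insert by simp
  hence p0: "int p > 0" using prime_gt_0_nat by simp
  have q0: "q > 0" using q by (auto intro: Nat.gr0I)
  have fin: "finite (?G A B)" by (rule finite_subset[of _ "{A<..B}"]) auto
  have dv: "int r dvd int p * k \<longleftrightarrow> int r dvd k" if "r \<in> P" for r k
  proof -
    have "coprime r p" using insert that by (intro primes_coprime) auto
    hence "coprime (int r) (int p)" by simp
    thus ?thesis by (simp add: coprime_dvd_mult_right_iff)
  qed
  have G: "?G A B = {n\<in>{A<..B}. \<forall>p\<in>insert p P. \<not> int p dvd n} \<union> {n\<in>?G A B. int p dvd n}" by auto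
  have im: "{n\<in>?G A B. int p dvd n} = (\<lambda>k. int p * k) ` ?G (A div int p) (B div int p)"
  proof -
    have "{n\<in>?G A B. int p dvd n} = {n\<in>{n\<in>{A<..B}. int p dvd n}. \<forall>p\<in>P. \<not> int p dvd n}" by auto
    also have "\<dots> = (\<lambda>k. int p * k) ` ?G (A div int p) (B div int p)"
      unfolding multiples_in_interval[OF p0] using dv by auto
    finally show ?thesis .
  qed
  have "(\<Sum>n\<in>?G A B. jac n q) = (\<Sum>n\<in>{n\<in>{A<..B}. \<forall>p\<in>insert p P. \<not> int p dvd n}. jac n q) + (\<Sum>n\<in>{n\<in>?G A B. int p dvd n}. jac n q)"
  proof (subst G, rule sum.union_disjoint)
    show "finite {n\<in>{A<..B}. \<forall>p\<in>insert p P. \<not> int p dvd n}" by (rule finite_subset[of _ "{A<..B}"]) auto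
    show "finite {n\<in>?G A B. int p dvd n}" by (rule finite_subset[of _ "{A<..B}"]) auto
  qed auto
  moreover have "(\<Sum>n\<in>{n\<in>?G A B. int p dvd n}. jac n q) = jac (int p) q * (\<Sum>n\<in>?G (A div int p) (B div int p). jac n q)"
    unfolding im using p0 by (subst sum.reindex) (auto simp: inj_on_def jac_mult_top[OF q] sum_distrib_left)
  ultimately have eq: "real_of_int (\<Sum>n\<in>{n\<in>{A<..B}. \<forall>p\<in>insert p P. \<not> int p dvd n}. jac n q)
     = real_of_int (\<Sum>n\<in>?G A B. jac n q) - real_of_int (jac (int p) q) * real_of_int (\<Sum>n\<in>?G (A div int p) (B div int p). jac n q)"
    by (simp only: of_int_mult[symmetric] of_int_diff[symmetric])
  have 1: "\<bar>real_of_int (\<Sum>n\<in>?G A B. jac n q)\<bar> \<le> 2 ^ card P * \<beta>"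
    using insert by (intro insert.IH) auto
  have 2: "\<bar>real_of_int (\<Sum>n\<in>?G (A div int p) (B div int p). jac n q)\<bar> \<le> 2 ^ card P * \<beta>"
    using insert.prems div_interval_length(2,3)[OF p0, of A B] by (intro insert.IH) auto
  have "\<bar>real_of_int (jac (int p) q)\<bar> \<le> 1" using abs_jac_le[OF q0, of "int p"] by linarith
  hence "\<bar>real_of_int (jac (int p) q) * real_of_int (\<Sum>n\<in>?G (A div int p) (B div int p). jac n q)\<bar> \<le> 1 * (2 ^ card P * \<beta>)"
    unfolding abs_mult using 2 by (intro mult_mono) simp_all
  moreover have "2 ^ card (insert p P) * \<beta> = 2 * (2 ^ card P * \<beta>)" using insert.hyps by simp
  ultimately show ?case unfolding eq using 1 by linarith
qed

text \<open>With K = k t^2 and k squarefree, the symbol modulo K is the symbol modulo k restricted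
  to n coprime to t. \<open>A0\<close> names the left end point inside the hypothesis on
  \<open>\<beta>\<close>, where \<open>A\<close> is a bound variable.\<close>

lemma jac_interval_sum_bound:
  fixes \<beta> :: real
  assumes K: "odd K" and AB: "A \<le> B"
    and \<beta>: "\<And>A M. int M \<le> B - A0 \<Longrightarrow> \<bar>real_of_int (jac_sum (squarefree_part K) A M)\<bar> \<le> \<beta>" and A0: "A0 = A"
  shows "\<bar>real_of_int (\<Sum>n\<in>{A<..B}. jac n K)\<bar> \<le> 2 ^ card (prime_factors (square_part K)) * \<beta>"
proof -
  define k t where "k = squarefree_part K" and "t = square_part K"
  have Kkt: "K = k * (t * t)" unfolding k_def t_def using squarefree_decompose[of K] by (simp add: power2_eq_square)
  have K0: "K > 0" using K by (auto intro: Nat.gr0I)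
  hence kt0: "k > 0" "t > 0" unfolding Kkt by auto
  have ko: "odd k" using K unfolding Kkt by simp
  let ?P = "prime_factors t"
  have jk: "jac n K = (if \<forall>p\<in>?P. \<not> int p dvd n then jac n k else 0)" for n
  proof -
    have j: "jac n K = jac n k * (jac n t * jac n t)" unfolding Kkt using kt0 by (simp add: jac_mult_bottom)
    show ?thesis
    proof (cases "coprime n (int t)")
      case True
      hence "jac n t \<noteq> 0" using jac_eq_0_iff[OF kt0(2)] by blast
      hence "jac n t * jac n t = 1" using jac_values[OF kt0(2), of n] by auto
      moreover have "\<forall>p\<in>?P. \<not> int p dvd n"
      proof (intro ballI notI)
        fix p assume p: "p \<in> ?P" "int p dvd n"
        have "int p dvd int t" using p by (simp add: in_prime_factors_iff)
        hence "int p dvd 1" using True p by (metis coprime_common_divisor)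
        thus False using p by (auto simp: in_prime_factors_iff)
      qed
      ultimately show ?thesis unfolding j by simp
    next
      case False
      hence "jac n t = 0" using jac_eq_0_iff[OF kt0(2)] by blast
      moreover have "\<exists>p\<in>?P. int p dvd n"
      proof -
        have "gcd n (int t) \<noteq> 1" using False by (simp add: coprime_iff_gcd_eq_1)
        hence "nat (gcd n (int t)) \<noteq> 1" by (metis gcd_ge_0_int int_nat_eq of_nat_1 int_one_le_iff_zero_less nat_one_as_int nat_eq_iff2 zero_neq_one)
        then obtain p where p: "prime p" "p dvd nat (gcd n (int t))" using prime_factor_nat by blast
        have "int p dvd int (nat (gcd n (int t)))" using p(2) by (simp only: int_dvd_int_iff)
        hence "int p dvd gcd n (int t)" by (simp only: int_nat_eq gcd_ge_0_int if_True)
        hence "int p dvd n" "int p dvd int t" by (rule dvd_gcdD1, rule dvd_gcdD2)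
        thus ?thesis using p(1) kt0 by (auto simp: in_prime_factors_iff)
      qed
      ultimately show ?thesis unfolding j by auto
    qed
  qed
  have "(\<Sum>n\<in>{A<..B}. jac n K) = (\<Sum>n\<in>{n\<in>{A<..B}. \<forall>p\<in>?P. \<not> int p dvd n}. jac n k)"
    unfolding jk by (rule sum.inter_filter[symmetric]) simp
  moreover have "\<bar>real_of_int (\<Sum>n\<in>{n\<in>{A<..B}. \<forall>p\<in>?P. \<not> int p dvd n}. jac n k)\<bar> \<le> 2 ^ card ?P * \<beta>"
  proof (rule jac_sum_coprime_primes[OF ko, of _ "B - A"])
    fix A' B' :: int assume "A' \<le> B'" "B' - A' \<le> B - A"
    thus "\<bar>real_of_int (\<Sum>n\<in>{A'<..B'}. jac n k)\<bar> \<le> \<beta>"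
      using \<beta>[of "nat (B' - A')" A'] A0 by (simp add: jac_sum_def k_def)
  qed (use AB in auto)
  ultimately show ?thesis by (simp add: t_def)
qed

text \<open>That K is not a square enters all character sum bounds only through a squarefree part
  above 1, which makes complete sums vanish.\<close>

lemma square_part_facts:
  assumes K: "odd K" "\<not> (\<exists>m. K = m\<^sup>2)"
  shows "squarefree_part K > 1" "odd (squarefree_part K)" "squarefree_part K * (square_part K)\<^sup>2 = K" "square_part K > (0::nat)"
proof -
  have K0: "K > 0" using K by (auto intro: Nat.gr0I)
  show dec: "squarefree_part K * (square_part K)\<^sup>2 = K" using squarefree_decompose[of K] by simp
  show "square_part K > 0"
  proof (rule Nat.gr0I)
    assume "square_part K = 0"
    hence "K = 0" using dec by simp
    thus False using K0 by simp
  qed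
  show "odd (squarefree_part K)" using K dec by (metis dvd_mult2)
  have "squarefree_part K \<noteq> 1" using K(2) dec by (metis mult_1)
  moreover have "squarefree_part K \<noteq> 0" by simp
  ultimately show "squarefree_part K > 1" by linarith
qed

text \<open>Whole periods of the squarefree part k cancel, so less than k remains, times 2^omega(t)
  <= t^2; and k t^2 = K. This serves moduli of size O(Q^(1/2)), for which a bound in terms of Q
  alone is too weak.\<close>

lemma jac_interval_trivial:
  assumes K: "odd K" "\<not> (\<exists>m. K = m\<^sup>2)" and AB: "A \<le> B"
  shows "\<bar>real_of_int (\<Sum>n\<in>{A<..B}. jac n K)\<bar> \<le> real K"
proof -
  note f = square_part_facts[OF K]
  have sq: "squarefree (squarefree_part K)" by simp
  have "\<bar>real_of_int (\<Sum>n\<in>{A<..B}. jac n K)\<bar> \<le> 2 ^ card (prime_factors (square_part K)) * real (squarefree_part K)"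
  proof (rule jac_interval_sum_bound[OF K(1) AB])
    fix A M
    obtain A' where A': "jac_sum (squarefree_part K) A M = jac_sum (squarefree_part K) A' (M mod squarefree_part K)"
      using jac_sum_mod[OF sq f(2,1)] .
    have "\<bar>jac_sum (squarefree_part K) A M\<bar> \<le> int (M mod squarefree_part K)"
      unfolding A' using f(1) by (intro abs_jac_sum_le) simp
    moreover have "M mod squarefree_part K < squarefree_part K" using f(1) by simp
    ultimately show "\<bar>real_of_int (jac_sum (squarefree_part K) A M)\<bar> \<le> real (squarefree_part K)" by linarith
  qed simp
  also have "2 ^ card (prime_factors (square_part K)) \<le> real ((square_part K)\<^sup>2)"
  proof -
    have "2 powr real (card (prime_factors (square_part K))) \<le> real (square_part K)"
      using card_prime_factors_le_log[OF f(4)] f(4) by (simp add: le_log_iff)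
    moreover have "square_part K \<le> (square_part K)\<^sup>2" by (simp add: power2_eq_square)
    hence "real (square_part K) \<le> real ((square_part K)\<^sup>2)" by (simp only: of_nat_le_iff)
    moreover have "2 powr real (card (prime_factors (square_part K))) = 2 ^ card (prime_factors (square_part K))"
      by (rule powr_realpow) simp
    ultimately show ?thesis by linarith
  qed
  hence "2 ^ card (prime_factors (square_part K)) * real (squarefree_part K) \<le> real ((square_part K)\<^sup>2) * real (squarefree_part K)"
    by (rule mult_right_mono) simp
  also have "\<dots> = real K" using f(3) by (metis mult.commute of_nat_mult)
  finally show ?thesis .
qed

text \<open>The square part t costs 2^omega(t), which is absorbed by Q^(\<epsilon>/2) since t <= 4
  Q^2.\<close>

lemma jac_interval_burgess:
  fixes \<epsilon> :: real
  assumes \<epsilon>: "\<epsilon> > 0"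
  obtains C where "C > 0" "\<And>K A B Q. odd K \<Longrightarrow> \<not> (\<exists>m. K = m\<^sup>2) \<Longrightarrow> Q \<ge> 1 \<Longrightarrow> real K \<le> 4 * Q\<^sup>2 \<Longrightarrow> A \<le> B \<Longrightarrow>
     real_of_int (B - A) \<le> 2 * Q \<Longrightarrow> \<bar>real_of_int (\<Sum>n\<in>{A<..B}. jac n K)\<bar> \<le> C * Q powr (7/8 + \<epsilon>)"
proof -
  obtain C0 where C0: "C0 > 0" "\<And>q A N Q. squarefree q \<Longrightarrow> odd q \<Longrightarrow> q > 1 \<Longrightarrow> Q \<ge> 1 \<Longrightarrow> real q \<le> 4 * Q\<^sup>2 \<Longrightarrow> real N \<le> 2 * Q \<Longrightarrow>
     \<bar>real_of_int (jac_sum q A N)\<bar> \<le> C0 * Q powr (7/8 + \<epsilon>/2)"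
    using jac_sum_bound_squarefree[of "\<epsilon>/2"] \<epsilon> by auto
  obtain C1 where C1: "C1 \<ge> 1" "\<And>q :: nat. q > 0 \<Longrightarrow> 2 ^ card (prime_factors q) \<le> C1 * real q powr (\<epsilon>/4)"
    using power_card_prime_factors_le[of 2 "\<epsilon>/4"] \<epsilon> by auto
  define C where "C = C1 * 4 powr (\<epsilon>/4) * C0"
  have "\<bar>real_of_int (\<Sum>n\<in>{A<..B}. jac n K)\<bar> \<le> C * Q powr (7/8 + \<epsilon>)"
    if K: "odd K" "\<not> (\<exists>m. K = m\<^sup>2)" and Q: "Q \<ge> 1" and KQ: "real K \<le> 4 * Q\<^sup>2" and AB: "A \<le> B" "real_of_int (B - A) \<le> 2 * Q" for K A B Q
  proof -
    note f = square_part_facts[OF K]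
    have K0: "K > 0" using K by (auto intro: Nat.gr0I)
    have "squarefree_part K dvd K" "square_part K dvd K" using f(3) by (metis dvd_triv_left, metis dvd_mult dvd_power dvd_refl zero_less_numeral power2_eq_square dvd_triv_left dvd_trans)
    hence le: "real (squarefree_part K) \<le> real K" "real (square_part K) \<le> real K"
      using K0 by (simp_all add: dvd_imp_le)
    have "\<bar>real_of_int (\<Sum>n\<in>{A<..B}. jac n K)\<bar> \<le> 2 ^ card (prime_factors (square_part K)) * (C0 * Q powr (7/8 + \<epsilon>/2))"
    proof (rule jac_interval_sum_bound[OF K(1) AB(1)])
      fix A' M assume "int M \<le> B - A"
      hence "real M \<le> 2 * Q" using AB(2) by linarith
      thus "\<bar>real_of_int (jac_sum (squarefree_part K) A' M)\<bar> \<le> C0 * Q powr (7/8 + \<epsilon>/2)"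
        using f le KQ Q by (intro C0(2)) auto
    qed simp
    also have "\<dots> \<le> (C1 * (4 powr (\<epsilon>/4) * Q powr (2 * (\<epsilon>/4)))) * (C0 * Q powr (7/8 + \<epsilon>/2))"
    proof (rule mult_right_mono)
      have "2 ^ card (prime_factors (square_part K)) \<le> C1 * real (square_part K) powr (\<epsilon>/4)" by (rule C1(2)[OF f(4)])
      also have "\<dots> \<le> C1 * (4 * Q\<^sup>2) powr (\<epsilon>/4)"
        using C1(1) le KQ \<epsilon> by (intro mult_left_mono powr_mono2) simp_all
      also have "(4 * Q\<^sup>2) powr (\<epsilon>/4) = 4 powr (\<epsilon>/4) * (Q powr 2) powr (\<epsilon>/4)" using Q by (simp add: powr_mult)
      also have "\<dots> = 4 powr (\<epsilon>/4) * Q powr (2 * (\<epsilon>/4))" by (simp add: powr_powr)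
      finally show "2 ^ card (prime_factors (square_part K)) \<le> C1 * (4 powr (\<epsilon>/4) * Q powr (2 * (\<epsilon>/4)))" .
    qed (use C0 in simp)
    also have "\<dots> = C * (Q powr (2 * (\<epsilon>/4)) * Q powr (7/8 + \<epsilon>/2))" by (simp add: C_def)
    also have "Q powr (2 * (\<epsilon>/4)) * Q powr (7/8 + \<epsilon>/2) = Q powr (2 * (\<epsilon>/4) + (7/8 + \<epsilon>/2))" by (simp only: powr_add)
    also have "2 * (\<epsilon>/4) + (7/8 + \<epsilon>/2) = 7/8 + \<epsilon>" by (simp add: field_simps)
    finally show ?thesis .
  qed
  moreover have "C > 0" using C0 C1 by (simp add: C_def)
  ultimately show ?thesis using that by blast
qed

section \<open>Selberg's sieve\<close>

definition mu :: "nat \<Rightarrow> real" where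
  "mu n = (if squarefree n then (-1) ^ card (prime_factors n) else 0)"

lemma mu_1 [simp]: "mu (Suc 0) = 1"
  using squarefree_1[where ?'a = nat] by (simp add: mu_def del: squarefree_1)

lemma mu_prime_mult:
  assumes "prime p" "\<not> p dvd n" "squarefree n"
  shows "squarefree (p * n)" "mu (p * n) = - mu n"
proof -
  have n0: "n > 0" using assms(3) by (auto intro: Nat.gr0I)
  have c: "coprime p n" using assms by (simp add: prime_imp_coprime)
  show sq: "squarefree (p * n)" by (rule squarefree_mult_coprime[OF c squarefree_prime[OF assms(1)] assms(3)])
  have "p \<notin> prime_factors n" using assms(2) by auto
  thus "mu (p * n) = - mu n" using sq assms by (simp add: mu_def prime_factors_insert n0)
qed

text \<open>For a fixed prime p dividing n, inserting or removing p is an involution on the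
  squarefree divisors that changes the sign.\<close>

lemma sum_mu_divisors:
  assumes "n > 1"
  shows "(\<Sum>d | d dvd n. mu d) = 0"
proof -
  obtain p where p: "prime p" "p dvd n" using prime_factor_nat[of n] assms by auto
  define S where "S = {d. d dvd n \<and> squarefree d}"
  have fin: "finite {d. d dvd n}" using assms by simp
  define i where "i = (\<lambda>d. if p dvd d then d div p else p * d)"
  have i: "i d \<in> S \<and> i (i d) = d \<and> mu (i d) = - mu d" if d: "d \<in> S" for d
  proof (cases "p dvd d")
    case True
    then obtain e where e: "d = p * e" by (auto elim: dvdE)
    have p0: "p > 0" using p prime_gt_0_nat by blast
    have sq: "squarefree e" using d e squarefree_mono[of e d] by (simp add: S_def)
    have np: "\<not> p dvd e"
    proof
      assume "p dvd e"
      hence "p ^ 2 dvd d" by (simp add: e power2_eq_square mult_dvd_mono)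
      hence "p dvd 1" using d squarefreeD unfolding S_def by blast
      thus False using p by simp
    qed
    have ie: "i d = e" "i e = d" using e p0 np by (simp_all add: i_def)
    have "e dvd n" using d e by (auto simp: S_def intro: dvd_trans)
    thus ?thesis using mu_prime_mult(2)[OF p(1) np sq] ie e sq by (simp add: S_def)
  next
    case False
    have c: "coprime p d" using False p by (simp add: prime_imp_coprime)
    have sq: "squarefree d" "d dvd n" using d by (auto simp: S_def)
    have "p * d dvd n" using c p sq by (intro divides_mult)
    moreover have "i (p * d) = d" using p prime_gt_0_nat[of p] by (simp add: i_def)
    ultimately show ?thesis using mu_prime_mult[OF p(1) False sq(1)] False by (simp add: i_def S_def)
  qed
  have S: "(\<Sum>d | d dvd n. mu d) = (\<Sum>d\<in>S. mu d)"
    by (rule sum.mono_neutral_right[OF fin]) (auto simp: S_def mu_def)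
  have "(\<Sum>d\<in>S. mu d) = (\<Sum>d\<in>S. - mu d)"
    by (rule sum.reindex_bij_witness[of _ i i]) (use i in auto)
  hence "(\<Sum>d\<in>S. mu d) = - (\<Sum>d\<in>S. mu d)" by (simp only: sum_negf)
  thus ?thesis unfolding S by simp
qed

text \<open>Moebius inversion along multiples up to \<open>D\<close>, for recovering Selberg's
  weights: substituting e = s/d leaves the sum of \<open>mu\<close> over the divisors of
  s/r.\<close>

lemma sum_mu_between:
  assumes "r > 0" "s > 0" "s \<le> D"
  shows "(\<Sum>d\<in>{1..D}. if r dvd d \<and> d dvd s then mu (s div d) else 0) = (if r = s then 1 else 0)"
proof (cases "r dvd s")
  case False
  hence "(if r dvd d \<and> d dvd s then mu (s div d) else 0) = 0" for d using dvd_trans by auto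
  thus ?thesis using False by (simp only: sum.neutral_const) auto
next
  case True
  then obtain t where t: "s = r * t" by (auto elim: dvdE)
  have t0: "t > 0" using assms t by (auto intro: Nat.gr0I)
  have "(\<Sum>d\<in>{1..D}. if r dvd d \<and> d dvd s then mu (s div d) else 0) = (\<Sum>d | d \<in> {1..D} \<and> (r dvd d \<and> d dvd s). mu (s div d))"
    by (rule sum.inter_filter[symmetric]) simp
  also have "\<dots> = (\<Sum>e | e dvd t. mu e)"
  proof (rule sum.reindex_bij_witness[of _ "\<lambda>e. r * (t div e)" "\<lambda>d. s div d"])
    fix d assume "d \<in> {d. d \<in> {1..D} \<and> (r dvd d \<and> d dvd s)}"
    then obtain k where k: "d = r * k" "r * k dvd r * t" "d \<ge> 1" using t by (auto elim!: dvdE)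
    have "k dvd t" using k assms(1) by simp
    then obtain l where l: "t = k * l" by (auto elim: dvdE)
    have kl: "k > 0" "l > 0" using t0 l by (auto intro: Nat.gr0I)
    have sd: "s div d = l" using k l t assms(1) kl by (simp add: mult.assoc[symmetric])
    show "r * (t div (s div d)) = d" unfolding sd using k l kl by simp
    show "s div d \<in> {e. e dvd t}" unfolding sd using l by simp
    show "mu (s div d) = mu (s div d)" ..
  next
    fix e assume "e \<in> {e. e dvd t}"
    then obtain k where k: "t = e * k" by (auto elim: dvdE)
    have ek: "e > 0" "k > 0" using t0 k by (auto intro: Nat.gr0I)
    have te: "t div e = k" using k ek by simp
    have "r * k dvd s" unfolding t k by simp
    moreover have "r * k \<le> D" using \<open>r * k dvd s\<close> assms by (meson dvd_imp_le order_trans)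
    ultimately show "r * (t div e) \<in> {d. d \<in> {1..D} \<and> (r dvd d \<and> d dvd s)}" unfolding te using ek assms by simp
    show "s div (r * (t div e)) = e" unfolding te unfolding t k using ek assms by simp
  qed
  also have "\<dots> = (if r = s then 1 else 0)"
  proof (cases "t = 1")
    case True
    thus ?thesis using t by simp
  next
    case False
    hence "(\<Sum>e | e dvd t. mu e) = 0" using t0 by (intro sum_mu_divisors) simp
    moreover have "r \<noteq> s" using False t assms by simp
    ultimately show ?thesis by simp
  qed
  finally show ?thesis .
qed

section \<open>Selberg's weights\<close>

definition selberg_G :: "nat \<Rightarrow> real" where
  "selberg_G D = (\<Sum>r\<in>{1..D}. (mu r)\<^sup>2 / real (totient r))"

lemma selberg_G_ge_1: "D \<ge> 1 \<Longrightarrow> selberg_G D \<ge> 1"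
proof -
  assume "D \<ge> 1"
  hence "(mu 1)\<^sup>2 / real (totient 1) \<le> selberg_G D"
    unfolding selberg_G_def by (intro member_le_sum) auto
  thus ?thesis by simp
qed

lemma sum_inverse_squares_le: "(\<Sum>k\<in>{1..D}. 1 / (real k)\<^sup>2) \<le> 2"
proof -
  have "(\<Sum>k\<in>{1..Suc D}. 1 / (real k)\<^sup>2) \<le> 2 - 1 / real (Suc D)" for D
  proof (induction D)
    case (Suc D)
    have "1 / (real (Suc (Suc D)))\<^sup>2 \<le> 1 / real (Suc D) - 1 / real (Suc (Suc D))"
    proof -
      have "1 / (real (Suc (Suc D)))\<^sup>2 \<le> 1 / (real (Suc D) * real (Suc (Suc D)))"
        unfolding power2_eq_square by (intro divide_left_mono mult_right_mono) simp_all
      also have "\<dots> = 1 / real (Suc D) - 1 / real (Suc (Suc D))" by (simp add: field_simps)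
      finally show ?thesis .
    qed
    thus ?case using Suc.IH by simp
  qed simp
  hence "(\<Sum>k\<in>{1..Suc D}. 1 / (real k)\<^sup>2) \<le> 2" by (rule order.trans) simp
  moreover have "(\<Sum>k\<in>{1..D}. 1 / (real k)\<^sup>2) \<le> (\<Sum>k\<in>{1..Suc D}. 1 / (real k)\<^sup>2)" by simp
  ultimately show ?thesis by linarith
qed

text \<open>Each n <= D is r k^2 with r squarefree, so the harmonic sum is at most the sum of 1/r
  times the sum of 1/k^2, which is at most 2; and 1/r <= 1/phi(r).\<close>

lemma selberg_G_ge_ln:
  assumes "D \<ge> 1"
  shows "selberg_G D \<ge> ln (real D) / 2"
proof -
  let ?f = "\<lambda>n. (squarefree_part n, square_part n)"
  define Q where "Q = {r\<in>{1..D}. squarefree r}"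
  have inj: "inj_on ?f {1..D}"
    by (rule inj_onI) (metis prod.inject squarefree_decompose)
  have im: "?f ` {1..D} \<subseteq> Q \<times> {1..D}"
  proof (rule image_subsetI)
    fix n assume n: "n \<in> {1..D}"
    have dec: "squarefree_part n * (square_part n)\<^sup>2 = n" using squarefree_decompose[of n] by simp
    hence "squarefree_part n dvd n" "square_part n dvd n" by (metis dvd_triv_left, metis dvd_triv_right dvd_mult2 power2_eq_square dvd_mult dvd_triv_left)
    moreover have "squarefree_part n > 0" by (simp add: zero_less_iff_neq_zero)
    moreover have "square_part n > 0" using n by (simp add: zero_less_iff_neq_zero)
    ultimately show "?f n \<in> Q \<times> {1..D}" using n by (auto simp: Q_def dest!: dvd_imp_le)
  qed
  have "ln (real D) \<le> ln (real D + 1)" using assms by simp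
  also have "\<dots> \<le> harm D" by (rule ln_le_harm)
  also have "harm D = (\<Sum>n\<in>{1..D}. 1 / real n)" by (simp add: harm_def field_simps)
  also have "\<dots> = (\<Sum>n\<in>{1..D}. (\<lambda>(r, k). 1 / (real r * (real k)\<^sup>2)) (?f n))"
  proof (rule sum.cong[OF refl])
    fix n :: nat
    have "squarefree_part n * (square_part n)\<^sup>2 = n" using squarefree_decompose[of n] by simp
    hence "real n = real (squarefree_part n) * (real (square_part n))\<^sup>2" by (metis of_nat_mult of_nat_power)
    thus "1 / real n = (\<lambda>(r, k). 1 / (real r * (real k)\<^sup>2)) (?f n)" by simp
  qed
  also have "\<dots> = (\<Sum>x\<in>?f ` {1..D}. (\<lambda>(r, k). 1 / (real r * (real k)\<^sup>2)) x)"
    by (subst sum.reindex[OF inj]) simp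
  also have "\<dots> \<le> (\<Sum>x\<in>Q \<times> {1..D}. (\<lambda>(r, k). 1 / (real r * (real k)\<^sup>2)) x)"
    by (rule sum_mono2[OF _ im]) (auto simp: Q_def)
  also have "\<dots> = (\<Sum>r\<in>Q. 1 / real r) * (\<Sum>k\<in>{1..D}. 1 / (real k)\<^sup>2)"
    unfolding sum_product sum.cartesian_product by (simp add: case_prod_unfold)
  also have "\<dots> \<le> (\<Sum>r\<in>Q. 1 / real r) * 2"
    by (intro mult_left_mono sum_inverse_squares_le sum_nonneg) simp
  also have "(\<Sum>r\<in>Q. 1 / real r) \<le> selberg_G D"
  proof -
    have "(\<Sum>r\<in>Q. 1 / real r) = (\<Sum>r\<in>{1..D}. if squarefree r then 1 / real r else 0)"
      unfolding Q_def by (rule sum.inter_filter) simp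
    also have "\<dots> \<le> selberg_G D" unfolding selberg_G_def
    proof (rule sum_mono)
      fix r assume r: "r \<in> {1..D}"
      have "1 / real r \<le> 1 / real (totient r)"
        using r by (intro divide_left_mono) (simp_all add: totient_le)
      thus "(if squarefree r then 1 / real r else 0) \<le> (mu r)\<^sup>2 / real (totient r)"
        by (simp add: mu_def flip: power_mult)
    qed
    finally show ?thesis .
  qed
  finally show ?thesis by simp
qed

text \<open>With w(d) = d y(d), the relations d e / lcm = gcd and gcd = sum of phi over common
  divisors diagonalise the form: it is the sum over r of phi(r) times the square of the sum of y
  over multiples of r. Prescribing these inner sums as mu(r)/(phi(r) G), the minimiser under w(1) =
  1, gives the value 1/G.\<close>

lemma selberg_weights:
  assumes D: "D \<ge> 1"
  obtains w :: "nat \<Rightarrow> real" where "w 1 = 1" "\<And>d. d \<in> {1..D} \<Longrightarrow> \<bar>w d\<bar> \<le> real D"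
    "(\<Sum>d\<in>{1..D}. \<Sum>e\<in>{1..D}. w d * w e / real (lcm d e)) = 1 / selberg_G D"
proof -
  let ?R = "{1..D}"
  define G where "G = selberg_G D"
  have G1: "G \<ge> 1" unfolding G_def by (rule selberg_G_ge_1[OF D])
  define z where "z = (\<lambda>s. mu s / (real (totient s) * G))"
  define y where "y = (\<lambda>d. \<Sum>s\<in>?R. if d dvd s then mu (s div d) * z s else 0)"
  define w where "w = (\<lambda>d. real d * y d)"
  have mu_sq: "mu s * mu s = (mu s)\<^sup>2" "\<bar>mu s\<bar> \<le> 1" "\<bar>mu s\<bar> = (mu s)\<^sup>2" for s by (auto simp: mu_def power2_eq_square power_abs)
  have sumz: "(\<Sum>s\<in>?R. (mu s)\<^sup>2 / (real (totient s) * G)) = 1"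
  proof -
    have "(\<Sum>s\<in>?R. (mu s)\<^sup>2 / (real (totient s) * G)) = (\<Sum>s\<in>?R. (mu s)\<^sup>2 / real (totient s)) / G"
      by (simp add: sum_divide_distrib)
    also have "\<dots> = G / G" by (simp only: G_def selberg_G_def)
    also have "\<dots> = 1" using G1 by simp
    finally show ?thesis .
  qed
  have "y 1 = (\<Sum>s\<in>?R. (mu s)\<^sup>2 / (real (totient s) * G))"
    unfolding y_def z_def by (rule sum.cong[OF refl]) (simp add: power2_eq_square)
  hence "y 1 = 1" by (rule trans[OF _ sumz])
  hence w1: "w 1 = 1" unfolding w_def by (simp only: of_nat_1 mult_1)
  have yb: "\<bar>y d\<bar> \<le> 1" for d
  proof -
    have "\<bar>y d\<bar> \<le> (\<Sum>s\<in>?R. (mu s)\<^sup>2 / (real (totient s) * G))"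
      unfolding y_def
    proof (rule order.trans[OF sum_abs], rule sum_mono)
      fix s
      have "\<bar>mu (s div d) * z s\<bar> \<le> 1 * \<bar>z s\<bar>" unfolding abs_mult by (rule mult_right_mono[OF mu_sq(2)]) simp
      also have "\<bar>z s\<bar> = (mu s)\<^sup>2 / (real (totient s) * G)" using G1 by (simp add: z_def abs_mult mu_sq(3))
      finally show "\<bar>if d dvd s then mu (s div d) * z s else 0\<bar> \<le> (mu s)\<^sup>2 / (real (totient s) * G)"
        using G1 by simp
    qed
    thus ?thesis unfolding sumz .
  qed
  have wD: "\<bar>w d\<bar> \<le> real D" if "d \<in> ?R" for d
  proof -
    have "\<bar>w d\<bar> = real d * \<bar>y d\<bar>" by (simp add: w_def abs_mult)
    also have "\<dots> \<le> real D * 1" using that yb by (intro mult_mono) simp_all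
    finally show ?thesis by simp
  qed
  have inversion: "(\<Sum>d\<in>?R. if r dvd d then y d else 0) = z r" if r: "r \<in> ?R" for r
  proof -
    have "(\<Sum>d\<in>?R. if r dvd d then y d else 0) = (\<Sum>d\<in>?R. \<Sum>s\<in>?R. (if r dvd d \<and> d dvd s then mu (s div d) else 0) * z s)"
    proof (rule sum.cong[OF refl])
      fix d
      show "(if r dvd d then y d else 0) = (\<Sum>s\<in>?R. (if r dvd d \<and> d dvd s then mu (s div d) else 0) * z s)"
        by (cases "r dvd d") (simp_all add: y_def if_distrib[of "\<lambda>x. x * _"] cong: if_cong)
    qed
    also have "\<dots> = (\<Sum>s\<in>?R. \<Sum>d\<in>?R. (if r dvd d \<and> d dvd s then mu (s div d) else 0) * z s)" by (rule sum.swap)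
    also have "\<dots> = (\<Sum>s\<in>?R. (if r = s then 1 else 0) * z s)"
    proof (rule sum.cong[OF refl])
      fix s assume "s \<in> ?R"
      thus "(\<Sum>d\<in>?R. (if r dvd d \<and> d dvd s then mu (s div d) else 0) * z s) = (if r = s then 1 else 0) * z s"
        using r sum_mu_between[of r s D] unfolding sum_distrib_right[symmetric] by simp
    qed
    also have "\<dots> = (\<Sum>s\<in>?R. if r = s then z s else 0)" by (rule sum.cong) auto
    also have "\<dots> = z r" using r by simp
    finally show ?thesis .
  qed
  have gcd_sum: "real (gcd d e) = (\<Sum>r\<in>?R. real (totient r) * ((if r dvd d then 1 else 0) * (if r dvd e then 1 else 0)))"
    if "d \<in> ?R" "e \<in> ?R" for d e
  proof -
    have g: "gcd d e > 0" using that by simp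
    have "(\<Sum>r | r dvd gcd d e. totient r) = gcd d e" by (rule totient_divisor_sum)
    hence "real (gcd d e) = (\<Sum>r | r dvd gcd d e. real (totient r))" by (metis of_nat_sum)
    also have "{r. r dvd gcd d e} = {r\<in>?R. r dvd d \<and> r dvd e}"
    proof -
      have "r \<in> ?R" if "r dvd gcd d e" for r
      proof -
        have "r dvd d" using that by simp
        hence "r \<le> d" "r > 0" using \<open>d \<in> ?R\<close> by (auto dest: dvd_imp_le intro!: Nat.gr0I)
        thus ?thesis using \<open>d \<in> ?R\<close> by simp
      qed
      thus ?thesis by auto
    qed
    also have "(\<Sum>r\<in>{r\<in>?R. r dvd d \<and> r dvd e}. real (totient r)) = (\<Sum>r\<in>?R. if r dvd d \<and> r dvd e then real (totient r) else 0)"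
      by (rule sum.inter_filter) simp
    finally show ?thesis by (simp only: if_distrib mult_1_right mult_zero_right mult_zero_left mult_1 if_bool_eq_conj) (rule sum.cong, auto)
  qed
  have "(\<Sum>d\<in>?R. \<Sum>e\<in>?R. w d * w e / real (lcm d e)) = (\<Sum>d\<in>?R. \<Sum>e\<in>?R. \<Sum>r\<in>?R. real (totient r) * ((if r dvd d then y d else 0) * (if r dvd e then y e else 0)))"
  proof (rule sum.cong[OF refl], rule sum.cong[OF refl])
    fix d e assume de: "d \<in> ?R" "e \<in> ?R"
    have "real (gcd d e) * real (lcm d e) = real d * real e" by (metis of_nat_mult prod_gcd_lcm_nat)
    moreover have "real (lcm d e) > 0" using de by (simp add: lcm_pos_nat)
    moreover have "w d * w e / real (lcm d e) = y d * y e * (real d * real e) / real (lcm d e)"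
      by (simp add: w_def mult_ac)
    ultimately have "w d * w e / real (lcm d e) = y d * y e * (real (gcd d e) * real (lcm d e)) / real (lcm d e)"
      by (simp only:)
    also have "\<dots> = y d * y e * real (gcd d e)"
    proof -
      have "real (lcm d e) \<noteq> 0" using \<open>real (lcm d e) > 0\<close> by linarith
      from nonzero_mult_div_cancel_right[OF this, of "y d * y e * real (gcd d e)"] show ?thesis
        by (simp only: mult.assoc)
    qed
    finally have "w d * w e / real (lcm d e) = y d * y e * real (gcd d e)" .
    also have "\<dots> = (\<Sum>r\<in>?R. y d * y e * (real (totient r) * ((if r dvd d then 1 else 0) * (if r dvd e then 1 else 0))))"
      unfolding gcd_sum[OF de] sum_distrib_left ..
    also have "\<dots> = (\<Sum>r\<in>?R. real (totient r) * ((if r dvd d then y d else 0) * (if r dvd e then y e else 0)))"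
      by (rule sum.cong[OF refl]) simp
    finally show "w d * w e / real (lcm d e) = (\<Sum>r\<in>?R. real (totient r) * ((if r dvd d then y d else 0) * (if r dvd e then y e else 0)))" .
  qed
  also have "\<dots> = (\<Sum>d\<in>?R. \<Sum>r\<in>?R. \<Sum>e\<in>?R. real (totient r) * ((if r dvd d then y d else 0) * (if r dvd e then y e else 0)))"
    by (rule sum.cong[OF refl], rule sum.swap)
  also have "\<dots> = (\<Sum>r\<in>?R. \<Sum>d\<in>?R. \<Sum>e\<in>?R. real (totient r) * ((if r dvd d then y d else 0) * (if r dvd e then y e else 0)))"
    by (rule sum.swap)
  also have "\<dots> = (\<Sum>r\<in>?R. real (totient r) * ((\<Sum>d\<in>?R. if r dvd d then y d else 0) * (\<Sum>e\<in>?R. if r dvd e then y e else 0)))"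
    unfolding sum_product by (simp only: sum_distrib_left)
  also have "\<dots> = (\<Sum>r\<in>?R. (mu r)\<^sup>2 / real (totient r) / G\<^sup>2)"
  proof (rule sum.cong[OF refl])
    fix r assume r: "r \<in> ?R"
    hence "totient r > 0" by simp
    thus "real (totient r) * ((\<Sum>d\<in>?R. if r dvd d then y d else 0) * (\<Sum>e\<in>?R. if r dvd e then y e else 0)) = (mu r)\<^sup>2 / real (totient r) / G\<^sup>2"
      unfolding inversion[OF r] z_def using G1 by (simp add: field_simps power2_eq_square)
  qed
  also have "\<dots> = G / G\<^sup>2" unfolding sum_divide_distrib[symmetric] by (simp add: G_def selberg_G_def)
  also have "\<dots> = 1 / selberg_G D" using G1 by (simp add: power2_eq_square G_def)
  finally show ?thesis using that[of w] w1 wD by blast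
qed

text \<open>The sieve majorant: a square, hence nonnegative, and equal to \<open>w 1\<close> squared
  at primes above \<open>D\<close>, whose only divisor up to \<open>D\<close> is 1.\<close>

definition sieve_weight :: "(nat \<Rightarrow> real) \<Rightarrow> nat \<Rightarrow> int \<Rightarrow> real" where
  "sieve_weight w D m = (\<Sum>d\<in>{1..D}. if int d dvd m then w d else 0)\<^sup>2"

lemma sum_sieve_weight:
  fixes g :: "int \<Rightarrow> real"
  shows "(\<Sum>m\<in>{A<..B}. sieve_weight w D m * g m) =
     (\<Sum>d\<in>{1..D}. \<Sum>e\<in>{1..D}. w d * w e * (\<Sum>m\<in>{m\<in>{A<..B}. int (lcm d e) dvd m}. g m))"
proof -
  have "(\<Sum>m\<in>{A<..B}. sieve_weight w D m * g m) =
     (\<Sum>m\<in>{A<..B}. \<Sum>d\<in>{1..D}. \<Sum>e\<in>{1..D}. w d * w e * (if int (lcm d e) dvd m then g m else 0))"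
  proof (rule sum.cong[OF refl])
    fix m
    have dv: "int (lcm d e) dvd m \<longleftrightarrow> int d dvd m \<and> int e dvd m" for d e
      by (simp add: lcm_least_iff flip: lcm_int_int_eq)
    have "sieve_weight w D m * g m = (\<Sum>d\<in>{1..D}. \<Sum>e\<in>{1..D}. (if int d dvd m then w d else 0) * (if int e dvd m then w e else 0)) * g m"
      by (simp only: sieve_weight_def power2_eq_square sum_product)
    also have "\<dots> = (\<Sum>d\<in>{1..D}. \<Sum>e\<in>{1..D}. (if int d dvd m then w d else 0) * (if int e dvd m then w e else 0) * g m)"
      by (simp only: sum_distrib_right)
    also have "\<dots> = (\<Sum>d\<in>{1..D}. \<Sum>e\<in>{1..D}. w d * w e * (if int (lcm d e) dvd m then g m else 0))"
      by (rule sum.cong[OF refl], rule sum.cong[OF refl]) (simp add: dv)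
    finally show "sieve_weight w D m * g m = (\<Sum>d\<in>{1..D}. \<Sum>e\<in>{1..D}. w d * w e * (if int (lcm d e) dvd m then g m else 0))" .
  qed
  also have "\<dots> = (\<Sum>d\<in>{1..D}. \<Sum>m\<in>{A<..B}. \<Sum>e\<in>{1..D}. w d * w e * (if int (lcm d e) dvd m then g m else 0))"
    by (rule sum.swap)
  also have "\<dots> = (\<Sum>d\<in>{1..D}. \<Sum>e\<in>{1..D}. \<Sum>m\<in>{A<..B}. w d * w e * (if int (lcm d e) dvd m then g m else 0))"
    by (rule sum.cong[OF refl], rule sum.swap)
  also have "\<dots> = (\<Sum>d\<in>{1..D}. \<Sum>e\<in>{1..D}. w d * w e * (\<Sum>m\<in>{m\<in>{A<..B}. int (lcm d e) dvd m}. g m))"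
  proof (rule sum.cong[OF refl], rule sum.cong[OF refl])
    fix d e
    have "(\<Sum>m\<in>{m\<in>{A<..B}. int (lcm d e) dvd m}. g m) = (\<Sum>m\<in>{A<..B}. if int (lcm d e) dvd m then g m else 0)"
      by (rule sum.inter_filter) simp
    thus "(\<Sum>m\<in>{A<..B}. w d * w e * (if int (lcm d e) dvd m then g m else 0)) = w d * w e * (\<Sum>m\<in>{m\<in>{A<..B}. int (lcm d e) dvd m}. g m)"
      by (simp only: sum_distrib_left)
  qed
  finally show ?thesis .
qed

text \<open>D^2 pairs of weights with products at most D^2 each: the origin of D^4 in the later
  bounds.\<close>

lemma weights_product_bound:
  assumes w: "\<And>d. d \<in> {1..D} \<Longrightarrow> \<bar>w d\<bar> \<le> real D" and x: "\<And>d e. d \<in> {1..D} \<Longrightarrow> e \<in> {1..D} \<Longrightarrow> \<bar>x d e\<bar> \<le> \<beta>"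
  shows "\<bar>\<Sum>d\<in>{1..D}. \<Sum>e\<in>{1..D}. w d * w e * x d e\<bar> \<le> real D ^ 4 * \<beta>"
proof -
  have "\<bar>\<Sum>d\<in>{1..D}. \<Sum>e\<in>{1..D}. w d * w e * x d e\<bar> \<le> (\<Sum>d\<in>{1..D}. \<Sum>e\<in>{1..D}. real D * real D * \<beta>)"
  proof (rule order.trans[OF sum_abs], rule sum_mono, rule order.trans[OF sum_abs], rule sum_mono)
    fix d e assume "d \<in> {1..D}" "e \<in> {1..D}"
    thus "\<bar>w d * w e * x d e\<bar> \<le> real D * real D * \<beta>"
      unfolding abs_mult by (intro mult_mono w x) simp_all
  qed
  also have "\<dots> = real D ^ 4 * \<beta>" by (simp add: eval_nat_numeral mult_ac)
  finally show ?thesis .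
qed

text \<open>On multiples m = l k of l = lcm d e the symbol of l comes out, and k runs over an
  interval no longer than the original.\<close>

lemma sieve_char_sum:
  assumes w: "\<And>d. d \<in> {1..D} \<Longrightarrow> \<bar>w d\<bar> \<le> real D" and K: "odd K" and AB: "A \<le> B"
    and \<beta>: "\<And>A' B'. A' \<le> B' \<Longrightarrow> B' - A' \<le> B - A \<Longrightarrow> \<bar>real_of_int (\<Sum>n\<in>{A'<..B'}. jac n K)\<bar> \<le> \<beta>"
  shows "\<bar>\<Sum>m\<in>{A<..B}. sieve_weight w D m * real_of_int (jac m K)\<bar> \<le> real D ^ 4 * \<beta>"
  unfolding sum_sieve_weight
proof (rule weights_product_bound[OF w])
  fix d e assume de: "d \<in> {1..D}" "e \<in> {1..D}"
  define l where "l = int (lcm d e)"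
  have l0: "l > 0" using de by (simp add: l_def lcm_pos_nat)
  have K0: "K > 0" using K by (auto intro: Nat.gr0I)
  have "(\<Sum>m\<in>{m\<in>{A<..B}. l dvd m}. real_of_int (jac m K)) = real_of_int (jac l K) * real_of_int (\<Sum>k\<in>{A div l<..B div l}. jac k K)"
    unfolding multiples_in_interval[OF l0] using l0
    by (subst sum.reindex) (simp_all add: inj_on_def jac_mult_top[OF K] sum_distrib_left)
  hence "\<bar>\<Sum>m\<in>{m\<in>{A<..B}. l dvd m}. real_of_int (jac m K)\<bar> = \<bar>real_of_int (jac l K)\<bar> * \<bar>real_of_int (\<Sum>k\<in>{A div l<..B div l}. jac k K)\<bar>"
    by (simp only: abs_mult)
  also have "\<dots> \<le> 1 * \<beta>"
  proof (rule mult_mono)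
    show "\<bar>real_of_int (jac l K)\<bar> \<le> 1" using abs_jac_le[OF K0, of l] by linarith
    show "\<bar>real_of_int (\<Sum>k\<in>{A div l<..B div l}. jac k K)\<bar> \<le> \<beta>"
      by (rule \<beta>) (use div_interval_length(2,3)[OF l0 AB] in auto)
  qed simp_all
  finally show "\<bar>\<Sum>m\<in>{m\<in>{A<..B}. int (lcm d e) dvd m}. real_of_int (jac m K)\<bar> \<le> \<beta>" by (simp add: l_def)
qed

text \<open>The number of multiples of lcm d e differs from its expected value by at most 1, and
  these errors add up to at most D^4.\<close>

lemma sieve_weight_sum:
  assumes w: "\<And>d. d \<in> {1..D} \<Longrightarrow> \<bar>w d\<bar> \<le> real D" and AB: "A \<le> B"
    and G: "(\<Sum>d\<in>{1..D}. \<Sum>e\<in>{1..D}. w d * w e / real (lcm d e)) = 1 / G"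
  shows "(\<Sum>m\<in>{A<..B}. sieve_weight w D m) \<le> real_of_int (B - A) / G + real D ^ 4"
proof -
  define R where "R = (\<lambda>d e. real (card {m\<in>{A<..B}. int (lcm d e) dvd m}) - real_of_int (B - A) / real (lcm d e))"
  have R: "\<bar>R d e\<bar> \<le> 1" if "d \<in> {1..D}" "e \<in> {1..D}" for d e
  proof -
    define l where "l = int (lcm d e)"
    have l0: "l > 0" using that by (simp add: l_def lcm_pos_nat)
    have "card {m\<in>{A<..B}. l dvd m} = card {A div l<..B div l}"
      unfolding multiples_in_interval[OF l0] using l0 by (intro card_image) (simp add: inj_on_def)
    hence c: "real (card {m\<in>{A<..B}. l dvd m}) = real_of_int (B div l) - real_of_int (A div l)"
      using div_interval_length(3)[OF l0 AB] by simp
    have fl: "real_of_int x / real_of_int l - 1 \<le> real_of_int (x div l) \<and> real_of_int (x div l) \<le> real_of_int x / real_of_int l" for x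
      using of_int_floor_le[of "real_of_int x / real_of_int l"] real_of_int_floor_gt_diff_one[of "real_of_int x / real_of_int l"]
      unfolding floor_divide_of_int_eq by linarith
    have "R d e = real_of_int (B div l) - real_of_int (A div l) - (real_of_int B / real_of_int l - real_of_int A / real_of_int l)"
      unfolding R_def l_def[symmetric] c by (simp add: diff_divide_distrib l_def)
    thus ?thesis using fl[of A] fl[of B] by linarith
  qed
  have "(\<Sum>m\<in>{A<..B}. sieve_weight w D m) = (\<Sum>m\<in>{A<..B}. sieve_weight w D m * 1)" by simp
  also have "\<dots> = (\<Sum>d\<in>{1..D}. \<Sum>e\<in>{1..D}. w d * w e * real (card {m\<in>{A<..B}. int (lcm d e) dvd m}))"
    unfolding sum_sieve_weight by simp
  also have "\<dots> = (\<Sum>d\<in>{1..D}. \<Sum>e\<in>{1..D}. real_of_int (B - A) * (w d * w e / real (lcm d e)) + w d * w e * R d e)"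
    by (rule sum.cong[OF refl], rule sum.cong[OF refl]) (simp add: R_def algebra_simps)
  also have "\<dots> = real_of_int (B - A) * (1 / G) + (\<Sum>d\<in>{1..D}. \<Sum>e\<in>{1..D}. w d * w e * R d e)"
    by (simp only: sum.distrib sum_distrib_left[symmetric] G)
  also have "(\<Sum>d\<in>{1..D}. \<Sum>e\<in>{1..D}. w d * w e * R d e) \<le> real D ^ 4 * 1"
    using weights_product_bound[of D w R 1, OF w R] by linarith
  finally show ?thesis by simp
qed

lemma norm_square_sum:
  "complex_of_real ((cmod (\<Sum>n\<in>N. f n))\<^sup>2) = (\<Sum>n\<in>N. \<Sum>n'\<in>N. f n * cnj (f n'))"
  by (simp only: complex_norm_square sum_product cnj_sum)

text \<open>The majorant is inserted while the summand is still an absolute square, so positivity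
  permits passing from primes to all integers. After squaring out, pairs with a square product are
  charged the whole mass of the majorant, the others its character sum.\<close>

lemma sieve_inequality:
  fixes \<alpha> :: "int \<Rightarrow> complex" and k :: "int \<Rightarrow> nat"
  assumes D: "D \<ge> 1" "int D \<le> A" and AB: "A \<le> B" and N: "finite N"
    and \<alpha>: "\<And>n. n \<in> N \<Longrightarrow> cmod (\<alpha> n) \<le> 1" and k: "\<And>n. n \<in> N \<Longrightarrow> odd (k n)"
    and P: "\<And>p. p \<in> P \<Longrightarrow> prime p \<and> A < p \<and> p \<le> B"
    and \<beta>: "\<And>n n' A' B'. n \<in> N \<Longrightarrow> n' \<in> N \<Longrightarrow> \<not> (\<exists>m. k n * k n' = m\<^sup>2) \<Longrightarrow> A' \<le> B' \<Longrightarrow> B' - A' \<le> B - A \<Longrightarrow>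
        \<bar>real_of_int (\<Sum>j\<in>{A'<..B'}. jac j (k n * k n'))\<bar> \<le> \<beta>" and \<beta>0: "\<beta> \<ge> 0"
  shows "(\<Sum>p\<in>P. (cmod (\<Sum>n\<in>N. \<alpha> n * of_int (jac p (k n))))\<^sup>2) \<le>
     real (card {(n, n'). n \<in> N \<and> n' \<in> N \<and> (\<exists>m. k n * k n' = m\<^sup>2)}) * (real_of_int (B - A) / selberg_G D + real D ^ 4)
       + real (card N) ^ 2 * (real D ^ 4 * \<beta>)"
proof -
  obtain w where w: "w 1 = 1" "\<And>d. d \<in> {1..D} \<Longrightarrow> \<bar>w d\<bar> \<le> real D"
    "(\<Sum>d\<in>{1..D}. \<Sum>e\<in>{1..D}. w d * w e / real (lcm d e)) = 1 / selberg_G D"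
    by (rule selberg_weights[OF D(1)]) (rule that)
  let ?W = "sieve_weight w D"
  define f where "f = (\<lambda>m. \<Sum>n\<in>N. \<alpha> n * of_int (jac m (k n)))"
  define X where "X = real_of_int (B - A) / selberg_G D + real D ^ 4"
  have W0: "?W m \<ge> 0" for m by (simp add: sieve_weight_def)
  have X0: "X \<ge> 0" unfolding X_def using AB selberg_G_ge_1[OF D(1)] by (intro add_nonneg_nonneg divide_nonneg_nonneg) auto
  have Wp: "?W p = 1" if p: "p \<in> P" for p
  proof -
    have pp: "prime p" "p > int D" using P[OF p] D by auto
    have "(\<Sum>d\<in>{1..D}. if int d dvd p then w d else 0) = (\<Sum>d\<in>{1..D}. if d = 1 then w d else 0)"
    proof (rule sum.cong[OF refl])
      fix d assume d: "d \<in> {1..D}"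
      have "int d dvd p \<longleftrightarrow> d = 1"
      proof
        assume "int d dvd p"
        moreover have "\<forall>m. 0 \<le> m \<and> m dvd p \<longrightarrow> m = 1 \<or> m = p" using pp(1) unfolding prime_int_iff by blast
        ultimately have "int d = 1 \<or> int d = p" using of_nat_0_le_iff by blast
        thus "d = 1" using pp(2) d by auto
      qed simp
      thus "(if int d dvd p then w d else 0) = (if d = 1 then w d else 0)" by simp
    qed
    also have "\<dots> = 1" using D(1) w(1) by simp
    finally show ?thesis by (simp add: sieve_weight_def)
  qed
  have "(\<Sum>p\<in>P. (cmod (f p))\<^sup>2) = (\<Sum>p\<in>P. ?W p * (cmod (f p))\<^sup>2)"
    by (rule sum.cong[OF refl]) (simp add: Wp)
  also have "\<dots> \<le> (\<Sum>m\<in>{A<..B}. ?W m * (cmod (f m))\<^sup>2)"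
    by (rule sum_mono2) (use P W0 in auto)
  also have "\<dots> \<le> cmod (complex_of_real (\<Sum>m\<in>{A<..B}. ?W m * (cmod (f m))\<^sup>2))"
    unfolding norm_of_real by (rule abs_ge_self)
  also have "complex_of_real (\<Sum>m\<in>{A<..B}. ?W m * (cmod (f m))\<^sup>2) =
     (\<Sum>m\<in>{A<..B}. \<Sum>n\<in>N. \<Sum>n'\<in>N. \<alpha> n * cnj (\<alpha> n') * of_real (?W m * real_of_int (jac m (k n * k n'))))"
    unfolding of_real_sum
  proof (rule sum.cong[OF refl])
    fix m
    have "complex_of_real (?W m * (cmod (f m))\<^sup>2) = of_real (?W m) * (\<Sum>n\<in>N. \<Sum>n'\<in>N. (\<alpha> n * of_int (jac m (k n))) * cnj (\<alpha> n' * of_int (jac m (k n'))))"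
      unfolding of_real_mult f_def norm_square_sum ..
    also have "\<dots> = (\<Sum>n\<in>N. \<Sum>n'\<in>N. of_real (?W m) * ((\<alpha> n * of_int (jac m (k n))) * cnj (\<alpha> n' * of_int (jac m (k n')))))"
      by (simp only: sum_distrib_left)
    also have "\<dots> = (\<Sum>n\<in>N. \<Sum>n'\<in>N. \<alpha> n * cnj (\<alpha> n') * of_real (?W m * real_of_int (jac m (k n * k n'))))"
    proof (rule sum.cong[OF refl], rule sum.cong[OF refl])
      fix n n' assume n: "n \<in> N" "n' \<in> N"
      have "k n \<noteq> 0" "k n' \<noteq> 0" using k n by (metis even_zero)+
      thus "of_real (?W m) * ((\<alpha> n * of_int (jac m (k n))) * cnj (\<alpha> n' * of_int (jac m (k n')))) = \<alpha> n * cnj (\<alpha> n') * of_real (?W m * real_of_int (jac m (k n * k n')))"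
        by (simp add: jac_mult_bottom mult_ac)
    qed
    finally show "complex_of_real (?W m * (cmod (f m))\<^sup>2) = (\<Sum>n\<in>N. \<Sum>n'\<in>N. \<alpha> n * cnj (\<alpha> n') * of_real (?W m * real_of_int (jac m (k n * k n'))))" .
  qed
  also have "\<dots> = (\<Sum>n\<in>N. \<Sum>m\<in>{A<..B}. \<Sum>n'\<in>N. \<alpha> n * cnj (\<alpha> n') * of_real (?W m * real_of_int (jac m (k n * k n'))))"
    by (rule sum.swap)
  also have "\<dots> = (\<Sum>n\<in>N. \<Sum>n'\<in>N. \<Sum>m\<in>{A<..B}. \<alpha> n * cnj (\<alpha> n') * of_real (?W m * real_of_int (jac m (k n * k n'))))"
    by (rule sum.cong[OF refl], rule sum.swap)
  also have "\<dots> = (\<Sum>n\<in>N. \<Sum>n'\<in>N. \<alpha> n * cnj (\<alpha> n') * of_real (\<Sum>m\<in>{A<..B}. ?W m * real_of_int (jac m (k n * k n'))))"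
    by (simp only: sum_distrib_left of_real_sum)
  also have "cmod \<dots> \<le> (\<Sum>n\<in>N. \<Sum>n'\<in>N. (if \<exists>m. k n * k n' = m\<^sup>2 then X else 0) + real D ^ 4 * \<beta>)"
  proof (rule order.trans[OF norm_sum], rule sum_mono, rule order.trans[OF norm_sum], rule sum_mono)
    fix n n' assume n: "n \<in> N" "n' \<in> N"
    define T where "T = (\<Sum>m\<in>{A<..B}. ?W m * real_of_int (jac m (k n * k n')))"
    have ko: "odd (k n * k n')" using k n by simp
    hence k0: "k n * k n' > 0" by (auto intro: Nat.gr0I)
    have "cmod (\<alpha> n * cnj (\<alpha> n') * of_real T) = cmod (\<alpha> n) * cmod (\<alpha> n') * \<bar>T\<bar>"
      by (simp only: norm_mult complex_mod_cnj norm_of_real)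
    also have "\<dots> \<le> 1 * 1 * \<bar>T\<bar>" using \<alpha> n by (intro mult_right_mono mult_mono) auto
    also have "\<bar>T\<bar> \<le> (if \<exists>m. k n * k n' = m\<^sup>2 then X else 0) + real D ^ 4 * \<beta>"
    proof (cases "\<exists>m. k n * k n' = m\<^sup>2")
      case False
      have "\<bar>T\<bar> \<le> real D ^ 4 * \<beta>" unfolding T_def
        by (rule sieve_char_sum[OF w(2) ko AB]) (use \<beta>[OF n False] in auto)
      thus ?thesis using False by (simp only: if_False)
    next
      case True
      have "\<bar>T\<bar> \<le> (\<Sum>m\<in>{A<..B}. ?W m)" unfolding T_def
      proof (rule order.trans[OF sum_abs], rule sum_mono)
        fix m
        have "\<bar>real_of_int (jac m (k n * k n'))\<bar> \<le> 1" using abs_jac_le[OF k0, of m] by linarith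
        hence "\<bar>?W m\<bar> * \<bar>real_of_int (jac m (k n * k n'))\<bar> \<le> ?W m * 1" using W0[of m] by (intro mult_mono) simp_all
        thus "\<bar>?W m * real_of_int (jac m (k n * k n'))\<bar> \<le> ?W m" by (simp add: abs_mult)
      qed
      also have "\<dots> \<le> X" unfolding X_def by (rule sieve_weight_sum[OF w(2) AB w(3)])
      also have "X \<le> X + real D ^ 4 * \<beta>" using \<beta>0 by simp
      finally show ?thesis using True by (simp only: if_True)
    qed
    finally show "cmod (\<alpha> n * cnj (\<alpha> n') * of_real (\<Sum>m\<in>{A<..B}. ?W m * real_of_int (jac m (k n * k n')))) \<le> (if \<exists>m. k n * k n' = m\<^sup>2 then X else 0) + real D ^ 4 * \<beta>"
      by (simp only: T_def mult_1)
  qed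
  also have "\<dots> = (\<Sum>n\<in>N. \<Sum>n'\<in>N. if \<exists>m. k n * k n' = m\<^sup>2 then X else 0) + real (card N) ^ 2 * (real D ^ 4 * \<beta>)"
    by (simp only: sum.distrib sum_constant power2_eq_square mult.assoc)
  also have "(\<Sum>n\<in>N. \<Sum>n'\<in>N. if \<exists>m. k n * k n' = m\<^sup>2 then X else 0) = real (card {(n, n'). n \<in> N \<and> n' \<in> N \<and> (\<exists>m. k n * k n' = m\<^sup>2)}) * X"
  proof -
    have "(\<Sum>n\<in>N. \<Sum>n'\<in>N. if \<exists>m. k n * k n' = m\<^sup>2 then X else 0) = (\<Sum>x\<in>N \<times> N. if \<exists>m. k (fst x) * k (snd x) = m\<^sup>2 then X else 0)"
      by (simp only: sum.cartesian_product case_prod_unfold)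
    also have "\<dots> = (\<Sum>x\<in>{x\<in>N \<times> N. \<exists>m. k (fst x) * k (snd x) = m\<^sup>2}. X)"
      by (rule sum.inter_filter[symmetric]) (use N in simp)
    also have "{x\<in>N \<times> N. \<exists>m. k (fst x) * k (snd x) = m\<^sup>2} = {(n, n'). n \<in> N \<and> n' \<in> N \<and> (\<exists>m. k n * k n' = m\<^sup>2)}" by auto
    finally show ?thesis by simp
  qed
  finally show ?thesis by (simp only: f_def X_def)
qed

section \<open>Reciprocity\<close>

text \<open>The reciprocity sign depends on l only through l modulo 4. For l = p both sides are
  0.\<close>

lemma Legendre_reciprocity_prime:
  assumes p: "prime p" "p > 2" and l: "prime l" "odd l"
  shows "Legendre (int l) p = jac p l * (if l mod 4 = 1 then 1 else (-1) ^ nat ((p - 1) div 2))"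
proof (cases "int l = p")
  case True
  thus ?thesis using l by (simp add: jac_prime Legendre_eq_0_iff)
next
  case False
  have l2: "int l > 2" using l prime_gt_1_nat[of l] by (cases "l = 2") auto
  have "prime (nat p)" using p prime_ge_0_int[of p] by simp
  hence qr: "Legendre p (int l) * Legendre (int l) p = (-1::int) ^ (nat ((p - 1) div 2 * ((int l - 1) div 2)))"
    using p l l2 False by (intro Quadratic_Reciprocity_int) auto
  have "prime (int l)" using l(1) by simp
  hence "\<not> p dvd int l" using primes_dvd_imp_eq[OF p(1)] False by blast
  hence BB: "Legendre (int l) p * Legendre (int l) p = 1"
    using Legendre_square by blast
  define s where "s = (if l mod 4 = 1 then 1 else (-1::int) ^ nat ((p - 1) div 2))"
  have "(-1::int) ^ (nat ((p - 1) div 2 * ((int l - 1) div 2))) = s"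
  proof -
    have "nat ((p - 1) div 2 * ((int l - 1) div 2)) = nat ((p - 1) div 2) * ((l - 1) div 2)"
      using p l2 by (simp add: nat_mult_distrib nat_div_distrib nat_diff_distrib')
    moreover have "even ((l - 1) div 2) \<longleftrightarrow> l mod 4 = 1" using l(2) by presburger
    ultimately show ?thesis by (cases "even ((l - 1) div 2)") (auto simp: s_def power_mult mult.commute[of "nat ((p - 1) div 2)"] uminus_power_if)
  qed
  hence AB: "Legendre p (int l) * Legendre (int l) p = s" using qr by (simp only:)
  have ss: "s * s = 1" by (simp add: s_def flip: power_mult_distrib)
  have "Legendre p (int l) * s = (Legendre p (int l) * (Legendre (int l) p * Legendre (int l) p)) * s"
    by (simp only: BB mult_1_right)
  also have "\<dots> = (Legendre p (int l) * Legendre (int l) p) * s * Legendre (int l) p" by (simp only: mult_ac)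
  also have "\<dots> = Legendre (int l) p" unfolding AB ss by simp
  finally have "Legendre (int l) p = Legendre p (int l) * s" by (rule sym)
  thus ?thesis using l by (simp add: jac_prime s_def)
qed

text \<open>Both sides are multiplicative in \<open>q\<close>, for the residues 1 and 3 modulo 4
  multiply by the rule of signs.\<close>

lemma Legendre_reciprocity_jac:
  assumes p: "prime p" "p > 2" and q: "odd q"
  shows "Legendre (int q) p = jac p q * (if q mod 4 = 1 then 1 else (-1) ^ nat ((p - 1) div 2))"
proof -
  have "q > 0" using q by (auto intro: Nat.gr0I)
  thus ?thesis using q
  proof (induction q rule: prime_decomp_induct)
    case one
    thus ?case using p by simp
  next
    case (mult l q)
    define s where "s = (-1::int) ^ nat ((p - 1) div 2)"
    have ss: "s * s = 1" by (simp add: s_def flip: power_mult_distrib)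
    have o: "odd l" "odd q" using mult.prems by auto
    have l: "Legendre (int l) p = jac p l * (if l mod 4 = 1 then 1 else s)"
      unfolding s_def by (rule Legendre_reciprocity_prime[OF p mult.hyps(1) o(1)])
    have r: "Legendre (int q) p = jac p q * (if q mod 4 = 1 then 1 else s)"
      unfolding s_def by (rule mult.IH[OF o(2)])
    have j: "jac p (l * q) = jac p l * jac p q" using mult prime_gt_0_nat[of l] by (intro jac_mult_bottom) auto
    have "l mod 4 = 1 \<or> l mod 4 = 3" "q mod 4 = 1 \<or> q mod 4 = 3" using o by presburger+
    hence m: "(l * q) mod 4 = 1 \<longleftrightarrow> (l mod 4 = 1 \<longleftrightarrow> q mod 4 = 1)"
      by (subst mod_mult_eq[symmetric]) auto
    have "(if l mod 4 = 1 then 1 else s) * (if q mod 4 = 1 then 1 else s) = (if (l * q) mod 4 = 1 then 1 else s)"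
      unfolding m using ss by simp
    moreover have "Legendre (int (l * q)) p = Legendre (int l) p * Legendre (int q) p"
      by (simp add: Legendre_mult[OF p])
    hence "Legendre (int (l * q)) p = (jac p l * jac p q) * ((if l mod 4 = 1 then 1 else s) * (if q mod 4 = 1 then 1 else s))"
      unfolding l r by (simp only: mult_ac)
    ultimately show ?case unfolding j s_def[symmetric] by (simp only:)
  qed
qed

definition odd_part :: "int \<Rightarrow> nat" where
  "odd_part n = nat n div 2 ^ multiplicity 2 (nat n)"

text \<open>On each class the reciprocity factor is one and the same function of p: (2/p) enters
  through the parity of the 2-adic valuation, the sign through the odd part modulo 4.\<close>

definition int_class :: "int \<Rightarrow> bool \<times> bool" where
  "int_class n = (even (multiplicity 2 (nat n)), odd_part n mod 4 = 1)"

lemma odd_part: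
  assumes "n > 0"
  shows "nat n = 2 ^ multiplicity 2 (nat n) * odd_part n" "odd (odd_part n)"
proof -
  have d: "2 ^ multiplicity 2 (nat n) dvd nat n" by (rule multiplicity_dvd)
  thus 1: "nat n = 2 ^ multiplicity 2 (nat n) * odd_part n" by (simp add: odd_part_def)
  show "odd (odd_part n)" unfolding odd_part_def
    using multiplicity_decompose[of "nat n" 2] assms by simp
qed

definition class_unit :: "int \<Rightarrow> bool \<times> bool \<Rightarrow> int" where
  "class_unit p c = (if fst c then 1 else Legendre 2 p) * (if snd c then 1 else (-1) ^ nat ((p - 1) div 2))"

lemma Legendre_odd_part:
  assumes p: "prime p" "p > 2" and n: "n > 0"
  shows "Legendre n p = class_unit p (int_class n) * jac p (odd_part n)"
proof -
  define v where "v = multiplicity 2 (nat n)"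
  have n': "n = 2 ^ v * int (odd_part n)"
    using arg_cong[OF odd_part(1)[OF n], of int] n by (simp add: v_def)
  have "\<not> p dvd 2" using p zdvd_not_zless[of 2 p] by auto
  hence sq: "Legendre 2 p * Legendre 2 p = 1" using Legendre_square by blast
  have pw: "Legendre (2 ^ k) p = (if even k then 1 else Legendre 2 p)" for k
    by (induction k) (use p sq in \<open>simp_all add: Legendre_mult\<close>)
  have "Legendre n p = Legendre (2 ^ v) p * Legendre (int (odd_part n)) p"
    using arg_cong[OF n', of "\<lambda>x. Legendre x p"] by (simp add: Legendre_mult[OF p])
  thus ?thesis unfolding pw Legendre_reciprocity_jac[OF p odd_part(2)[OF n]]
    by (simp add: class_unit_def int_class_def v_def)
qed

lemma abs_class_unit_le: "\<bar>class_unit p c\<bar> \<le> 1"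
  using Legendre_values[of 2 p] by (auto simp: class_unit_def abs_mult power_abs)

text \<open>Cauchy-Schwarz over the four classes costs the factor 4, and the class factors have
  modulus at most 1.\<close>

lemma norm_S_p_le:
  assumes p: "prime p" "p > 2" and u: "u > 0"
  shows "(cmod (S_p p \<alpha> u h))\<^sup>2 \<le> 4 * (\<Sum>c\<in>UNIV. (cmod (\<Sum>n\<in>{n\<in>{u<..u+h}. int_class n = c}. \<alpha> n * of_int (jac p (odd_part n))))\<^sup>2)"
proof -
  let ?f = "\<lambda>c. \<Sum>n\<in>{n\<in>{u<..u+h}. int_class n = c}. \<alpha> n * complex_of_int (jac p (odd_part n))"
  have "S_p p \<alpha> u h = (\<Sum>c\<in>UNIV. \<Sum>n\<in>{n\<in>{u<..u+h}. int_class n = c}. \<alpha> n * of_int (Legendre n p))"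
    unfolding S_p_def by (rule sum.group[symmetric]) auto
  also have "\<dots> = (\<Sum>c\<in>UNIV. of_int (class_unit p c) * ?f c)"
  proof (rule sum.cong[OF refl])
    fix c
    have "(\<Sum>n\<in>{n\<in>{u<..u+h}. int_class n = c}. \<alpha> n * of_int (Legendre n p)) = (\<Sum>n\<in>{n\<in>{u<..u+h}. int_class n = c}. of_int (class_unit p c) * (\<alpha> n * of_int (jac p (odd_part n))))"
    proof (rule sum.cong[OF refl])
      fix n assume "n \<in> {n\<in>{u<..u+h}. int_class n = c}"
      hence "n > 0" "int_class n = c" using u by auto
      thus "\<alpha> n * of_int (Legendre n p) = of_int (class_unit p c) * (\<alpha> n * complex_of_int (jac p (odd_part n)))"
        using Legendre_odd_part[OF p] by (simp add: mult_ac)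
    qed
    thus "(\<Sum>n\<in>{n\<in>{u<..u+h}. int_class n = c}. \<alpha> n * of_int (Legendre n p)) = of_int (class_unit p c) * ?f c"
      by (simp only: sum_distrib_left)
  qed
  finally have S: "S_p p \<alpha> u h = (\<Sum>c\<in>UNIV. of_int (class_unit p c) * ?f c)" .
  have "cmod (S_p p \<alpha> u h) \<le> (\<Sum>c\<in>UNIV. 1 * cmod (?f c))"
    unfolding S
  proof (rule order.trans[OF norm_sum], rule sum_mono)
    fix c
    have "cmod (of_int (class_unit p c)) \<le> 1" using abs_class_unit_le[of p c] by simp
    thus "cmod (of_int (class_unit p c) * ?f c) \<le> 1 * cmod (?f c)"
      unfolding norm_mult by (rule mult_right_mono) simp
  qed
  hence "(cmod (S_p p \<alpha> u h))\<^sup>2 \<le> (\<Sum>c\<in>UNIV. 1 * cmod (?f c))\<^sup>2" by (rule power_mono) simp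
  also have "\<dots> \<le> (\<Sum>c\<in>(UNIV::(bool \<times> bool) set). 1\<^sup>2) * (\<Sum>c\<in>UNIV. (cmod (?f c))\<^sup>2)"
    by (rule Cauchy_Schwarz_ineq_sum)
  also have "(\<Sum>c\<in>(UNIV::(bool \<times> bool) set). 1\<^sup>2) = (4::real)" by (simp add: card_prod flip: UNIV_Times_UNIV)
  finally show ?thesis .
qed

section \<open>Pairs with square product\<close>

definition square_pairs :: "nat \<Rightarrow> nat \<Rightarrow> (nat \<times> nat) set" where
  "square_pairs U H = {(m, n). m \<in> {U<..U+H} \<and> n \<in> {U<..U+H} \<and> (\<exists>j. m * n = j\<^sup>2)}"

text \<open>Within a class the 2-adic valuations have equal parity, so a square product of odd parts
  makes the full product a square; the pairs can then be counted without reference to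
  classes.\<close>

lemma class_pairs_le:
  fixes u h :: int and c :: "bool \<times> bool"
  assumes "u > 0" "h \<ge> 0"
  defines "N \<equiv> {n\<in>{u<..u+h}. int_class n = c}"
  shows "card {(n, n'). n \<in> N \<and> n' \<in> N \<and> (\<exists>m. odd_part n * odd_part n' = m\<^sup>2)} \<le> card (square_pairs (nat u) (nat h))"
proof (rule card_inj_on_le)
  let ?E = "{(n, n'). n \<in> N \<and> n' \<in> N \<and> (\<exists>m. odd_part n * odd_part n' = m\<^sup>2)}"
  show "inj_on (\<lambda>(n, n'). (nat n, nat n')) ?E"
    using assms(1) by (auto simp: inj_on_def N_def)
  show "(\<lambda>(n, n'). (nat n, nat n')) ` ?E \<subseteq> square_pairs (nat u) (nat h)"
  proof (rule image_subsetI)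
    fix x assume x: "x \<in> ?E"
    obtain n n' m where x': "x = (n, n')" "n \<in> N" "n' \<in> N" "odd_part n * odd_part n' = m\<^sup>2" using x by auto
    define v v' where "v = multiplicity 2 (nat n)" and "v' = multiplicity 2 (nat n')"
    have "int_class n = int_class n'" using x' by (simp add: N_def)
    hence "even (v + v')" by (auto simp: int_class_def v_def v'_def)
    then obtain r where r: "v + v' = 2 * r" by (rule evenE) (rule that)
    have "n > 0" "n' > 0" using x' assms(1) by (auto simp: N_def)
    hence "nat n * nat n' = (2 ^ v * odd_part n) * (2 ^ v' * odd_part n')"
      using odd_part(1) unfolding v_def v'_def by metis
    also have "\<dots> = 2 ^ (v + v') * (odd_part n * odd_part n')" by (simp add: power_add)
    also have "\<dots> = (2 ^ r * m)\<^sup>2" unfolding x'(4) r by (simp add: power_mult_distrib power_mult mult.commute[of 2 r])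
    finally have "\<exists>j. nat n * nat n' = j\<^sup>2" by blast
    moreover have "nat n \<in> {nat u<..nat u + nat h}" "nat n' \<in> {nat u<..nat u + nat h}"
      using x'(2,3) assms(1,2) by (auto simp: N_def)
    ultimately show "(\<lambda>(n, n'). (nat n, nat n')) x \<in> square_pairs (nat u) (nat h)"
      by (simp add: x'(1) square_pairs_def)
  qed
  show "finite (square_pairs (nat u) (nat h))"
    by (rule finite_subset[of _ "{nat u<..nat u + nat h} \<times> {nat u<..nat u + nat h}"]) (auto simp: square_pairs_def)
qed

text \<open>The squarefree part records the parity of each multiplicity, and a square product forces
  equal parities.\<close>

lemma square_product_squarefree_part:
  assumes "m > 0" "n > 0" "m * n = j\<^sup>2"
  shows "squarefree_part m = squarefree_part (n :: nat)"
proof (rule multiplicity_eq_nat)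
  show "squarefree_part m > 0" "squarefree_part n > 0" by (simp_all add: zero_less_iff_neq_zero)
  fix p :: nat assume p: "prime p"
  have j: "j \<noteq> 0" using assms by (intro notI) simp
  have "multiplicity p m + multiplicity p n = multiplicity p (m * n)"
    using assms p by (subst prime_elem_multiplicity_mult_distrib) auto
  also have "\<dots> = 2 * multiplicity p j" unfolding assms(3) using p j by (subst prime_elem_multiplicity_power_distrib) auto
  finally have "multiplicity p m mod 2 = multiplicity p n mod 2" by presburger
  thus "multiplicity p (squarefree_part m) = multiplicity p (squarefree_part n)"
    using p assms by (simp add: prime_multiplicity_squarefree_part)
qed

text \<open>The members are d k^2 with k between a and b. From d (b^2 - a^2) <= H and d a >= sqrt(U
  d) the spread b - a is at most H / (2 sqrt(U d)).\<close>

lemma square_class_card_le: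
  fixes U H d :: nat
  assumes U: "U > 0" and d: "d > 0"
  defines "A \<equiv> {n\<in>{U<..U+H}. squarefree_part n = d}"
  shows "real (card A) \<le> 1 + H / (2 * sqrt (real U * real d))"
proof (cases "A = {}")
  case False
  define R where "R = square_part ` A"
  have dec: "n = d * (square_part n)\<^sup>2" if "n \<in> A" for n
    using squarefree_decompose[of n] that by (simp add: A_def)
  have finA: "finite A" by (simp add: A_def)
  have inj: "inj_on square_part A" by (rule inj_onI) (metis dec)
  have R: "finite R" "R \<noteq> {}" using finA False by (auto simp: R_def)
  define a b where "a = Min R" and "b = Max R"
  have ab: "a \<in> R" "b \<in> R" "a \<le> b" using R by (auto simp: a_def b_def)
  have "R \<subseteq> {a..b}" using R by (auto simp: a_def b_def)
  hence "card R \<le> b - a + 1" using card_mono[of "{a..b}" R] ab by simp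
  hence c: "real (card A) \<le> real b - real a + 1" using ab card_image[OF inj] by (simp add: R_def)
  have "d * a\<^sup>2 > U" "d * b\<^sup>2 \<le> U + H"
    using ab dec by (auto simp: R_def A_def)
  hence "real U < real (d * a\<^sup>2)" "real (d * b\<^sup>2) \<le> real (U + H)" by (simp_all only: of_nat_less_iff of_nat_le_iff)
  hence A: "real U < real d * (real a)\<^sup>2" "real d * (real b)\<^sup>2 \<le> real U + real H" by simp_all
  have "sqrt (real U * real d) \<le> real d * real a"
  proof (rule real_le_lsqrt)
    have "real U * real d \<le> (real d * (real a)\<^sup>2) * real d" using A(1) by (intro mult_right_mono) simp_all
    thus "real U * real d \<le> (real d * real a)\<^sup>2" by (simp add: power2_eq_square mult_ac)
  qed simp_all
  hence "2 * sqrt (real U * real d) \<le> real d * (real a + real b)" using ab d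
    by (smt (verit) distrib_left mult_left_mono of_nat_0_le_iff of_nat_le_iff)
  hence "(real b - real a) * (2 * sqrt (real U * real d)) \<le> (real b - real a) * (real d * (real a + real b))"
    using ab by (intro mult_left_mono) simp_all
  also have "\<dots> = real d * (real b)\<^sup>2 - real d * (real a)\<^sup>2" by (simp add: power2_eq_square algebra_simps)
  also have "\<dots> \<le> H" using A by linarith
  finally have "(real b - real a) * (2 * sqrt (real U * real d)) \<le> H" .
  hence "real b - real a \<le> H / (2 * sqrt (real U * real d))" using U d by (simp add: pos_le_divide_eq)
  thus ?thesis using c by linarith
qed simp

text \<open>A square product forces equal squarefree parts, so the pairs are controlled by the
  squared sizes of these classes.\<close>

lemma card_square_pairs:
  fixes U H :: nat
  assumes U: "U > 0"
  shows "real (card (square_pairs U H)) \<le> (\<Sum>d\<in>{1..U+H}. (real (card {n\<in>{U<..U+H}. squarefree_part n = d}))\<^sup>2)"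
    "(\<Sum>d\<in>{1..U+H}. real (card {n\<in>{U<..U+H}. squarefree_part n = d})) = H"
proof -
  let ?A = "\<lambda>d. {n\<in>{U<..U+H}. squarefree_part n = d}"
  have sf: "squarefree_part n \<in> {1..U+H}" if "n \<in> {U<..U+H}" for n
  proof -
    have "squarefree_part n dvd n" using squarefree_decompose[of n] by (metis dvd_triv_left)
    hence "squarefree_part n \<le> n" using that by (intro dvd_imp_le) auto
    moreover have "1 \<le> squarefree_part n" by (rule Suc_leI[of 0, unfolded One_nat_def[symmetric]], rule Nat.gr0I) simp
    ultimately show ?thesis using that unfolding atLeastAtMost_iff greaterThanAtMost_iff by linarith
  qed
  have "square_pairs U H \<subseteq> (\<Union>d\<in>{1..U+H}. ?A d \<times> ?A d)"
  proof
    fix x assume "x \<in> square_pairs U H"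
    then obtain m n j where x: "x = (m, n)" "m \<in> {U<..U+H}" "n \<in> {U<..U+H}" "m * n = j\<^sup>2" by (auto simp: square_pairs_def)
    have "squarefree_part m = squarefree_part n"
      by (rule square_product_squarefree_part[OF _ _ x(4)]) (use x U in auto)
    thus "x \<in> (\<Union>d\<in>{1..U+H}. ?A d \<times> ?A d)" using x sf[OF x(2)] by auto
  qed
  hence "card (square_pairs U H) \<le> card (\<Union>d\<in>{1..U+H}. ?A d \<times> ?A d)" by (intro card_mono) auto
  also have "\<dots> \<le> (\<Sum>d\<in>{1..U+H}. card (?A d \<times> ?A d))" by (rule card_UN_le) simp
  finally have "real (card (square_pairs U H)) \<le> real (\<Sum>d\<in>{1..U+H}. card (?A d \<times> ?A d))" by (simp only: of_nat_le_iff)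
  thus "real (card (square_pairs U H)) \<le> (\<Sum>d\<in>{1..U+H}. (real (card (?A d)))\<^sup>2)"
    by (simp add: card_cartesian_product power2_eq_square)
  have "card {U<..U+H} = (\<Sum>d\<in>{1..U+H}. card (?A d))"
  proof -
    have "(\<Sum>n\<in>{U<..U+H}. 1::nat) = (\<Sum>d\<in>{1..U+H}. \<Sum>n\<in>?A d. 1)"
      by (rule sum.group[symmetric]) (use sf in auto)
    thus ?thesis by simp
  qed
  thus "(\<Sum>d\<in>{1..U+H}. real (card (?A d))) = H" by (simp flip: of_nat_sum)
qed

text \<open>For H^2 <= U each class has at most 1 + 1/2 members, so only diagonal pairs
  survive.\<close>

lemma card_square_pairs_sparse:
  assumes U: "U > 0" and H: "H\<^sup>2 \<le> U"
  shows "card (square_pairs U H) \<le> H"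
proof -
  let ?A = "\<lambda>d. {n\<in>{U<..U+H}. squarefree_part n = d}"
  have le: "real (card (?A d)) ^ 2 \<le> real (card (?A d))" if "d \<in> {1..U+H}" for d
  proof -
    have "real (card (?A d)) \<le> 1 + H / (2 * sqrt (real U * real d))"
      using that by (intro square_class_card_le U) simp
    moreover have "H / (2 * sqrt (real U * real d)) \<le> 1 / 2"
    proof -
      have "real (H\<^sup>2) \<le> real (U * d)" unfolding of_nat_le_iff using H that
        by (metis atLeastAtMost_iff le_trans mult.right_neutral mult_le_mono2)
      hence "real H \<le> sqrt (real U * real d)" by (intro real_le_rsqrt) simp
      thus ?thesis using U that by (simp add: pos_divide_le_eq)
    qed
    ultimately have "real (card (?A d)) < 2" by linarith
    hence "card (?A d) = 0 \<or> card (?A d) = 1" by linarith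
    thus ?thesis by (elim disjE; simp only: of_nat_0 of_nat_1 power2_eq_square mult_zero_left mult_1 order_refl)
  qed
  have "real (card (square_pairs U H)) \<le> (\<Sum>d\<in>{1..U+H}. real (card (?A d)))"
    by (rule order.trans[OF card_square_pairs(1)[OF U, of H]], rule sum_mono, rule le)
  thus ?thesis unfolding card_square_pairs(2)[OF U] by simp
qed

lemma harm_upper: "H \<ge> 1 \<Longrightarrow> (\<Sum>d\<in>{1..H}. 1 / real d) \<le> 1 + ln (real H)"
proof (induction H rule: dec_induct)
  case (step H)
  have "ln (real H / real (Suc H)) \<le> real H / real (Suc H) - 1" using step by (intro ln_le_minus_one) simp
  hence "1 / real (Suc H) \<le> ln (real (Suc H)) - ln (real H)" using step by (simp add: ln_div field_simps)
  thus ?case using step by simp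
qed simp

text \<open>A class of n >= 2 members has n <= 1 + x with x >= 1, hence n^2 - n <= 2 x^2 = H^2/(2 U
  d) <= H/(2 d); moreover x >= 1 and U > H force d <= H. Summation over d produces the
  logarithm.\<close>

lemma card_square_pairs_le:
  assumes H: "H \<ge> 2" "H < U"
  shows "real (card (square_pairs U H)) \<le> 4 * real H * ln (real H)"
proof -
  let ?A = "\<lambda>d. {n\<in>{U<..U+H}. squarefree_part n = d}"
  have U: "U > 0" using H by simp
  have le: "real (card (?A d)) ^ 2 \<le> real (card (?A d)) + (if d \<le> H then H / 2 * (1 / real d) else 0)" if d: "d \<in> {1..U+H}" for d
  proof -
    define n where "n = card (?A d)"
    define x where "x = H / (2 * sqrt (real U * real d))"
    have nx: "real n \<le> 1 + x" unfolding n_def x_def using d by (intro square_class_card_le U) simp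
    have x0: "x \<ge> 0" by (simp add: x_def)
    show ?thesis
    proof (cases "n \<le> 1")
      case True
      hence "n = 0 \<or> n = 1" by linarith
      thus ?thesis unfolding n_def[symmetric] by auto
    next
      case False
      hence x1: "x \<ge> 1" using nx by linarith
      have x2: "x ^ 2 = (real H)\<^sup>2 / (4 * (real U * real d))"
        by (simp add: x_def power_divide power_mult_distrib)
      have d0: "real d > 0" using d by simp
      have "1 ^ 2 \<le> x ^ 2" using x1 by (intro power_mono) simp_all
      hence "4 * (real U * real d) \<le> (real H)\<^sup>2" unfolding x2 using U d0 by (simp add: pos_le_divide_eq)
      moreover have "real H * real d \<le> real U * real d" using H by (intro mult_right_mono) simp_all
      ultimately have "real H * (4 * real d) \<le> real H * real H" by (simp add: power2_eq_square)
      hence "4 * real d \<le> real H" using H by (simp add: mult_le_cancel_left)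
      hence dH: "d \<le> H" by linarith
      have "real n ^ 2 - real n = real n * (real n - 1)" by (simp add: power2_eq_square algebra_simps)
      also have "\<dots> \<le> (x + x) * x" using nx x1 False by (intro mult_mono) auto
      also have "\<dots> = 2 * x ^ 2" by (simp add: power2_eq_square)
      also have "\<dots> = (real H / real U) * (H / 2 * (1 / real d))" unfolding x2 using U d0 by (simp add: field_simps power2_eq_square)
      also have "\<dots> \<le> 1 * (H / 2 * (1 / real d))" using H U by (intro mult_right_mono) simp_all
      finally show ?thesis unfolding n_def[symmetric] using dH by (simp only: if_True)
    qed
  qed
  have "real (card (square_pairs U H)) \<le> (\<Sum>d\<in>{1..U+H}. real (card (?A d)) + (if d \<le> H then H / 2 * (1 / real d) else 0))"
    by (rule order.trans[OF card_square_pairs(1)[OF U, of H]], rule sum_mono, rule le)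
  also have "\<dots> = H + (\<Sum>d\<in>{1..U+H}. if d \<le> H then H / 2 * (1 / real d) else 0)"
    unfolding sum.distrib card_square_pairs(2)[OF U] ..
  also have "(\<Sum>d\<in>{1..U+H}. if d \<le> H then H / 2 * (1 / real d) else 0) = (\<Sum>d\<in>{d\<in>{1..U+H}. d \<le> H}. H / 2 * (1 / real d))"
    by (rule sum.inter_filter[symmetric]) simp
  also have "{d\<in>{1..U+H}. d \<le> H} = {1..H}" by auto
  also have "(\<Sum>d\<in>{1..H}. H / 2 * (1 / real d)) = H / 2 * (\<Sum>d\<in>{1..H}. 1 / real d)" by (simp only: sum_distrib_left)
  also have "\<dots> \<le> H / 2 * (1 + ln (real H))" using H by (intro mult_left_mono harm_upper) simp_all
  finally have "real (card (square_pairs U H)) \<le> real H + real H / 2 * (1 + ln (real H))" by (simp only: add_left_mono)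
  also have "\<dots> = real H * (3/2 + ln (real H) / 2)" by (simp add: field_simps)
  also have "\<dots> \<le> real H * (4 * ln (real H))"
  proof (rule mult_left_mono)
    have "ln 2 \<le> ln (real H)" using H by simp
    thus "3/2 + ln (real H) / 2 \<le> 4 * ln (real H)" using ln2_ge_two_thirds by linarith
  qed simp
  finally show ?thesis by simp
qed

section \<open>The second moment\<close>

text \<open>16 = 4 * 4: Cauchy-Schwarz over the classes, then the number of classes. The moduli are
  bounded by 4 u^2 rather than 4 Q^2, since small u is exploited later.\<close>

lemma M2_sieve_bound:
  fixes u h :: int
  assumes hu: "2 \<le> h" "h < u" "real_of_int u \<le> Q" and \<alpha>: "\<And>n. n \<in> {u<..u+h} \<Longrightarrow> cmod (\<alpha> n) \<le> 1"
    and D: "D \<ge> 1" "real D \<le> Q - 1" and \<beta>0: "\<beta> \<ge> 0"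
    and \<beta>: "\<And>K A B. odd K \<Longrightarrow> \<not> (\<exists>m. K = m\<^sup>2) \<Longrightarrow> real K \<le> 4 * (real_of_int u)\<^sup>2 \<Longrightarrow> A \<le> B \<Longrightarrow> real_of_int (B - A) \<le> 2 * Q \<Longrightarrow>
       \<bar>real_of_int (\<Sum>j\<in>{A<..B}. jac j K)\<bar> \<le> \<beta>"
  shows "M2 Q \<alpha> u h \<le> 16 * (real (card (square_pairs (nat u) (nat h))) * (2 * Q / selberg_G D + real D ^ 4) + (real_of_int h)\<^sup>2 * (real D ^ 4 * \<beta>))"
proof -
  \<comment> \<open>Subtracting 1 from the ceiling keeps a prime equal to Q inside the half-open
    interval.\<close>
  define A B where "A = \<lceil>Q\<rceil> - 1" and "B = \<lfloor>2 * Q\<rfloor>"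
  define P where "P = {p :: int. prime p \<and> Q \<le> real_of_int p \<and> real_of_int p \<le> 2 * Q}"
  define N where "N = (\<lambda>c. {n\<in>{u<..u+h}. int_class n = c})"
  have Q3: "Q \<ge> 3" using hu by linarith
  have AB: "A \<le> B" "real_of_int (B - A) \<le> 2 * Q" using Q3 unfolding A_def B_def by linarith+
  have G1: "selberg_G D \<ge> 1" by (rule selberg_G_ge_1[OF D(1)])
  define X where "X = real (card (square_pairs (nat u) (nat h))) * (2 * Q / selberg_G D + real D ^ 4) + (real_of_int h)\<^sup>2 * (real D ^ 4 * \<beta>)"
  have PA: "prime p \<and> A < p \<and> p \<le> B" if "p \<in> P" for p
    using that unfolding P_def A_def B_def by (auto simp: le_floor_iff) linarith
  have "finite P" by (rule finite_subset[of _ "{A<..B}"]) (use PA in auto)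
  have cls: "(\<Sum>p\<in>P. (cmod (\<Sum>n\<in>N c. \<alpha> n * of_int (jac p (odd_part n))))\<^sup>2) \<le> X" for c
  proof -
    have finN: "finite (N c)" unfolding N_def by (rule finite_subset[of _ "{u<..u+h}"]) auto
    have NI: "n \<in> {u<..u+h}" "n > 0" if "n \<in> N c" for n using that hu by (auto simp: N_def)
    have op: "real (odd_part n) \<le> 2 * real_of_int u" if n: "n \<in> N c" for n
    proof -
      have "1 * odd_part n \<le> 2 ^ multiplicity 2 (nat n) * odd_part n" by (rule mult_right_mono) simp_all
      hence "odd_part n \<le> nat n" using odd_part(1)[OF NI(2)[OF n]] by linarith
      thus ?thesis using NI[OF n] hu by simp linarith
    qed
    have "(\<Sum>p\<in>P. (cmod (\<Sum>n\<in>N c. \<alpha> n * of_int (jac p (odd_part n))))\<^sup>2) \<le>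
       real (card {(n, n'). n \<in> N c \<and> n' \<in> N c \<and> (\<exists>m. odd_part n * odd_part n' = m\<^sup>2)}) * (real_of_int (B - A) / selberg_G D + real D ^ 4)
       + real (card (N c)) ^ 2 * (real D ^ 4 * \<beta>)"
    proof (rule sieve_inequality[OF D(1) _ AB(1) finN _ _ _ _ \<beta>0])
      show "int D \<le> A" using D(2) unfolding A_def by linarith
      show "cmod (\<alpha> n) \<le> 1" "odd (odd_part n)" if "n \<in> N c" for n using NI[OF that] \<alpha> odd_part(2) by blast+
      show "prime p \<and> A < p \<and> p \<le> B" if "p \<in> P" for p by (rule PA[OF that])
      fix n n' A' B' assume n: "n \<in> N c" "n' \<in> N c" "\<not> (\<exists>m. odd_part n * odd_part n' = m\<^sup>2)" "A' \<le> B'" "B' - A' \<le> B - A"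
      have "real (odd_part n) * real (odd_part n') \<le> (2 * real_of_int u) * (2 * real_of_int u)"
        using op n hu by (intro mult_mono) simp_all
      hence "real (odd_part n * odd_part n') \<le> 4 * (real_of_int u)\<^sup>2" by (simp add: power2_eq_square)
      moreover have "odd (odd_part n * odd_part n')" using NI n odd_part(2) by simp
      moreover have "real_of_int (B' - A') \<le> 2 * Q" using n(5) AB(2) by linarith
      ultimately show "\<bar>real_of_int (\<Sum>j\<in>{A'<..B'}. jac j (odd_part n * odd_part n'))\<bar> \<le> \<beta>"
        using n by (intro \<beta>) simp_all
    qed
    also have "\<dots> \<le> X" unfolding X_def
    proof (rule add_mono)
      have "card {(n, n'). n \<in> N c \<and> n' \<in> N c \<and> (\<exists>m. odd_part n * odd_part n' = m\<^sup>2)} \<le> card (square_pairs (nat u) (nat h))"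
        unfolding N_def using hu by (intro class_pairs_le) simp_all
      moreover have "real_of_int (B - A) / selberg_G D \<le> 2 * Q / selberg_G D" using AB(2) G1 by (intro divide_right_mono) simp_all
      moreover have "0 \<le> real_of_int (B - A) / selberg_G D" using AB(1) G1 by simp
      ultimately show "real (card {(n, n'). n \<in> N c \<and> n' \<in> N c \<and> (\<exists>m. odd_part n * odd_part n' = m\<^sup>2)}) * (real_of_int (B - A) / selberg_G D + real D ^ 4)
        \<le> real (card (square_pairs (nat u) (nat h))) * (2 * Q / selberg_G D + real D ^ 4)"
        by (intro mult_mono add_right_mono add_nonneg_nonneg) simp_all
      have "card (N c) \<le> card {u<..u+h}" unfolding N_def by (intro card_mono) auto
      hence "real (card (N c)) \<le> real_of_int h" using hu by simp
      thus "real (card (N c)) ^ 2 * (real D ^ 4 * \<beta>) \<le> (real_of_int h)\<^sup>2 * (real D ^ 4 * \<beta>)"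
        using \<beta>0 by (intro mult_right_mono power_mono) simp_all
    qed
    finally show ?thesis .
  qed
  have "M2 Q \<alpha> u h = (\<Sum>p\<in>P. (cmod (S_p p \<alpha> u h))\<^sup>2)" by (simp add: M2_def P_def)
  also have "\<dots> \<le> (\<Sum>p\<in>P. 4 * (\<Sum>c\<in>UNIV. (cmod (\<Sum>n\<in>N c. \<alpha> n * of_int (jac p (odd_part n))))\<^sup>2))"
  proof (rule sum_mono)
    fix p assume "p \<in> P"
    hence "prime p" "p > 2" using Q3 by (auto simp: P_def)
    thus "(cmod (S_p p \<alpha> u h))\<^sup>2 \<le> 4 * (\<Sum>c\<in>UNIV. (cmod (\<Sum>n\<in>N c. \<alpha> n * of_int (jac p (odd_part n))))\<^sup>2)"
      unfolding N_def using hu by (intro norm_S_p_le) simp_all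
  qed
  also have "\<dots> = 4 * (\<Sum>c\<in>UNIV. \<Sum>p\<in>P. (cmod (\<Sum>n\<in>N c. \<alpha> n * of_int (jac p (odd_part n))))\<^sup>2)"
    unfolding sum_distrib_left[symmetric] by (subst sum.swap) (rule refl)
  also have "\<dots> \<le> 4 * (\<Sum>c\<in>(UNIV :: (bool \<times> bool) set). X)"
    by (intro mult_left_mono sum_mono cls) simp
  also have "\<dots> = 16 * X" by (simp add: card_prod flip: UNIV_Times_UNIV)
  finally show ?thesis by (simp only: X_def)
qed

lemma M2_trivial_bound:
  fixes u h :: int
  assumes hu: "2 \<le> h" "h < u" "real_of_int u \<le> Q" and \<alpha>: "\<And>n. n \<in> {u<..u+h} \<Longrightarrow> cmod (\<alpha> n) \<le> 1"
  shows "M2 Q \<alpha> u h \<le> 2 * Q * (real_of_int h)\<^sup>2"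
proof -
  define P where "P = {p :: int. prime p \<and> Q \<le> real_of_int p \<and> real_of_int p \<le> 2 * Q}"
  have Q3: "Q \<ge> 3" using hu by linarith
  have sub: "P \<subseteq> {0<..\<lfloor>2 * Q\<rfloor>}"
  proof
    fix p assume p: "p \<in> P"
    hence "p > 0" using prime_gt_0_int[of p] by (simp add: P_def)
    moreover have "p \<le> \<lfloor>2 * Q\<rfloor>" using p by (simp add: P_def le_floor_iff)
    ultimately show "p \<in> {0<..\<lfloor>2 * Q\<rfloor>}" by simp
  qed
  have "card P \<le> card {0<..\<lfloor>2 * Q\<rfloor>}" by (rule card_mono[OF _ sub]) simp
  hence c: "real (card P) \<le> 2 * Q" using Q3 by simp linarith
  have "cmod (S_p p \<alpha> u h) \<le> real_of_int h" for p
  proof -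
    have "cmod (S_p p \<alpha> u h) \<le> (\<Sum>n\<in>{u<..u+h}. 1 * 1)"
      unfolding S_p_def
    proof (rule order.trans[OF norm_sum], rule sum_mono)
      fix n assume "n \<in> {u<..u+h}"
      moreover have "cmod (of_int (Legendre n p)) \<le> 1" using Legendre_values[of n p] by auto
      ultimately show "cmod (\<alpha> n * of_int (Legendre n p)) \<le> 1 * 1"
        unfolding norm_mult using \<alpha> by (intro mult_mono) simp_all
    qed
    thus ?thesis using hu by simp
  qed
  hence "M2 Q \<alpha> u h \<le> (\<Sum>p\<in>P. (real_of_int h)\<^sup>2)"
    unfolding M2_def P_def[symmetric] by (intro sum_mono power_mono) simp_all
  also have "\<dots> = real (card P) * (real_of_int h)\<^sup>2" by simp
  also have "\<dots> \<le> 2 * Q * (real_of_int h)\<^sup>2" using c by (intro mult_right_mono) simp_all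
  finally show ?thesis .
qed

text \<open>The estimate at a single \<open>Q\<close> with a fixed exponent loss, so that the
  constant stays independent of \<epsilon> when \<epsilon> is later chosen in terms of
  \<open>Q\<close>.\<close>

definition M2_bound :: "real \<Rightarrow> real \<Rightarrow> real \<Rightarrow> bool" where
  "M2_bound c Q \<epsilon> \<longleftrightarrow> (\<forall>(h::int) (u::int) (\<alpha>::int \<Rightarrow> complex).
       2 \<le> h \<and> h < u \<and> real_of_int u \<le> Q \<and> (\<forall>n\<in>{u<..u+h}. cmod (\<alpha> n) \<le> 1) \<longrightarrow>
       M2 Q \<alpha> u h \<le> c * (real_of_int h * real (prime_pi Q) * ln (real_of_int h)
                        + (real_of_int h)\<^sup>2 * Q powr (7/8 + \<epsilon>)))"

text \<open>12816 = 4 * 801 * 4: the pair count, the sieve factor 800 + 1, and Chebyshev's Q / ln Q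
  <= 4 pi(Q).\<close>

lemma combine_bounds:
  fixes m a b c x z :: real
  assumes "m \<le> 16 * (a + b)" "a \<le> c" "c \<le> 12816 * x" "b \<le> x" "0 \<le> x" "0 \<le> z"
  shows "m \<le> 300000 * (x + z)"
proof -
  have "a + b \<le> 12817 * x" using assms by simp
  hence "16 * (a + b) \<le> 16 * (12817 * x)" by simp
  also have "\<dots> \<le> 300000 * x" using assms by simp
  also have "\<dots> \<le> 300000 * (x + z)" using assms by simp
  finally show ?thesis using assms by simp
qed

text \<open>240 = 3 * 80 is needed when only diagonal pairs occur: 2 Q + 1 <= 3 Q and Q <= 80 pi(Q)
  log h.\<close>

lemma combine_bounds':
  fixes m a b x z :: real
  assumes "m \<le> 16 * (a + b)" "a \<le> 240 * x + z" "b \<le> z" "0 \<le> x" "0 \<le> z"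
  shows "m \<le> 300000 * (x + z)"
proof -
  have "a + b \<le> 240 * x + 2 * z" using assms by simp
  hence "16 * (a + b) \<le> 16 * (240 * x + 2 * z)" by simp
  also have "\<dots> \<le> 300000 * (x + z)" using assms by simp
  finally show ?thesis using assms by simp
qed

text \<open>The limit 1/50 on \<epsilon> is for the range h <= Q^(1/20), where the nonsquare pairs,
  enlarged by the sieve, have to be absorbed in h pi(Q) log h.\<close>

lemma M2_bound_eventually_small:
  fixes \<epsilon> :: real
  assumes \<epsilon>: "0 < \<epsilon>" "\<epsilon> \<le> 1/50"
  shows "\<forall>\<^sub>F Q in at_top. M2_bound 300000 Q \<epsilon>"
proof -
  obtain C where C: "C > 0" "\<And>K A B Q. odd K \<Longrightarrow> \<not> (\<exists>m. K = m\<^sup>2) \<Longrightarrow> Q \<ge> 1 \<Longrightarrow> real K \<le> 4 * Q\<^sup>2 \<Longrightarrow> A \<le> B \<Longrightarrow>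
     real_of_int (B - A) \<le> 2 * Q \<Longrightarrow> \<bar>real_of_int (\<Sum>n\<in>{A<..B}. jac n K)\<bar> \<le> C * Q powr (7/8 + \<epsilon>/2)"
    using jac_interval_burgess[of "\<epsilon>/2"] \<epsilon>(1) by (metis half_gt_zero)
  have ev1: "\<forall>\<^sub>F Q::real in at_top. C \<le> Q powr (\<epsilon>/2)" using \<epsilon>(1) C(1) by real_asymp
  have ev2: "\<forall>\<^sub>F Q::real in at_top. 4 * ln Q * (2 + 1) \<le> Q powr \<epsilon>" using \<epsilon>(1) by real_asymp
  have ev3: "\<forall>\<^sub>F Q::real in at_top. Q powr (1/200) + 1 \<le> Q powr (1/100)" by real_asymp
  \<comment> \<open>Exponents of the two sieved ranges: 1/20 + 1/25 + 7/8 + 1/50 = 197/200, and 1/8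
    + 1/25 + 1/2 = 133/200 in the next line, both below 1. The 1/25 is the cost D^4 for D <=
    Q^(1/100).\<close>
  have ev4: "\<forall>\<^sub>F Q::real in at_top. Q powr (1/20 + 1/25 + (7/8 + 1/50)) \<le> Q / (8 * ln Q)" by real_asymp
  have ev5: "\<forall>\<^sub>F Q::real in at_top. Q powr (1/8 + 1/25) * (4 * Q powr (1/2)) \<le> Q / (8 * ln Q)" by real_asymp
  have ev6: "\<forall>\<^sub>F Q::real in at_top. Q powr (1/25) \<le> Q / ln Q" by real_asymp
  have ev7: "\<forall>\<^sub>F Q::real in at_top. Q powr (1/100) \<le> Q - 1" by real_asymp
  have ev8: "\<forall>\<^sub>F Q::real in at_top. Q \<ge> 3" by (rule eventually_ge_at_top)
  show ?thesis using ev1 ev2 ev3 ev4 ev5 ev6 ev7 ev8 prime_pi_lower_bound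
  proof eventually_elim
    case (elim Q)
    note e = elim
    have lnQ: "ln Q > 0" using e by simp
    show "M2_bound 300000 Q \<epsilon>"
      unfolding M2_bound_def
    proof (intro allI impI, elim conjE)
      fix h u :: int and \<alpha> :: "int \<Rightarrow> complex"
      assume hu: "2 \<le> h" "h < u" "real_of_int u \<le> Q" and \<alpha>: "\<forall>n\<in>{u<..u+h}. cmod (\<alpha> n) \<le> 1"
      define H where "H = real_of_int h"
      define L where "L = ln H"
      define \<pi> where "\<pi> = real (prime_pi Q)"
      define p where "p = card (square_pairs (nat u) (nat h))"
      define Z where "Z = Q powr (7/8 + \<epsilon>)"
      have H: "H \<ge> 2" "H \<le> Q" using hu unfolding H_def by linarith+
      have L: "L \<ge> 1/2" "L \<le> ln Q"
      proof -
        have "ln 2 \<le> L" unfolding L_def using H by simp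
        thus "L \<ge> 1/2" using ln2_ge_two_thirds by linarith
        show "L \<le> ln Q" unfolding L_def using H by simp
      qed
      have pi: "\<pi> \<ge> Q / (4 * ln Q)" unfolding \<pi>_def using e by blast
      have Z0: "Z \<ge> 0" by (simp add: Z_def)
      have pi0: "\<pi> \<ge> 0" by (simp add: \<pi>_def)
      have pairs: "real p \<le> 4 * H * L"
        using card_square_pairs_le[of "nat h" "nat u"] hu by (simp add: p_def H_def L_def nat_less_iff)
      define b where "b = C * Q powr (7/8 + \<epsilon>/2)"
      have b0: "b \<ge> 0" using C(1) by (simp add: b_def)
      have bZ: "b \<le> Z"
      proof -
        have "b \<le> Q powr (\<epsilon>/2) * Q powr (7/8 + \<epsilon>/2)" unfolding b_def using e by (intro mult_right_mono) simp_all
        also have "\<dots> = Q powr (\<epsilon>/2 + (7/8 + \<epsilon>/2))" by (simp only: powr_add)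
        also have "\<epsilon>/2 + (7/8 + \<epsilon>/2) = 7/8 + \<epsilon>" by simp
        finally show ?thesis by (simp only: Z_def)
      qed
      have bb: "\<bar>real_of_int (\<Sum>j\<in>{A<..B}. jac j K)\<bar> \<le> b" 
        if "odd K" "\<not> (\<exists>m. K = m\<^sup>2)" "real K \<le> 4 * (real_of_int u)\<^sup>2" "A \<le> B" "real_of_int (B - A) \<le> 2 * Q" for K A B
        unfolding b_def
      proof (rule C(2)[OF that(1,2) _ _ that(4,5)])
        have "(real_of_int u)\<^sup>2 \<le> Q\<^sup>2" using hu by (intro power_mono) simp_all
        thus "real K \<le> 4 * Q\<^sup>2" using that(3) by linarith
      qed (use e in simp)
      \<comment> \<open>Level 1 means no sieving: every integer has weight 1.\<close>
      have D1: "M2 Q \<alpha> u h \<le> 16 * (real p * (2 * Q + 1) + H\<^sup>2 * b)"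
        using M2_sieve_bound[OF hu, of \<alpha> 1 b] \<alpha> bb b0 e by (simp add: p_def H_def selberg_G_def)
      define D where "D = nat \<lfloor>Q powr (1/100)\<rfloor>"
      have Dle: "real D \<le> Q powr (1/100)" unfolding D_def by simp
      \<comment> \<open>Rounding down is paid for by halving the exponent, whence the 400 in the
        bound for \<open>selberg_G D\<close>.\<close>
      have Dge: "real D \<ge> Q powr (1/200)" using e unfolding D_def by linarith
      have Q200: "Q powr (1/200) \<ge> 1" using e by (simp add: ge_one_powr_ge_zero)
      have D1': "D \<ge> 1" using Dge Q200 by linarith
      have D4: "real D ^ 4 \<le> Q powr (1/25)"
      proof -
        have "real D ^ 4 \<le> (Q powr (1/100)) ^ 4" using Dle by (intro power_mono) simp_all
        thus ?thesis using e by (simp add: powr_power)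
      qed
      have G: "selberg_G D \<ge> ln Q / 400"
      proof -
        have "ln (Q powr (1/200)) \<le> ln (real D)" using Dge e D1' by (subst ln_le_cancel_iff) simp_all
        hence "ln Q / 200 \<le> ln (real D)" using e by (simp add: ln_powr)
        thus ?thesis using selberg_G_ge_ln[OF D1'] by linarith
      qed
      \<comment> \<open>Level \<open>D\<close> gains ln Q on the square pairs; \<open>small\<close>
        lets the nonsquare pairs, enlarged by D^4, hide in \<open>H * \<pi> * L\<close>.\<close>
      have sieved: "M2 Q \<alpha> u h \<le> 300000 * (H * \<pi> * L + H\<^sup>2 * Z)"
        if \<beta>0: "\<beta> \<ge> 0" and small: "H * Q powr (1/25) * \<beta> \<le> Q / (8 * ln Q)"
        and \<beta>: "\<And>K A B. odd K \<Longrightarrow> \<not> (\<exists>m. K = m\<^sup>2) \<Longrightarrow> real K \<le> 4 * (real_of_int u)\<^sup>2 \<Longrightarrow> A \<le> B \<Longrightarrow> real_of_int (B - A) \<le> 2 * Q \<Longrightarrow>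
          \<bar>real_of_int (\<Sum>j\<in>{A<..B}. jac j K)\<bar> \<le> \<beta>" for \<beta>
      proof -
        have DQ: "real D \<le> Q - 1" using Dle e by linarith
        have "M2 Q \<alpha> u h \<le> 16 * (real p * (2 * Q / selberg_G D + real D ^ 4) + H\<^sup>2 * (real D ^ 4 * \<beta>))"
          unfolding p_def H_def by (rule M2_sieve_bound[OF hu _ D1' DQ \<beta>0 \<beta>]) (use \<alpha> in blast)+
        moreover have "real p * (2 * Q / selberg_G D + real D ^ 4) \<le> (4 * H * L) * (801 * (Q / ln Q))"
        proof (rule mult_mono[OF pairs])
          have "selberg_G D > 0" using selberg_G_ge_1[OF D1'] by linarith
          moreover have "0 < ln Q / 400" using lnQ by simp
          ultimately have "0 < selberg_G D * (ln Q / 400)" by (rule mult_pos_pos)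
          moreover have "0 \<le> 2 * Q" using e by linarith
          ultimately have "2 * Q / selberg_G D \<le> 2 * Q / (ln Q / 400)" by (intro divide_left_mono[OF G])
          also have "\<dots> = 800 * (Q / ln Q)" by simp
          finally show "2 * Q / selberg_G D + real D ^ 4 \<le> 801 * (Q / ln Q)" using D4 e by linarith
          have "0 \<le> 2 * Q" using e by linarith
          thus "0 \<le> 2 * Q / selberg_G D + real D ^ 4"
            using selberg_G_ge_1[OF D1'] by (intro add_nonneg_nonneg divide_nonneg_nonneg) simp_all
        qed (use H L in simp)
        moreover have "(4 * H * L) * (801 * (Q / ln Q)) \<le> 12816 * (H * \<pi> * L)"
        proof -
          have "Q / ln Q \<le> 4 * \<pi>" using pi lnQ by (simp add: field_simps)
          hence "(4 * H * L * 801) * (Q / ln Q) \<le> (4 * H * L * 801) * (4 * \<pi>)" using H L by (intro mult_left_mono) simp_all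
          thus ?thesis by (simp add: mult_ac)
        qed
        moreover have "H\<^sup>2 * (real D ^ 4 * \<beta>) \<le> H * \<pi> * L"
        proof -
          have "H\<^sup>2 * (real D ^ 4 * \<beta>) = H * (H * real D ^ 4 * \<beta>)" by (simp add: power2_eq_square)
          also have "\<dots> \<le> H * (H * Q powr (1/25) * \<beta>)" using H D4 \<beta>0 by (intro mult_left_mono mult_right_mono) simp_all
          also have "\<dots> \<le> H * (Q / (8 * ln Q))" using small H by (intro mult_left_mono) simp_all
          also have "\<dots> = H * (Q / (4 * ln Q)) * (1/2)" by simp
          also have "\<dots> \<le> H * \<pi> * L" using pi H L e lnQ pi0 by (intro mult_mono mult_left_mono) simp_all
          finally show ?thesis .
        qed
        moreover have "H * \<pi> * L \<ge> 0" "H\<^sup>2 * Z \<ge> 0" using H L pi0 Z0 by simp_all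
        ultimately show ?thesis by (rule combine_bounds)
      qed
      have fin: "M2 Q \<alpha> u h \<le> 300000 * (H * \<pi> * L + H\<^sup>2 * Z)"
      proof -
        consider "H \<ge> Q powr (1/8)" | "(nat h)\<^sup>2 \<le> nat u" "H > Q powr (1/20)" 
          | "H \<le> Q powr (1/20)" | "H < Q powr (1/8)" "nat u < (nat h)\<^sup>2" by linarith
        thus ?thesis
        proof cases
          case 1
          \<comment> \<open>Without sieving a logarithm is lost, but it fits into Q^\<epsilon>, and
            Q <= H * Q^(7/8).\<close>
          have "real p * (2 * Q + 1) \<le> (4 * H * L) * (3 * Q)" using pairs e H L by (intro mult_mono) simp_all
          also have "\<dots> = H * ((4 * L * (2 + 1)) * Q)" by simp
          also have "\<dots> \<le> H * (Q powr \<epsilon> * Q)"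
          proof (intro mult_left_mono mult_right_mono)
            have "4 * L * (2 + 1) \<le> 4 * ln Q * (2 + 1)" using L by simp
            thus "4 * L * (2 + 1) \<le> Q powr \<epsilon>" using e by linarith
          qed (use H in simp_all)
          also have "Q powr \<epsilon> * Q = Q powr (1/8) * Z"
          proof -
            have "Q powr (1/8) * Z = Q powr (1/8 + (7/8 + \<epsilon>))" unfolding Z_def by (simp only: powr_add)
            also have "1/8 + (7/8 + \<epsilon>) = \<epsilon> + 1" by simp
            also have "Q powr (\<epsilon> + 1) = Q powr \<epsilon> * Q" using e by (simp add: powr_add)
            finally show ?thesis by (rule sym)
          qed
          also have "H * (Q powr (1/8) * Z) \<le> H * (H * Z)" using 1 H Z0 by (intro mult_left_mono mult_right_mono) simp_all
          finally have a: "real p * (2 * Q + 1) \<le> H\<^sup>2 * Z" by (simp add: power2_eq_square)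
          have "H\<^sup>2 * b \<le> H\<^sup>2 * Z" using bZ by (intro mult_left_mono) simp_all
          moreover have nn: "H * \<pi> * L \<ge> 0" "H\<^sup>2 * Z \<ge> 0" using H L pi0 Z0 by simp_all
          moreover have "real p * (2 * Q + 1) \<le> 240 * (H * \<pi> * L) + H\<^sup>2 * Z" using a nn(1) by (simp add: add_increasing)
          ultimately show ?thesis using D1 by (intro combine_bounds'[OF D1])
        next
          case 2
          \<comment> \<open>The diagonal alone lacks the factor log h of the claim, and for h >
            Q^(1/20) this factor makes up for the ln Q between Q and pi(Q).\<close>
          have "p \<le> nat h" unfolding p_def using hu 2 by (intro card_square_pairs_sparse) simp_all
          hence "real p \<le> H" using hu by (simp add: H_def)
          hence "real p * (2 * Q + 1) \<le> H * (3 * Q)" using e H by (intro mult_mono) simp_all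
          moreover have "H * Q \<le> 80 * (H * \<pi> * L)"
          proof -
            have "ln (Q powr (1/20)) \<le> L" unfolding L_def using 2 e H by (subst ln_le_cancel_iff) simp_all
            hence "ln Q / 20 \<le> L" using e by (simp add: ln_powr)
            hence "Q / (4 * ln Q) * (ln Q / 20) \<le> \<pi> * L" using pi e lnQ pi0 by (intro mult_mono) simp_all
            hence "Q / 80 \<le> \<pi> * L" using lnQ by simp
            hence "H * (Q / 80) \<le> H * (\<pi> * L)" using H by (intro mult_left_mono) simp_all
            thus ?thesis by simp
          qed
          moreover have "H\<^sup>2 * b \<le> H\<^sup>2 * Z" using bZ by (intro mult_left_mono) simp_all
          moreover have "H * \<pi> * L \<ge> 0" "H\<^sup>2 * Z \<ge> 0" using H L pi0 Z0 by simp_all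
          ultimately show ?thesis by (intro combine_bounds'[OF D1]) simp_all
        next
          case 3
          have "H * Q powr (1/25) * b \<le> Q / (8 * ln Q)"
          proof -
            have "H * Q powr (1/25) * b \<le> Q powr (1/20) * Q powr (1/25) * Q powr (7/8 + 1/50)"
            proof (intro mult_mono)
              have "Z \<le> Q powr (7/8 + 1/50)" unfolding Z_def using e \<epsilon> by (intro powr_mono) simp_all
              thus "b \<le> Q powr (7/8 + 1/50)" using bZ by linarith
            qed (use 3 b0 H in simp_all)
            also have "\<dots> = Q powr (1/20 + 1/25 + (7/8 + 1/50))" by (simp only: powr_add)
            also have "\<dots> \<le> Q / (8 * ln Q)" using e by blast
            finally show ?thesis .
          qed
          thus ?thesis by (rule sieved[OF b0 _ bb])
        next
          case 4
          \<comment> \<open>Here u <= h^2 <= Q^(1/4), so the moduli are at most 4 Q^(1/2), and the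
            trivial bound by the modulus is small enough to sieve.\<close>
          define U where "U = real_of_int u"
          have "real (nat u) \<le> real ((nat h)\<^sup>2)" using 4(2) by (simp only: of_nat_le_iff)
          hence "U \<le> H\<^sup>2" using hu by (simp add: U_def H_def)
          also have "\<dots> \<le> (Q powr (1/8))\<^sup>2" using 4(1) H by (intro power_mono) simp_all
          also have "\<dots> = Q powr (1/4)" using e by (simp add: powr_power)
          finally have "U\<^sup>2 \<le> (Q powr (1/4))\<^sup>2" using hu by (intro power_mono) (simp_all add: U_def)
          also have "\<dots> = Q powr (1/2)" using e by (simp add: powr_power)
          finally have U2: "U\<^sup>2 \<le> Q powr (1/2)" .
          have "H * Q powr (1/25) * (4 * Q powr (1/2)) \<le> Q powr (1/8) * Q powr (1/25) * (4 * Q powr (1/2))"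
            using 4(1) by (intro mult_right_mono) simp_all
          also have "\<dots> = Q powr (1/8 + 1/25) * (4 * Q powr (1/2))" by (simp only: powr_add)
          also have "\<dots> \<le> Q / (8 * ln Q)" using e by blast
          finally have small: "H * Q powr (1/25) * (4 * Q powr (1/2)) \<le> Q / (8 * ln Q)" .
          show ?thesis
          proof (rule sieved[OF _ small])
            fix K :: nat and A B :: int assume K: "odd K" "\<not> (\<exists>m. K = m\<^sup>2)" "real K \<le> 4 * (real_of_int u)\<^sup>2" "A \<le> B"
            have "\<bar>real_of_int (\<Sum>j\<in>{A<..B}. jac j K)\<bar> \<le> real K" by (rule jac_interval_trivial[OF K(1,2,4)])
            thus "\<bar>real_of_int (\<Sum>j\<in>{A<..B}. jac j K)\<bar> \<le> 4 * Q powr (1/2)"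
              using K(3) U2 unfolding U_def by linarith
          qed simp
        qed
      qed
      thus "M2 Q \<alpha> u h \<le> 300000 * (real_of_int h * real (prime_pi Q) * ln (real_of_int h) + (real_of_int h)\<^sup>2 * Q powr (7/8 + \<epsilon>))"
        by (simp only: H_def \<pi>_def L_def Z_def)
    qed
  qed
qed

section \<open>From fixed exponents to o(1)\<close>

lemma M2_bound_mono:
  assumes "M2_bound c Q \<epsilon>" "\<epsilon> \<le> \<epsilon>'" "c \<ge> 0"
  shows "M2_bound c Q \<epsilon>'"
  unfolding M2_bound_def
proof (intro allI impI)
  fix h u :: int and \<alpha> :: "int \<Rightarrow> complex"
  assume hu: "2 \<le> h \<and> h < u \<and> real_of_int u \<le> Q \<and> (\<forall>n\<in>{u<..u+h}. cmod (\<alpha> n) \<le> 1)"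
  hence "Q \<ge> 1" by linarith
  hence "Q powr (7/8 + \<epsilon>) \<le> Q powr (7/8 + \<epsilon>')" using assms(2) by (intro powr_mono) simp_all
  hence "c * (real_of_int h * real (prime_pi Q) * ln (real_of_int h) + (real_of_int h)\<^sup>2 * Q powr (7/8 + \<epsilon>))
     \<le> c * (real_of_int h * real (prime_pi Q) * ln (real_of_int h) + (real_of_int h)\<^sup>2 * Q powr (7/8 + \<epsilon>'))"
    using assms(3) by (intro mult_left_mono add_left_mono) simp_all
  thus "M2 Q \<alpha> u h \<le> c * (real_of_int h * real (prime_pi Q) * ln (real_of_int h) + (real_of_int h)\<^sup>2 * Q powr (7/8 + \<epsilon>'))"
    using assms(1) hu unfolding M2_bound_def by (meson order_trans)
qed

text \<open>The trivial bound gives \<epsilon> = 1 at every \<open>Q\<close>; this is the default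
  where the asymptotic estimate does not yet apply.\<close>

lemma M2_bound_1: 
  assumes "c \<ge> 2"
  shows "M2_bound c Q 1"
  unfolding M2_bound_def
proof (intro allI impI)
  fix h u :: int and \<alpha> :: "int \<Rightarrow> complex"
  assume hu: "2 \<le> h \<and> h < u \<and> real_of_int u \<le> Q \<and> (\<forall>n\<in>{u<..u+h}. cmod (\<alpha> n) \<le> 1)"
  hence Q: "Q \<ge> 1" by linarith
  have "M2 Q \<alpha> u h \<le> 2 * Q * (real_of_int h)\<^sup>2" using hu by (intro M2_trivial_bound) blast+
  also have "\<dots> = 2 * ((real_of_int h)\<^sup>2 * Q powr 1)" using Q by simp
  also have "\<dots> \<le> c * ((real_of_int h)\<^sup>2 * Q powr (7/8 + 1))"
    using assms Q by (intro mult_mono mult_left_mono powr_mono) simp_all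
  also have "\<dots> \<le> c * (real_of_int h * real (prime_pi Q) * ln (real_of_int h) + (real_of_int h)\<^sup>2 * Q powr (7/8 + 1))"
    using assms hu by (intro mult_left_mono) simp_all
  finally show "M2 Q \<alpha> u h \<le> c * (real_of_int h * real (prime_pi Q) * ln (real_of_int h) + (real_of_int h)\<^sup>2 * Q powr (7/8 + 1))" .
qed

text \<open>A diagonal choice: at each \<open>Q\<close> the smallest admissible 1/n with n <= Q, or
  1 if there is none. The cap n <= Q keeps the set finite, and each fixed n is admissible for all
  large \<open>Q\<close>.\<close>

lemma eventually_small_parameter:
  fixes P :: "real \<Rightarrow> real \<Rightarrow> bool"
  assumes ev: "\<And>e. e > 0 \<Longrightarrow> \<forall>\<^sub>F Q in at_top. P Q e" and one: "\<And>Q. P Q 1"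
  obtains \<epsilon> where "(\<epsilon> \<longlongrightarrow> 0) at_top" "\<And>Q. P Q (\<epsilon> Q)"
proof -
  define S where "S = (\<lambda>Q. {n::nat. 1 \<le> n \<and> real n \<le> Q \<and> P Q (1 / real n)})"
  define \<epsilon> where "\<epsilon> = (\<lambda>Q. if S Q = {} then 1 else 1 / real (Max (S Q)))"
  have fin: "finite (S Q)" for Q
    by (rule finite_subset[of _ "{..nat \<lfloor>Q\<rfloor>}"]) (auto simp: S_def le_nat_floor)
  have P: "P Q (\<epsilon> Q)" for Q
  proof (cases "S Q = {}")
    case False
    hence M: "Max (S Q) \<in> S Q" using fin by simp
    have "P Q (1 / real n)" if "n \<in> S Q" for n using that by (simp add: S_def)
    from this[OF M] show ?thesis using False by (simp only: \<epsilon>_def if_False)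
  qed (simp add: \<epsilon>_def one)
  have "(\<epsilon> \<longlongrightarrow> 0) at_top"
  proof (rule tendstoI)
    fix e :: real assume "e > 0"
    then obtain n where n: "n > 0" "1 / real n < e" using nat_approx_posE[of e] by (metis zero_less_Suc)
    have "\<forall>\<^sub>F Q in at_top. P Q (1 / real n) \<and> Q \<ge> real n"
      using n by (intro eventually_conj ev eventually_ge_at_top) simp
    thus "\<forall>\<^sub>F Q in at_top. dist (\<epsilon> Q) 0 < e"
    proof eventually_elim
      case (elim Q)
      hence nS: "n \<in> S Q" using n by (simp add: S_def)
      hence le: "n \<le> Max (S Q)" using fin by simp
      have "1 / real (Max (S Q)) \<le> 1 / real n" using le n(1) by (intro divide_left_mono) simp_all
      thus ?case using nS n by (auto simp: \<epsilon>_def)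
    qed
  qed
  thus ?thesis using that P by blast
qed

lemma M2_nonneg: "M2 Q \<alpha> u h \<ge> 0"
  unfolding M2_def by (intro sum_nonneg) simp

theorem theorem1p1:
  shows "\<exists>c > 0. \<exists>\<epsilon> :: real \<Rightarrow> real. (\<epsilon> \<longlongrightarrow> 0) at_top \<and>
    (\<forall>(Q::real) (h::int) (u::int) (\<alpha>::int \<Rightarrow> complex).
       2 \<le> h \<and> h < u \<and> real_of_int u \<le> Q \<and> (\<forall>n\<in>{u<..u+h}. cmod (\<alpha> n) \<le> 1) \<longrightarrow>
       \<bar>M2 Q \<alpha> u h\<bar> \<le> c * (real_of_int h * real (prime_pi Q) * ln (real_of_int h)
                        + (real_of_int h)\<^sup>2 * Q powr (7/8 + \<epsilon> Q)))"
proof -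
  have "\<forall>\<^sub>F Q in at_top. M2_bound 300000 Q e" if "e > 0" for e
  proof -
    have "\<forall>\<^sub>F Q in at_top. M2_bound 300000 Q (min e (1/50))"
      using that by (intro M2_bound_eventually_small) simp_all
    \<comment> \<open>Monotonicity in the exponent undoes the cap at 1/50.\<close>
    thus ?thesis by eventually_elim (rule M2_bound_mono, auto)
  qed
  then obtain \<epsilon> where \<epsilon>: "(\<epsilon> \<longlongrightarrow> 0) at_top" "\<And>Q. M2_bound 300000 Q (\<epsilon> Q)"
    using eventually_small_parameter[of "M2_bound 300000"] M2_bound_1[of 300000] by auto
  show ?thesis
  proof (intro exI[of _ 300000] exI[of _ \<epsilon>] conjI)
    show "\<forall>Q h u \<alpha>. 2 \<le> h \<and> h < u \<and> real_of_int u \<le> Q \<and> (\<forall>n\<in>{u<..u+h}. cmod (\<alpha> n) \<le> 1) \<longrightarrow>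
       \<bar>M2 Q \<alpha> u h\<bar> \<le> 300000 * (real_of_int h * real (prime_pi Q) * ln (real_of_int h) + (real_of_int h)\<^sup>2 * Q powr (7/8 + \<epsilon> Q))"
      using \<epsilon>(2) M2_nonneg unfolding M2_bound_def by (simp add: abs_of_nonneg)
  qed (use \<epsilon> in simp_all)
qed

end
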